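(* Let $N\ge 1$ be an integer and let $\frac{2N}{N+1}<p<2$. For $a>0$ consider the initial value problem $$\left(|f'|^{p-2}f'\right)'(r)+\frac{N-1}{r}\left(|f'|^{p-2}f'\right)(r)+f(r)-|f'(r)|^{p-1}=0,\quad r\in(0,\infty),\qquad f(0)=a,\quad f'(0)=0. \qquad (\ast)$$ Given $a>0$, there is a unique solution $f(\cdot;a)\in C^1([0,\infty))$ to $(\ast)$ such that $(|f'|^{p-2}f')(\cdot;a)\in C^1([0,\infty))$. Furthermore, there exists a unique $a_*>0$ such that $f(r;a_* )>0$ for all $r\ge 0$ and there is $c_*>0$ such that $$f(r;a_* )\sim c_*\, r^{-(N-1)/(p-1)}e^{-r/(p-1)}\quad\text{as } r\to\infty.$$ Moreover, the following complete classification of the behavior of the solutions $f(\cdot;a)$ to $(\ast)$ holds: (a) For $a\in(0,a_* )$, $f(r;a)>0$ for all $r\ge 0$ and $$f(r;a)\sim\left(\frac{2-p}{p-1}\,r\right)^{-(p-1)/(2-p)}\quad\text{as } r\to\infty.$$ (b) For $a\in(a_*,\infty)$, there exists $R(a)\in(0,\infty)$ such that $f(r;a)>0$ for $r\in(0,R(a))$, $f(R(a);a)=0$, and $f'(R(a);a)<0$. In particular, $f(\cdot;a)$ changes sign in $(0,\infty)$.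
   Context: The notation $F(r)\sim G(r)$ as $r\to\infty$ means $\lim_{r\to\infty}F(r)/G(r)=1$. The expression $|f'|^{p-2}f'$ is understood to be $0$ where $f'=0$ (recall $p>1$). *)

theory Defs
  imports "HOL-Analysis.Analysis" "HOL-Library.Landau_Symbols"
begin

text \<open>
  Functions on the half-line are represented by total functions on the reals whose values at
  negative arguments are irrelevant: derivatives are taken within \<open>{0..}\<close>, that is,
  they are right derivatives at \<open>0\<close> and ordinary derivatives elsewhere.
\<close>

definition deriv_halfline :: "(real \<Rightarrow> real) \<Rightarrow> real \<Rightarrow> real" where
  "deriv_halfline f r = vector_derivative f (at r within {0..})"

definition C1_halfline :: "(real \<Rightarrow> real) \<Rightarrow> bool" where
  "C1_halfline f \<longleftrightarrow> f differentiable_on {0..} \<and> continuous_on {0..} (deriv_halfline f)"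

text \<open>The value at \<open>x = 0\<close> is \<open>0\<close>, also for \<open>p < 2\<close>.\<close>

definition p_flux :: "real \<Rightarrow> real \<Rightarrow> real" where
  "p_flux p x = \<bar>x\<bar> powr (p - 2) * x"

definition is_solution :: "nat \<Rightarrow> real \<Rightarrow> real \<Rightarrow> (real \<Rightarrow> real) \<Rightarrow> bool" where
  "is_solution N p a f \<longleftrightarrow>
     C1_halfline f \<and>
     C1_halfline (\<lambda>r. p_flux p (deriv_halfline f r)) \<and>
     (\<forall>r>0. deriv_halfline (\<lambda>s. p_flux p (deriv_halfline f s)) r
            + (real N - 1) / r * p_flux p (deriv_halfline f r)
            + f r - \<bar>deriv_halfline f r\<bar> powr (p - 1) = 0) \<and>
     f 0 = a \<and> deriv_halfline f 0 = 0"

definition fast_decay :: "nat \<Rightarrow> real \<Rightarrow> (real \<Rightarrow> real) \<Rightarrow> bool" where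
  "fast_decay N p f \<longleftrightarrow>
     (\<forall>r\<ge>0. f r > 0) \<and>
     (\<exists>c>0. f \<sim>[at_top] (\<lambda>r. c * r powr (- (real N - 1) / (p - 1)) * exp (- r / (p - 1))))"

end

theory Submission
  imports Defs
begin

text \<open>
  With \<open>m = 1 / (p - 1) > 1\<close> and \<open>w = - \<bar>f'\<bar> powr (p - 2) * f'\<close> the equation becomes the system
  \<open>f' = - \<bar>w\<bar> powr (m - 1) * w\<close>, \<open>w' = f - (N - 1) / r * w - \<bar>w\<bar>\<close>, whose nonlinearity is locally Lipschitz;
  the singular term has a sign that makes the square distance of two solutions grow at most
  exponentially, and the energy \<open>f\<^sup>2 / 2 + \<bar>w\<bar> powr (m + 1) / (m + 1)\<close> prevents blow-up.

  As long as \<open>f > 0\<close> one has \<open>w > 0\<close>, and in the variable \<open>t\<close> with \<open>dt = r ^ (N - 1) * exp r * dr\<close> the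
  function \<open>y = r ^ (N - 1) * exp r * w\<close> solves the Emden-Fowler equation \<open>y'' + Q * y powr m = 0\<close>, where
  \<open>Q = (r ^ (N - 1) * exp r) powr (- (m + 1))\<close>, with \<open>y = 0\<close> and \<open>y' = f = a\<close> at \<open>t = 0\<close>. Fast decay means that \<open>y\<close> stays
  bounded, and a zero of \<open>f\<close> is a critical point of \<open>y\<close>. The Pohozaev function
  \<open>y' * (t * y' - y) / 2 + t * Q * y powr (m + 1) / (m + 1)\<close> first increases and then decreases, hence is
  positive along crossing and along fast solutions. As in the work of Yanagida, for such a solution \<open>y1\<close> and a
  solution \<open>y2\<close> with larger initial value this forces \<open>y2 / y1\<close> to decrease, so that \<open>y2\<close> must cross. The
  crossing values therefore form an up-closed open set; slow decay takes place exactly when \<open>(f, w)\<close> enters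
  the invariant region \<open>f < delta\<close>, \<open>w < 2 * f\<close>, which is an open condition on \<open>a\<close> as well. The infimum of the
  crossing values belongs to neither set.
\<close>

section \<open>Real functions of one variable\<close>

text \<open>The derivative of the Pohozaev function is a positive factor times
  \<open>theta - gain\<close>, where \<open>gain\<close> increases with \<open>r\<close> from
  (N-1)/N at 0 to 1 at infinity. As m > 1 gives theta < 1, and as subcriticality is precisely
  (N-1)/N < theta, this weight changes sign exactly once.

  Fast and slow solutions are both positive and decreasing, so no sign condition separates them.
  What does is the quotient h = f/w, which obeys h' = h (damp - h) - w^(m-1). Once w is small this
  is nearly a logistic equation: its equilibrium 1 attracts (slow decay), its equilibrium 0 repels
  (fast decay is exceptional). The invariant region is h > 1/2 with f small; it is recognised at a
  single radius, which is why slow decay is an open condition.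

  That crossing happens at all for large a is a concentration argument. A solution that stays
  positive has a flux, hence a Pohozaev value, bounded at a fixed radius independently of a; but the
  Pohozaev value gathered close to 0 is at least a power of a, with an exponent that is positive
  exactly when m is subcritical.\<close>

lemma first_zero:
  fixes h :: "real \<Rightarrow> real"
  assumes cont: "continuous_on {a..b} h" and "a \<le> b" "h a < 0" "h b \<ge> 0"
  obtains s where "a < s" "s \<le> b" "h s = 0" "\<And>x. a \<le> x \<Longrightarrow> x < s \<Longrightarrow> h x < 0"
proof -
  define Z where "Z = {x \<in> {a..b}. h x = 0}"
  have IV: "\<exists>z\<in>Z. z \<le> x" if x: "a \<le> x" "x \<le> b" "h x \<ge> 0" for x
  proof -
    have "continuous_on {a..x} h"
      using cont x by (auto intro: continuous_on_subset)
    then obtain z where "a \<le> z" "z \<le> x" "h z = 0"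
      using IVT'[of h a 0 x] x \<open>h a < 0\<close> by force
    then show ?thesis using x by (auto simp: Z_def)
  qed
  have ne: "Z \<noteq> {}" using IV[of b] assms by auto
  have "closed Z"
    unfolding Z_def using continuous_closed_preimage_constant[OF cont, of 0] by simp
  moreover have bdd: "bdd_below Z" by (auto simp: Z_def bdd_below_def)
  ultimately have "Inf Z \<in> Z" using ne closed_contains_Inf by blast
  moreover have "h x < 0" if x: "a \<le> x" "x < Inf Z" for x
  proof (rule ccontr)
    assume "\<not> h x < 0"
    moreover have "x \<le> b" using x \<open>Inf Z \<in> Z\<close> by (auto simp: Z_def)
    ultimately obtain z where "z \<in> Z" "z \<le> x" using IV[of x] x by auto
    with x cInf_lower[OF _ bdd, of z] show False by auto
  qed
  moreover have "Inf Z \<noteq> a" using \<open>Inf Z \<in> Z\<close> assms by (auto simp: Z_def)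
  ultimately show ?thesis by (intro that[of "Inf Z"]) (auto simp: Z_def)
qed

text \<open>At a first zero reached from below the left slope cannot be negative. In
  \<open>step\<close> the sign of \<open>h\<close> on the whole of \<open>[a, s)\<close> is
  available, so the derivative at \<open>s\<close> may be computed from facts that hold only as long
  as the barrier has not been met.\<close>

lemma barrier:
  fixes h :: "real \<Rightarrow> real"
  assumes cont: "continuous_on {a..b} h" and "a \<le> b" "h a < 0"
    and step: "\<And>s. a < s \<Longrightarrow> s \<le> b \<Longrightarrow> h s = 0 \<Longrightarrow> (\<And>x. a \<le> x \<Longrightarrow> x < s \<Longrightarrow> h x < 0) \<Longrightarrow>
      \<exists>d<0. (h has_real_derivative d) (at s)"
  shows "h b < 0"
proof (rule ccontr)
  assume "\<not> h b < 0"
  then obtain s where s: "a < s" "s \<le> b" "h s = 0" "\<And>x. a \<le> x \<Longrightarrow> x < s \<Longrightarrow> h x < 0"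
    using first_zero[of a b h] assms by (metis not_less)
  obtain d where "d < 0" "(h has_real_derivative d) (at s)" using step[OF s] by blast
  from DERIV_neg_dec_left[OF this(2,1)] obtain e
    where e: "e > 0" "\<And>k. 0 < k \<Longrightarrow> k < e \<Longrightarrow> h s < h (s - k)" by blast
  define k where "k = min (e/2) (s - a)"
  have "0 < k" "k < e" "k \<le> s - a" using e(1) s(1) by (auto simp: k_def)
  then show False using e(2)[of k] s(4)[of "s - k"] s(3) by auto
qed

section \<open>Powers of absolute values and the map \<open>p_flux\<close>\<close>

text \<open>The formula includes the origin: there the difference quotient has absolute value
  |h|^(q-1), which tends to 0 because q > 1.\<close>

lemma DERIV_abs_powr:
  fixes q x :: real
  assumes "q > 1"
  shows "((\<lambda>x. \<bar>x\<bar> powr q) has_real_derivative q * (\<bar>x\<bar> powr (q - 2) * x)) (at x)"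
proof -
  consider "x > 0" | "x < 0" | "x = 0" by linarith
  then show ?thesis
  proof cases
    case 1
    have "((\<lambda>x. x powr q) has_real_derivative q * x powr (q - 1)) (at x)"
      using 1 by (auto intro!: derivative_eq_intros)
    moreover have "\<forall>\<^sub>F y in nhds x. y powr q = \<bar>y\<bar> powr q"
      using eventually_nhds_in_open[of "{0<..}" x] 1 by (auto elim!: eventually_mono)
    moreover have "x powr (q - 1) = \<bar>x\<bar> powr (q - 2) * x"
      using 1 powr_mult_base[of x "q - 2"] by (simp add: mult.commute)
    ultimately show ?thesis using DERIV_cong_ev[of x x "\<lambda>x. x powr q"] by auto
  next
    case 2
    have "((\<lambda>x. (-x) powr q) has_real_derivative q * (-x) powr (q - 1) * (-1)) (at x)"
      using 2 by (auto intro!: derivative_eq_intros)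
    moreover have "\<forall>\<^sub>F y in nhds x. (-y) powr q = \<bar>y\<bar> powr q"
      using eventually_nhds_in_open[of "{..<0}" x] 2 by (auto elim!: eventually_mono)
    moreover have "q * (-x) powr (q - 1) * (-1) = q * (\<bar>x\<bar> powr (q - 2) * x)"
    proof -
      have "(-x) powr (q - 1) = (-x) * (-x) powr (q - 2)"
        using 2 powr_mult_base[of "-x" "q - 2"] by simp
      then show ?thesis using 2 by simp
    qed
    ultimately show ?thesis
      using DERIV_cong_ev[of x x "\<lambda>x. (-x) powr q" "\<lambda>x. \<bar>x\<bar> powr q"] by metis
  next
    case 3
    have "((\<lambda>h::real. \<bar>h\<bar> powr (q - 1)) \<longlongrightarrow> 0 powr (q - 1)) (at 0)"
      using assms by (intro tendsto_powr2) (auto intro!: tendsto_eq_intros)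
    then have "((\<lambda>h::real. \<bar>\<bar>h\<bar> powr q / h\<bar>) \<longlongrightarrow> 0 powr (q - 1)) (at 0)"
    proof (rule Lim_transform_eventually)
      show "\<forall>\<^sub>F h in at (0::real). \<bar>h\<bar> powr (q - 1) = \<bar>\<bar>h\<bar> powr q / h\<bar>"
        by (auto simp: eventually_at powr_diff intro!: exI[of _ 1])
    qed
    then have "((\<lambda>h::real. \<bar>h\<bar> powr q / h) \<longlongrightarrow> 0) (at 0)"
      using assms by (rule_tac tendsto_rabs_zero_cancel) simp
    then show ?thesis unfolding 3 DERIV_def using assms by simp
  qed
qed

text \<open>Applied with the exponent m + 1 > 2. For 1 < p < 2 the map \<open>p_flux p\<close> is
  not differentiable at 0, but its inverse \<open>p_flux (m + 1)\<close> is C^1; this is the gain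
  from taking the flux as the second unknown.\<close>

lemma DERIV_p_flux:
  fixes p x :: real
  assumes "p > 2"
  shows "(p_flux p has_real_derivative (p - 1) * \<bar>x\<bar> powr (p - 2)) (at x)"
proof -
  consider "x > 0" | "x < 0" | "x = 0" by linarith
  then show ?thesis
  proof cases
    case 1
    have "((\<lambda>x. x powr (p - 1)) has_real_derivative (p - 1) * x powr (p - 2)) (at x)"
      using 1 by (auto intro!: derivative_eq_intros)
    moreover have "\<forall>\<^sub>F y in nhds x. y powr (p - 1) = p_flux p y"
      using eventually_nhds_in_open[of "{0<..}" x] 1
      by (auto elim!: eventually_mono simp: p_flux_def powr_mult_base mult.commute[of "_ powr _"])
    ultimately show ?thesis using DERIV_cong_ev[of x x "\<lambda>x. x powr (p - 1)" "p_flux p"] 1 by auto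
  next
    case 2
    have "((\<lambda>x. - ((-x) powr (p - 1))) has_real_derivative (p - 1) * (-x) powr (p - 2)) (at x)"
      using 2 by (auto intro!: derivative_eq_intros)
    moreover have "\<forall>\<^sub>F y in nhds x. - ((-y) powr (p - 1)) = p_flux p y"
      using eventually_nhds_in_open[of "{..<0}" x] 2
    proof (auto elim!: eventually_mono simp: p_flux_def)
      fix y :: real assume "y < 0"
      then show "- ((-y) powr (p - 1)) = (-y) powr (p - 2) * y"
        using powr_mult_base[of "-y" "p - 2"] by (simp add: mult.commute)
    qed
    ultimately show ?thesis using DERIV_cong_ev[of x x "\<lambda>x. - ((-x) powr (p - 1))" "p_flux p"] 2 by auto
  next
    case 3
    have "((\<lambda>h::real. \<bar>h\<bar> powr (p - 2)) \<longlongrightarrow> 0 powr (p - 2)) (at 0)"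
      using assms by (intro tendsto_powr2) (auto intro!: tendsto_eq_intros)
    then have "((\<lambda>h::real. p_flux p h / h) \<longlongrightarrow> 0 powr (p - 2)) (at 0)"
    proof (rule Lim_transform_eventually)
      show "\<forall>\<^sub>F h in at (0::real). \<bar>h\<bar> powr (p - 2) = p_flux p h / h"
        by (auto simp: eventually_at p_flux_def intro!: exI[of _ 1])
    qed
    then show ?thesis unfolding 3 DERIV_def using assms by (simp add: p_flux_def)
  qed
qed

lemma p_flux_pos: "x \<ge> 0 \<Longrightarrow> p_flux p x = x powr (p - 1)"
  by (cases "x = 0") (auto simp: p_flux_def powr_mult_base mult.commute[of "_ powr _"])

lemma p_flux_minus: "p_flux p (- x) = - p_flux p x"
  by (simp add: p_flux_def)

lemma abs_p_flux: "\<bar>p_flux p x\<bar> = \<bar>x\<bar> powr (p - 1)"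
  by (cases "x = 0") (auto simp: p_flux_def abs_mult powr_mult_base mult.commute[of "_ powr _"])

lemma p_flux_mult_self: "p_flux p x * x = \<bar>x\<bar> powr p"
proof -
  have "p_flux p x * x = \<bar>x\<bar> * (\<bar>x\<bar> * \<bar>x\<bar> powr (p - 2))"
    by (simp add: p_flux_def abs_mult_self_eq mult.left_commute flip: mult.assoc)
  then show ?thesis by (simp add: powr_mult_base)
qed

text \<open>The hypothesis says that the exponents are conjugate; it is used with q = m + 1, that is
  (p - 1) m = 1.\<close>

lemma p_flux_inverse:
  assumes "(p - 1) * (q - 1) = 1"
  shows "p_flux p (p_flux q x) = x"
proof -
  have nonneg: "p_flux p (p_flux q x) = x" if "x \<ge> 0" for x
    using that assms by (simp add: p_flux_pos powr_powr mult.commute)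
  show ?thesis
  proof (cases "x \<ge> 0")
    case False
    then show ?thesis using nonneg[of "-x"] by (simp add: p_flux_minus)
  qed (rule nonneg)
qed

lemma p_flux_Lipschitz:
  assumes "p > 2" "\<bar>x\<bar> \<le> M" "\<bar>y\<bar> \<le> M"
  shows "\<bar>p_flux p x - p_flux p y\<bar> \<le> (p - 1) * M powr (p - 2) * \<bar>x - y\<bar>"
proof -
  have "norm (p_flux p x - p_flux p y) \<le> (p - 1) * M powr (p - 2) * norm (x - y)"
  proof (rule field_differentiable_bound[where S="{-M..M}" and f'="\<lambda>z. (p - 1) * \<bar>z\<bar> powr (p - 2)"])
    show "(p_flux p has_real_derivative (p - 1) * \<bar>z\<bar> powr (p - 2)) (at z within {-M..M})" for z
      by (rule has_field_derivative_at_within[OF DERIV_p_flux[OF assms(1)]])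
    show "norm ((p - 1) * \<bar>z\<bar> powr (p - 2)) \<le> (p - 1) * M powr (p - 2)" if "z \<in> {-M..M}" for z
      using that assms(1) by (auto simp: abs_mult intro!: mult_left_mono powr_mono2)
  qed (use assms in auto)
  then show ?thesis by simp
qed

lemma continuous_on_p_flux:
  assumes "p > 2" "continuous_on S g"
  shows "continuous_on S (\<lambda>x. p_flux p (g x))"
proof -
  have "continuous_on UNIV (p_flux p)"
    using DERIV_p_flux[OF assms(1)] by (auto intro!: DERIV_continuous_on simp: has_field_derivative_at_within)
  then show ?thesis using continuous_on_compose2[OF _ assms(2)] by blast
qed

section \<open>Existence for systems with Lipschitz nonlinearity\<close>

text \<open>The solution operator of w' + (N-1)/r * w = h with w(0) = 0. At r = 0 the integral is 0,
  so the value is 0 for every N.\<close>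

definition radial_avg :: "nat \<Rightarrow> (real \<Rightarrow> real) \<Rightarrow> real \<Rightarrow> real" where
  "radial_avg N h r = integral {0..r} (\<lambda>s. s ^ (N - 1) * h s) / r ^ (N - 1)"

text \<open>The kernel (s/r)^(N-1) is at most 1 on \<open>{0..r}\<close>, so the singular
  coefficient leaves no trace in the estimate.\<close>

lemma radial_avg_diff_le:
  assumes h: "continuous_on {0..b} h" "continuous_on {0..b} k" and r: "0 \<le> r" "r \<le> b"
    and g: "(g has_integral I) {0..r}" "\<And>s. s \<in> {0..r} \<Longrightarrow> \<bar>h s - k s\<bar> \<le> g s"
  shows "\<bar>radial_avg N h r - radial_avg N k r\<bar> \<le> I"
proof (cases "r = 0")
  case True
  then have "I = 0" using g(1) has_integral_unique[of g I "{0}" 0] by auto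
  then show ?thesis using True by (simp add: radial_avg_def)
next
  case False
  then have rp: "r > 0" using r by simp
  have sub: "continuous_on {0..r} h" "continuous_on {0..r} k"
    using h r by (auto intro: continuous_on_subset)
  have ih: "(\<lambda>s. s ^ (N - 1) * h s) integrable_on {0..r}" "(\<lambda>s. s ^ (N - 1) * k s) integrable_on {0..r}"
    using sub by (auto intro!: integrable_continuous_real continuous_intros)
  have "\<bar>integral {0..r} (\<lambda>s. s ^ (N - 1) * h s - s ^ (N - 1) * k s)\<bar>
      \<le> integral {0..r} (\<lambda>s. r ^ (N - 1) * g s)"
  proof (rule integral_norm_bound_integral[where 'a=real, unfolded real_norm_def])
    show "(\<lambda>s. s ^ (N - 1) * h s - s ^ (N - 1) * k s) integrable_on {0..r}"
      using ih by (rule integrable_diff)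
    show "(\<lambda>s. r ^ (N - 1) * g s) integrable_on {0..r}"
      using g(1) by (intro integrable_on_mult_right) auto
    show "\<bar>s ^ (N - 1) * h s - s ^ (N - 1) * k s\<bar> \<le> r ^ (N - 1) * g s" if "s \<in> {0..r}" for s
    proof -
      have "\<bar>s ^ (N - 1) * h s - s ^ (N - 1) * k s\<bar> = s ^ (N - 1) * \<bar>h s - k s\<bar>"
        using that by (simp add: abs_mult flip: right_diff_distrib)
      also have "\<dots> \<le> r ^ (N - 1) * g s"
        using that g(2)[OF that] by (intro mult_mono power_mono) auto
      finally show ?thesis .
    qed
  qed
  also have "integral {0..r} (\<lambda>s. r ^ (N - 1) * g s) = r ^ (N - 1) * I"
    using g(1) by (auto intro!: integral_unique has_integral_mult_right)
  finally have "\<bar>integral {0..r} (\<lambda>s. s ^ (N - 1) * h s) - integral {0..r} (\<lambda>s. s ^ (N - 1) * k s)\<bar>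
      \<le> r ^ (N - 1) * I"
    using ih by (simp add: integral_diff)
  then show ?thesis
    using rp by (simp add: radial_avg_def field_simps flip: diff_divide_distrib)
qed

lemma radial_avg_DERIV:
  assumes "N \<ge> 1" and h: "continuous_on {0..b} h" and r: "0 < r" "r < b"
  shows "(radial_avg N h has_real_derivative h r - (real N - 1) / r * radial_avg N h r) (at r)"
proof -
  have "((\<lambda>u. integral {0..u} (\<lambda>s. s ^ (N - 1) * h s)) has_real_derivative r ^ (N - 1) * h r)
      (at r within {0..b})"
    using r h by (intro integral_has_real_derivative continuous_intros) auto
  then have "((\<lambda>u. integral {0..u} (\<lambda>s. s ^ (N - 1) * h s)) has_real_derivative r ^ (N - 1) * h r) (at r)"
    using r by (simp add: at_within_Icc_at)
  then have "(radial_avg N h has_real_derivative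
      ((r ^ (N - 1) * h r) * r ^ (N - 1) -
        integral {0..r} (\<lambda>s. s ^ (N - 1) * h s) * (real (N - 1) * r ^ (N - 1 - 1)))
      / (r ^ (N - 1) * r ^ (N - 1))) (at r)"
    unfolding radial_avg_def[abs_def] using r by (auto intro!: derivative_eq_intros)
  moreover have "real (N - 1) * r ^ (N - 1 - 1) = (real N - 1) / r * r ^ (N - 1)"
    using r assms(1) by (cases "N - 1") auto
  moreover have "(R * h r * R - I * (n / r * R)) / (R * R) = h r - n / r * (I / R)" if "R > 0" for I R n
    using that r by (simp add: field_simps)
  from this[of "r ^ (N - 1)"]
  have "(r ^ (N - 1) * h r * r ^ (N - 1) - integral {0..r} (\<lambda>s. s ^ (N - 1) * h s) * ((real N - 1) / r * r ^ (N - 1)))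
      / (r ^ (N - 1) * r ^ (N - 1)) = h r - (real N - 1) / r * radial_avg N h r"
    unfolding radial_avg_def using r by simp
  ultimately show ?thesis by simp
qed

text \<open>Only the origin needs an argument: there the bound r * M, with M a bound for |h|,
  replaces the quotient 0/0.\<close>

lemma radial_avg_continuous:
  assumes "N \<ge> 1" and h: "continuous_on {0..b} h"
  shows "continuous_on {0..b} (radial_avg N h)"
proof (cases "b > 0")
  case False
  then have "{0..b} = {} \<or> {0..b} = {0}" by auto
  then show ?thesis by auto
next
  case True
  have "compact (h ` {0..b})" using h by (intro compact_continuous_image) auto
  then obtain M where M: "\<And>s. s \<in> {0..b} \<Longrightarrow> \<bar>h s\<bar> \<le> M"
    by (metis bounded_iff compact_imp_bounded image_eqI real_norm_def)
  have z: "radial_avg N (\<lambda>_. 0) = (\<lambda>_. 0)" "radial_avg N h 0 = 0" by (auto simp: radial_avg_def)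
  have bd: "\<bar>radial_avg N h r\<bar> \<le> r * M" if "0 \<le> r" "r \<le> b" for r
  proof -
    have "((\<lambda>s. M) has_integral (r * M)) {0..r}"
      using has_integral_const_real[of M 0 r] that by simp
    then show ?thesis
      using radial_avg_diff_le[OF h, of "\<lambda>_. 0" r "\<lambda>_. M" "r * M" N] that M z by auto
  qed
  show ?thesis
    unfolding continuous_on_eq_continuous_within
  proof
    fix x assume x: "x \<in> {0..b}"
    show "continuous (at x within {0..b}) (radial_avg N h)"
    proof (cases "x = 0")
      case True
      have "((\<lambda>r. r * M) \<longlongrightarrow> 0) (at 0 within {0..b})" by (auto intro!: tendsto_eq_intros)
      then have "(radial_avg N h \<longlongrightarrow> 0) (at 0 within {0..b})"
      proof (rule Lim_null_comparison[rotated])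
        show "\<forall>\<^sub>F r in at 0 within {0..b}. norm (radial_avg N h r) \<le> r * M"
          using bd by (auto simp: eventually_at_filter)
      qed
      then show ?thesis using True z by (simp add: continuous_within)
    next
      case False
      have "continuous_on {0..b} (\<lambda>u. integral {0..u} (\<lambda>s. s ^ (N - 1) * h s))"
        using h by (intro indefinite_integral_continuous_1 integrable_continuous_real continuous_intros) auto
      then show ?thesis
        unfolding radial_avg_def[abs_def] using x False
        by (auto simp: continuous_on_eq_continuous_within intro!: continuous_intros)
    qed
  qed
qed

lemma exp_has_integral:
  assumes "0 \<le> r" "(l::real) > 0"
  shows "((\<lambda>s. exp (l * s)) has_integral (exp (l * r) - 1) / l) {0..r}"
proof -
  have "((\<lambda>s. exp (l * s)) has_integral (exp (l * r) / l - exp (l * 0) / l)) {0..r}"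
    by (rule fundamental_theorem_of_calculus[OF assms(1)])
      (use assms in \<open>auto intro!: derivative_eq_intros simp flip: has_real_derivative_iff_has_vector_derivative\<close>)
  then show ?thesis by (simp add: diff_divide_distrib)
qed

text \<open>Banach's fixed point theorem for \<open>y r = exp (- l * r) * w r\<close>, with \<open>f\<close> eliminated by integration.\<close>

lemma Lipschitz_system_exists:
  fixes g :: "real \<Rightarrow> real"
  assumes N: "N \<ge> 1" and b: "b > 0" and L: "\<And>x y. \<bar>g x - g y\<bar> \<le> L * \<bar>x - y\<bar>"
  obtains f w where "continuous_on {0..b} f" "continuous_on {0..b} w" "f 0 = a" "w 0 = 0"
    "\<And>r. 0 < r \<Longrightarrow> r < b \<Longrightarrow> (f has_real_derivative - g (w r)) (at r)"
    "\<And>r. 0 < r \<Longrightarrow> r < b \<Longrightarrow>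
      (w has_real_derivative f r - (real N - 1) / r * w r - \<bar>w r\<bar>) (at r)"
proof -
  have L0: "L \<ge> 0" using L[of 0 1] by (auto intro: order.trans[OF abs_ge_zero])
  \<comment> \<open>The rate of the weighted supremum norm. Eliminating \<open>f\<close> costs a
    factor L, the term |w| a factor 1, and integrating exp (l s) divides by l; so the contraction
    constant is (L + 1) / l = 1/2.\<close>
  define l where "l = 2 * (L + 1)"
  have l: "l \<ge> 1" "l > 0" using L0 by (auto simp: l_def)
  have "L-lipschitz_on UNIV g" using L L0 by (auto simp: lipschitz_on_def dist_real_def)
  then have gc: "continuous_on UNIV g" by (rule lipschitz_on_continuous_on)
  \<comment> \<open>Retraction of the line onto \<open>{0..b}\<close>: composing with it extends
    functions on the interval to bounded continuous functions on the line, a complete space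
    available as a type.\<close>
  define c where "c r = max 0 (min b r)" for r :: real
  have c: "c r \<in> {0..b}" "r \<in> {0..b} \<Longrightarrow> c r = r" for r using b by (auto simp: c_def)
  have cc: "continuous_on UNIV c" unfolding c_def by (intro continuous_intros)
  define W :: "(real \<Rightarrow> real) \<Rightarrow> real \<Rightarrow> real" where "W y r = exp (l * r) * y r" for y r
  define F where "F y r = a - integral {0..r} (\<lambda>s. g (W y s))" for y r
  define H where "H y r = F y r - \<bar>W y r\<bar>" for y r
  define A where "A y r = exp (- l * c r) * radial_avg N (H y) (c r)" for y r
  have Wc: "continuous_on S (W y)" if "continuous_on UNIV y" for y S
    unfolding W_def[abs_def] using continuous_on_subset[OF that] by (intro continuous_intros) auto
  have gWc: "continuous_on S (\<lambda>s. g (W y s))" if "continuous_on UNIV y" for y S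
    using continuous_on_compose2[OF gc Wc[OF that]] by simp
  have Fc: "continuous_on {0..b} (F y)" if "continuous_on UNIV y" for y
    unfolding F_def[abs_def] using gWc[OF that]
    by (intro continuous_intros indefinite_integral_continuous_1 integrable_continuous_real)
  have Hc: "continuous_on {0..b} (H y)" if "continuous_on UNIV y" for y
    unfolding H_def[abs_def] using Fc[OF that] Wc[OF that] by (intro continuous_intros)
  have Ac: "continuous_on UNIV (A y)" if "continuous_on UNIV y" for y
    unfolding A_def[abs_def]
    by (intro continuous_intros cc continuous_on_compose2[OF radial_avg_continuous[OF N Hc[OF that]] cc])
      (use c in auto)
  have Ab: "A y \<in> bcontfun" if "continuous_on UNIV y" for y
  proof -
    have "A y ` UNIV \<subseteq> A y ` {0..b}"
    proof
      fix z assume "z \<in> A y ` UNIV"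
      then obtain r where r: "z = A y r" by auto
      have "A y r = A y (c r)" unfolding A_def using c[of r] c(2)[of "c r"] by simp
      then show "z \<in> A y ` {0..b}" using r c(1)[of r] by auto
    qed
    moreover have "bounded (A y ` {0..b})"
      using Ac[OF that] by (intro compact_imp_bounded compact_continuous_image)
        (auto intro: continuous_on_subset)
    ultimately have "bounded (range (A y))" by (rule bounded_subset[rotated])
    then show ?thesis using Ac[OF that] by (simp add: bcontfun_def)
  qed
  define Op where "Op y = Bcontfun (A (apply_bcontfun y))" for y
  have Op: "apply_bcontfun (Op y) = A (apply_bcontfun y)" for y
    unfolding Op_def using Ab by (intro Bcontfun_inverse) auto
  have "dist (Op y) (Op z) \<le> 1/2 * dist y z" for y z
  proof (rule dist_bound)
    fix r
    define d where "d = dist y z"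
    have d0: "d \<ge> 0" by (simp add: d_def)
    have cy: "continuous_on UNIV (apply_bcontfun y)" "continuous_on UNIV (apply_bcontfun z)" by auto
    have dW: "\<bar>W (apply_bcontfun y) s - W (apply_bcontfun z) s\<bar> \<le> d * exp (l * s)" for s
    proof -
      have "\<bar>W (apply_bcontfun y) s - W (apply_bcontfun z) s\<bar>
          = exp (l * s) * dist (apply_bcontfun y s) (apply_bcontfun z s)"
        by (simp add: W_def dist_real_def abs_mult flip: right_diff_distrib)
      also have "\<dots> \<le> exp (l * s) * d"
        unfolding d_def by (intro mult_left_mono dist_bounded) auto
      finally show ?thesis by (simp add: mult.commute)
    qed
    have dF: "\<bar>F (apply_bcontfun y) s - F (apply_bcontfun z) s\<bar> \<le> L * d * exp (l * s)" if "s \<ge> 0" for s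
    proof -
      let ?G = "\<lambda>y s. g (W (apply_bcontfun y) s)"
      have i: "?G y integrable_on {0..s}" "?G z integrable_on {0..s}"
        using gWc[OF cy(1)] gWc[OF cy(2)] by (auto intro!: integrable_continuous_real)
      have e: "((\<lambda>t. L * d * exp (l * t)) has_integral L * d * ((exp (l * s) - 1) / l)) {0..s}"
        by (rule has_integral_mult_right[OF exp_has_integral[OF that l(2)]])
      have "\<bar>integral {0..s} (\<lambda>t. ?G y t - ?G z t)\<bar> \<le> integral {0..s} (\<lambda>t. L * d * exp (l * t))"
      proof (rule integral_norm_bound_integral[where 'a=real, unfolded real_norm_def])
        show "\<bar>?G y t - ?G z t\<bar> \<le> L * d * exp (l * t)" for t
          using L[of "W (apply_bcontfun y) t" "W (apply_bcontfun z) t"] mult_left_mono[OF dW[of t] L0] by linarith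
      qed (use i e in \<open>auto intro: integrable_diff\<close>)
      also have "\<dots> = L * d * ((exp (l * s) - 1) / l)" using e by (rule integral_unique)
      also have "\<dots> \<le> L * d * exp (l * s)"
      proof (intro mult_left_mono)
        have "(exp (l * s) - 1) / l \<le> exp (l * s) / 1"
          using l by (intro frac_le) auto
        then show "(exp (l * s) - 1) / l \<le> exp (l * s)" by simp
      qed (use L0 d0 in auto)
      finally show ?thesis using i by (simp add: F_def integral_diff abs_minus_commute)
    qed
    have e: "((\<lambda>t. (L + 1) * d * exp (l * t)) has_integral (L + 1) * d * ((exp (l * c r) - 1) / l)) {0..c r}"
      using c(1)[of r] by (intro has_integral_mult_right exp_has_integral) (auto simp: l)
    have "\<bar>radial_avg N (H (apply_bcontfun y)) (c r) - radial_avg N (H (apply_bcontfun z)) (c r)\<bar>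
        \<le> (L + 1) * d * ((exp (l * c r) - 1) / l)"
    proof (rule radial_avg_diff_le[OF Hc[OF cy(1)] Hc[OF cy(2)] _ _ e])
      fix s assume "s \<in> {0..c r}"
      then have "s \<ge> 0" by simp
      have "\<bar>H (apply_bcontfun y) s - H (apply_bcontfun z) s\<bar> \<le>
        \<bar>F (apply_bcontfun y) s - F (apply_bcontfun z) s\<bar> + \<bar>W (apply_bcontfun y) s - W (apply_bcontfun z) s\<bar>"
        by (auto simp: H_def)
      also have "\<dots> \<le> L * d * exp (l * s) + d * exp (l * s)"
        using dF[OF \<open>s \<ge> 0\<close>] dW[of s] by linarith
      finally show "\<bar>H (apply_bcontfun y) s - H (apply_bcontfun z) s\<bar> \<le> (L + 1) * d * exp (l * s)"
        by (simp add: algebra_simps)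
    qed (use c(1)[of r] in auto)
    also have "\<dots> \<le> (L + 1) * d * (exp (l * c r) / l)"
      using L0 d0 l by (intro mult_left_mono divide_right_mono) auto
    also have "\<dots> = exp (l * c r) * (1/2 * d)"
      using L0 by (simp add: l_def field_simps)
    finally have "exp (- l * c r) * \<bar>radial_avg N (H (apply_bcontfun y)) (c r) - radial_avg N (H (apply_bcontfun z)) (c r)\<bar>
        \<le> exp (- l * c r) * (exp (l * c r) * (1/2 * d))"
      by (intro mult_left_mono) auto
    then show "dist (apply_bcontfun (Op y) r) (apply_bcontfun (Op z) r) \<le> 1/2 * dist y z"
      by (simp add: Op A_def dist_real_def d_def abs_mult exp_minus field_simps flip: right_diff_distrib)
  qed
  then have "\<exists>!y. Op y = y" by (intro banach_fix_type[of "1/2"]) auto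
  then obtain y where y: "Op y = y" by blast
  define w where "w = W (apply_bcontfun y)"
  define f where "f = F (apply_bcontfun y)"
  have cy: "continuous_on UNIV (apply_bcontfun y)" by auto
  have wr: "w r = radial_avg N (H (apply_bcontfun y)) r" if "r \<in> {0..b}" for r
  proof -
    have "apply_bcontfun y r = A (apply_bcontfun y) r" using y Op by metis
    then show ?thesis using c(2)[OF that] by (simp add: w_def W_def A_def exp_minus)
  qed
  have fc: "continuous_on {0..b} f" "continuous_on {0..b} w"
    unfolding f_def w_def using Fc Wc cy by auto
  show thesis
  proof (rule that[of f w])
    show "f 0 = a" by (simp add: f_def F_def)
    show "w 0 = 0" using wr[of 0] b by (simp add: radial_avg_def)
    fix r assume r: "0 < r" "r < b"
    have "((\<lambda>u. integral {0..u} (\<lambda>s. g (w s))) has_real_derivative g (w r)) (at r within {0..b})"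
      using r gWc[OF cy] unfolding w_def by (intro integral_has_real_derivative) auto
    then have "((\<lambda>u. integral {0..u} (\<lambda>s. g (w s))) has_real_derivative g (w r)) (at r)"
      using r by (simp add: at_within_Icc_at)
    then show "(f has_real_derivative - g (w r)) (at r)"
      unfolding f_def F_def[abs_def] w_def by (auto intro!: derivative_eq_intros)
    have "(radial_avg N (H (apply_bcontfun y)) has_real_derivative
        H (apply_bcontfun y) r - (real N - 1) / r * radial_avg N (H (apply_bcontfun y)) r) (at r)"
      by (rule radial_avg_DERIV[OF N Hc[OF cy] r])
    moreover have "\<forall>\<^sub>F u in nhds r. radial_avg N (H (apply_bcontfun y)) u = w u"
      using eventually_nhds_in_open[of "{0<..<b}" r] r wr by (auto elim!: eventually_mono)
    ultimately have "(w has_real_derivative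
        H (apply_bcontfun y) r - (real N - 1) / r * radial_avg N (H (apply_bcontfun y)) r) (at r)"
      using DERIV_cong_ev by blast
    then show "(w has_real_derivative f r - (real N - 1) / r * w r - \<bar>w r\<bar>) (at r)"
      using wr[of r] r by (simp add: H_def f_def w_def algebra_simps)
  qed (use fc in auto)
qed

section \<open>The radial system\<close>

locale radial_system =
  fixes N :: nat and m :: real
  assumes N_pos: "N \<ge> 1" and m_gt_1: "m > 1"
    and subcritical: "(real N - 2) * m < real N + 2"
begin

text \<open>Derivatives are required in the open interval only; at the singular point 0 and at
  \<open>b\<close> continuity suffices for every monotonicity argument, and the derivative at 0 is
  recovered afterwards.\<close>

definition sol_on :: "real \<Rightarrow> real \<Rightarrow> (real \<Rightarrow> real) \<Rightarrow> (real \<Rightarrow> real) \<Rightarrow> bool" where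
  "sol_on b a f w \<longleftrightarrow> continuous_on {0..b} f \<and> continuous_on {0..b} w \<and> f 0 = a \<and> w 0 = 0 \<and>
    (\<forall>r. 0 < r \<and> r < b \<longrightarrow> (f has_real_derivative - p_flux (m + 1) (w r)) (at r) \<and>
      (w has_real_derivative f r - (real N - 1) / r * w r - \<bar>w r\<bar>) (at r))"

lemma sol_onD:
  assumes "sol_on b a f w"
  shows "continuous_on {0..b} f" "continuous_on {0..b} w" "f 0 = a" "w 0 = 0"
    "0 < r \<Longrightarrow> r < b \<Longrightarrow> (f has_real_derivative - p_flux (m + 1) (w r)) (at r)"
    "0 < r \<Longrightarrow> r < b \<Longrightarrow> (w has_real_derivative f r - (real N - 1) / r * w r - \<bar>w r\<bar>) (at r)"
  using assms by (auto simp: sol_on_def)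

lemma sol_on_mono:
  assumes "sol_on b a f w" "c \<le> b"
  shows "sol_on c a f w"
  using assms by (auto simp: sol_on_def intro: continuous_on_subset)

text \<open>Along a solution the energy E changes by -(N-1)/r |w|^(m+1) and by a term of absolute
  value |w|^(m+1), which is positive where w < 0. Hence E' \<le> (m+1) E, and E times exp (-(m+1) r)
  decreases.\<close>

lemma energy_bound:
  assumes sol: "sol_on b a f w" and r: "0 \<le> r" "r \<le> b"
  shows "(f r)\<^sup>2 / 2 + \<bar>w r\<bar> powr (m + 1) / (m + 1) \<le> exp ((m + 1) * r) * (a\<^sup>2 / 2)"
proof -
  define G where "G r = ((f r)\<^sup>2 / 2 + \<bar>w r\<bar> powr (m + 1) / (m + 1)) * exp (- (m + 1) * r)" for r
  have cont: "continuous_on {0..r} f" "continuous_on {0..r} w"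
    using sol_onD(1,2)[OF sol] r by (auto intro: continuous_on_subset)
  have "G 0 \<ge> G r"
  proof (rule DERIV_nonpos_imp_decreasing_open[OF r(1)])
    show "continuous_on {0..r} G"
      unfolding G_def[abs_def] using m_gt_1 cont by (intro continuous_intros continuous_on_powr') auto
    fix x assume x: "0 < x" "x < r"
    define S where "S = p_flux (m + 1) (w x)"
    have S: "\<bar>w x\<bar> powr (m + 1 - 2) * w x = S" by (simp add: S_def p_flux_def)
    have Sw: "S * w x = \<bar>w x\<bar> powr (m + 1)"
      by (simp add: S_def p_flux_mult_self)
    have "\<bar>S * \<bar>w x\<bar>\<bar> = \<bar>S * w x\<bar>" by (simp add: abs_mult)
    then have "\<bar>S * \<bar>w x\<bar>\<bar> = \<bar>w x\<bar> powr (m + 1)" using Sw by simp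
    then have Sa: "- (S * \<bar>w x\<bar>) \<le> \<bar>w x\<bar> powr (m + 1)" by linarith
    have df: "(f has_real_derivative - S) (at x)"
      and dw: "(w has_real_derivative f x - (real N - 1) / x * w x - \<bar>w x\<bar>) (at x)"
      using sol_onD(5,6)[OF sol, of x] x r by (auto simp: S_def)
    have dp: "((\<lambda>x. \<bar>w x\<bar> powr (m + 1)) has_real_derivative
        (m + 1) * S * (f x - (real N - 1) / x * w x - \<bar>w x\<bar>)) (at x)"
      using DERIV_chain2[OF DERIV_abs_powr dw, of "m + 1"] m_gt_1 unfolding S by simp
    define D where "D = - ((real N - 1) / x * \<bar>w x\<bar> powr (m + 1)) - S * \<bar>w x\<bar>
        - (m + 1) * ((f x)\<^sup>2 / 2 + \<bar>w x\<bar> powr (m + 1) / (m + 1))"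
    define E where "E = (f x)\<^sup>2 / 2 + \<bar>w x\<bar> powr (m + 1) / (m + 1)"
    define E' where "E' = f x * (- S) + S * (f x - (real N - 1) / x * w x - \<bar>w x\<bar>)"
    have "((\<lambda>r. (f r)\<^sup>2 / 2) has_real_derivative f x * (- S)) (at x)"
      by (auto intro!: derivative_eq_intros df)
    moreover have "((\<lambda>r. \<bar>w r\<bar> powr (m + 1) / (m + 1)) has_real_derivative
        S * (f x - (real N - 1) / x * w x - \<bar>w x\<bar>)) (at x)"
      using DERIV_cdivide[OF dp, of "m + 1"] m_gt_1 by simp
    ultimately have dE: "((\<lambda>r. (f r)\<^sup>2 / 2 + \<bar>w r\<bar> powr (m + 1) / (m + 1)) has_real_derivative E') (at x)"
      unfolding E'_def by (rule DERIV_add)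
    have "((\<lambda>r. exp (- (m + 1) * r)) has_real_derivative exp (- (m + 1) * x) * (- (m + 1))) (at x)"
      by (auto intro!: derivative_eq_intros)
    from DERIV_mult[OF dE this, folded E_def]
    have "(G has_real_derivative (E' - (m + 1) * E) * exp (- (m + 1) * x)) (at x)"
      unfolding G_def[abs_def] by (rule DERIV_cong) (simp add: algebra_simps)
    moreover have "E' - (m + 1) * E = D"
      unfolding D_def E_def[symmetric] unfolding Sw[symmetric] E'_def by (simp add: algebra_simps)
    moreover have "D \<le> 0"
    proof -
      have "(real N - 1) / x * \<bar>w x\<bar> powr (m + 1) \<ge> 0"
        using N_pos x by simp
      moreover have "(m + 1) * ((f x)\<^sup>2 / 2 + \<bar>w x\<bar> powr (m + 1) / (m + 1))
          = (m + 1) * (f x)\<^sup>2 / 2 + \<bar>w x\<bar> powr (m + 1)"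
        using m_gt_1 by (simp add: field_simps)
      moreover have "(m + 1) * (f x)\<^sup>2 / 2 \<ge> 0" using m_gt_1 by simp
      ultimately show ?thesis using Sa unfolding D_def by linarith
    qed
    ultimately have "(G has_real_derivative D * exp (- (m + 1) * x)) (at x)" "D * exp (- (m + 1) * x) \<le> 0"
      by (auto simp: mult_nonpos_nonneg)
    then show "\<exists>y. (G has_real_derivative y) (at x) \<and> y \<le> 0" by blast
  qed
  moreover have "G 0 = a\<^sup>2 / 2" using sol_onD(3,4)[OF sol] m_gt_1 by (simp add: G_def)
  ultimately have "exp ((m + 1) * r) * G r \<le> exp ((m + 1) * r) * (a\<^sup>2 / 2)"
    by (intro mult_left_mono) auto
  moreover have "exp ((m + 1) * r) * G r = (f r)\<^sup>2 / 2 + \<bar>w r\<bar> powr (m + 1) / (m + 1)"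
    unfolding G_def by (simp add: mult_exp_exp algebra_simps)
  ultimately show ?thesis by simp
qed

text \<open>The summand 1 serves the case |w| \<le> 1; otherwise |w| \<le> |w|^(m+1), and the energy
  bound applies without taking roots.\<close>

definition flux_bound :: "real \<Rightarrow> real \<Rightarrow> real" where
  "flux_bound A b = 1 + (m + 1) * (exp ((m + 1) * b) * (A\<^sup>2 / 2))"

lemma flux_bound_ge: "flux_bound A b \<ge> 1"
  using m_gt_1 by (simp add: flux_bound_def)

lemma sol_flux_le:
  assumes sol: "sol_on b a f w" and r: "0 \<le> r" "r \<le> b" and A: "\<bar>a\<bar> \<le> A"
  shows "\<bar>w r\<bar> \<le> flux_bound A b"
proof (cases "\<bar>w r\<bar> \<le> 1")
  case True
  then show ?thesis using flux_bound_ge[of A b] by linarith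
next
  case False
  have "\<bar>w r\<bar> \<le> \<bar>w r\<bar> powr (m + 1)"
    using powr_mono[of 1 "m + 1" "\<bar>w r\<bar>"] False m_gt_1 by simp
  also have "\<dots> = (m + 1) * (\<bar>w r\<bar> powr (m + 1) / (m + 1))" using m_gt_1 by simp
  also have "\<dots> \<le> (m + 1) * (exp ((m + 1) * r) * (a\<^sup>2 / 2))"
    using energy_bound[OF sol r] m_gt_1 by (intro mult_left_mono) (auto intro: order.trans[rotated])
  also have "\<dots> \<le> (m + 1) * (exp ((m + 1) * b) * (A\<^sup>2 / 2))"
    using m_gt_1 r A abs_le_square_iff[of a A]
    by (intro mult_left_mono mult_mono) (auto intro!: divide_right_mono)
  finally show ?thesis by (simp add: flux_bound_def)
qed

text \<open>Gronwall's argument for the square distance. \<open>K\<close> depends on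
  \<open>A\<close> and \<open>b\<close> only, so the same estimate yields uniqueness (equal initial
  values) and uniform closeness of solutions on bounded intervals.\<close>

lemma sol_dependence:
  assumes "A \<ge> 0"
  obtains K where "K > 0" "\<And>a1 f1 w1 a2 f2 w2 r. sol_on b a1 f1 w1 \<Longrightarrow> sol_on b a2 f2 w2 \<Longrightarrow>
    \<bar>a1\<bar> \<le> A \<Longrightarrow> \<bar>a2\<bar> \<le> A \<Longrightarrow> 0 \<le> r \<Longrightarrow> r \<le> b \<Longrightarrow>
    (f1 r - f2 r)\<^sup>2 + (w1 r - w2 r)\<^sup>2 \<le> K * (a1 - a2)\<^sup>2"
proof -
  define L where "L = m * flux_bound A b powr (m - 1)"
  have L0: "L \<ge> 0" using m_gt_1 by (simp add: L_def)
  \<comment> \<open>L comes from the flux nonlinearity, 1 from the cross term 2uv, and 2 from |w|,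
    which has Lipschitz constant 1.\<close>
  define C where "C = L + 3"
  show thesis
  proof (rule that[of "exp (C * \<bar>b\<bar>)"])
    fix a1 f1 w1 a2 f2 w2 r
    assume s: "sol_on b a1 f1 w1" "sol_on b a2 f2 w2" and a: "\<bar>a1\<bar> \<le> A" "\<bar>a2\<bar> \<le> A"
      and r: "0 \<le> r" "r \<le> b"
    define d where "d r = (f1 r - f2 r)\<^sup>2 + (w1 r - w2 r)\<^sup>2" for r
    have cont: "continuous_on {0..r} f1" "continuous_on {0..r} w1" "continuous_on {0..r} f2" "continuous_on {0..r} w2"
      using sol_onD(1,2)[OF s(1)] sol_onD(1,2)[OF s(2)] r by (auto intro: continuous_on_subset)
    have "d 0 * exp (- C * 0) \<ge> d r * exp (- C * r)"
    proof (rule DERIV_nonpos_imp_decreasing_open[OF r(1)])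
      show "continuous_on {0..r} (\<lambda>r. d r * exp (- C * r))"
        unfolding d_def using cont by (intro continuous_intros)
      fix x assume x: "0 < x" "x < r"
      define S where "S = p_flux (m + 1) (w1 x) - p_flux (m + 1) (w2 x)"
      define u where "u = f1 x - f2 x"
      define v where "v = w1 x - w2 x"
      define z where "z = \<bar>w1 x\<bar> - \<bar>w2 x\<bar>"
      define k where "k = (real N - 1) / x"
      have k0: "k \<ge> 0" using N_pos x by (simp add: k_def)
      have S: "\<bar>S\<bar> \<le> L * \<bar>v\<bar>"
        using p_flux_Lipschitz[of "m + 1" "w1 x" "flux_bound A b" "w2 x"]
          sol_flux_le[OF s(1) _ _ a(1), of x] sol_flux_le[OF s(2) _ _ a(2), of x] x r m_gt_1
        by (simp add: S_def L_def v_def)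
      have z: "\<bar>z\<bar> \<le> \<bar>v\<bar>" by (simp add: z_def v_def)
      define D where "D = 2 * u * (- S) + 2 * v * (u - k * v - z)"
      have "(d has_real_derivative D) (at x)"
        unfolding d_def[abs_def] D_def S_def u_def v_def z_def k_def
        using x r by (auto intro!: derivative_eq_intros sol_onD(5,6)[OF s(1)] sol_onD(5,6)[OF s(2)]
            simp: algebra_simps diff_divide_distrib)
      then have "((\<lambda>r. d r * exp (- C * r)) has_real_derivative (D - C * d x) * exp (- C * x)) (at x)"
        by (auto intro!: derivative_eq_intros simp: algebra_simps)
      moreover have "D \<le> C * d x"
      proof -
        have uv: "2 * (\<bar>u\<bar> * \<bar>v\<bar>) \<le> u\<^sup>2 + v\<^sup>2"
          using sum_squares_bound[of "\<bar>u\<bar>" "\<bar>v\<bar>"] by simp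
        have "2 * u * (- S) \<le> 2 * (\<bar>u\<bar> * \<bar>S\<bar>)"
          using abs_ge_self[of "u * (- S)"] by (simp add: abs_mult mult.commute)
        also have "\<dots> \<le> 2 * (\<bar>u\<bar> * (L * \<bar>v\<bar>))" using S by (intro mult_left_mono) auto
        also have "\<dots> = L * (2 * (\<bar>u\<bar> * \<bar>v\<bar>))" by simp
        also have "\<dots> \<le> L * (u\<^sup>2 + v\<^sup>2)" using uv L0 by (rule mult_left_mono)
        finally have 1: "2 * u * (- S) \<le> L * (u\<^sup>2 + v\<^sup>2)" .
        have 2: "2 * (v * u) \<le> u\<^sup>2 + v\<^sup>2"
          using uv abs_ge_self[of "v * u"] by (simp add: abs_mult mult.commute)
        have 3: "- (v * (k * v)) \<le> 0" using k0 by (simp add: mult.left_commute)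
        have "- (v * z) \<le> \<bar>v\<bar> * \<bar>z\<bar>" using abs_ge_minus_self[of "v * z"] by (simp add: abs_mult)
        also have "\<dots> \<le> \<bar>v\<bar> * \<bar>v\<bar>" using z by (intro mult_left_mono) auto
        finally have 4: "- (v * z) \<le> v\<^sup>2" by (simp add: power2_eq_square)
        have "D = 2 * u * (- S) + 2 * (v * u) + 2 * (- (v * (k * v))) + 2 * (- (v * z))"
          by (simp add: D_def algebra_simps)
        also have "\<dots> \<le> L * (u\<^sup>2 + v\<^sup>2) + (u\<^sup>2 + v\<^sup>2) + 2 * v\<^sup>2" using 1 2 3 4 by linarith
        also have "\<dots> \<le> C * (u\<^sup>2 + v\<^sup>2)" by (simp add: C_def algebra_simps)
        finally show ?thesis by (simp add: d_def u_def v_def)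
      qed
      ultimately show "\<exists>y. ((\<lambda>r. d r * exp (- C * r)) has_real_derivative y) (at x) \<and> y \<le> 0"
        by (auto intro!: exI mult_nonpos_nonneg)
    qed
    moreover have "d 0 = (a1 - a2)\<^sup>2"
      using sol_onD(3,4)[OF s(1)] sol_onD(3,4)[OF s(2)] by (simp add: d_def)
    ultimately have "exp (C * r) * (d r * exp (- C * r)) \<le> exp (C * r) * (a1 - a2)\<^sup>2"
      by (intro mult_left_mono) auto
    moreover have "exp (C * r) * (d r * exp (- C * r)) = d r" by (simp add: exp_minus field_simps)
    moreover have "exp (C * r) * (a1 - a2)\<^sup>2 \<le> exp (C * \<bar>b\<bar>) * (a1 - a2)\<^sup>2"
      using r L0 by (intro mult_right_mono) (auto simp: C_def intro!: mult_left_mono)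
    ultimately have "d r \<le> exp (C * \<bar>b\<bar>) * (a1 - a2)\<^sup>2" by linarith
    then show "(f1 r - f2 r)\<^sup>2 + (w1 r - w2 r)\<^sup>2 \<le> exp (C * \<bar>b\<bar>) * (a1 - a2)\<^sup>2"
      by (simp add: d_def)
  qed auto
qed

lemma sol_unique:
  assumes "sol_on b a f1 w1" "sol_on b a f2 w2" "0 \<le> r" "r \<le> b"
  shows "f1 r = f2 r" "w1 r = w2 r"
proof -
  obtain K where "(f1 r - f2 r)\<^sup>2 + (w1 r - w2 r)\<^sup>2 \<le> K * (a - a)\<^sup>2"
    using sol_dependence[of "\<bar>a\<bar>" b] assms by (metis abs_ge_zero order_refl)
  then show "f1 r = f2 r" "w1 r = w2 r" by (simp_all add: sum_power2_le_zero_iff)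
qed

text \<open>The nonlinearity is cut off at a level \<open>M\<close> strictly above the a priori
  bound. Up to the first time with |w| = M the truncated solution is a true one, so the bound
  applies and excludes that time.\<close>

lemma sol_on_exists:
  assumes b: "b > 0"
  shows "\<exists>f w. sol_on b a f w"
proof -
  define M where "M = flux_bound a b + 1"
  have M: "M \<ge> 1" using flux_bound_ge[of a b] by (simp add: M_def)
  define c where "c x = max (- M) (min M x)" for x
  have c: "\<bar>c x\<bar> \<le> M" "\<bar>c x - c y\<bar> \<le> \<bar>x - y\<bar>" "\<bar>x\<bar> \<le> M \<Longrightarrow> c x = x" for x y
    using M by (auto simp: c_def)
  define L where "L = m * M powr (m - 1)"
  have "\<bar>p_flux (m + 1) (c x) - p_flux (m + 1) (c y)\<bar> \<le> L * \<bar>x - y\<bar>" for x y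
  proof -
    have "\<bar>p_flux (m + 1) (c x) - p_flux (m + 1) (c y)\<bar> \<le> L * \<bar>c x - c y\<bar>"
      using p_flux_Lipschitz[of "m + 1" "c x" M "c y"] m_gt_1 c by (simp add: L_def)
    also have "\<dots> \<le> L * \<bar>x - y\<bar>" using c(2) m_gt_1 by (intro mult_left_mono) (auto simp: L_def)
    finally show ?thesis .
  qed
  then obtain f w where fw: "continuous_on {0..b} f" "continuous_on {0..b} w" "f 0 = a" "w 0 = 0"
    "\<And>r. 0 < r \<Longrightarrow> r < b \<Longrightarrow> (f has_real_derivative - p_flux (m + 1) (c (w r))) (at r)"
    "\<And>r. 0 < r \<Longrightarrow> r < b \<Longrightarrow>
      (w has_real_derivative f r - (real N - 1) / r * w r - \<bar>w r\<bar>) (at r)"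
    using Lipschitz_system_exists[OF N_pos b, of "\<lambda>x. p_flux (m + 1) (c x)" L a] by metis
  have small: "\<bar>w r\<bar> - M < 0" if r: "0 \<le> r" "r \<le> b" for r
  proof (rule ccontr)
    assume "\<not> ?thesis"
    moreover have "continuous_on {0..r} (\<lambda>r. \<bar>w r\<bar> - M)"
      using fw(2) r by (intro continuous_intros) (auto intro: continuous_on_subset)
    ultimately obtain s where s: "0 < s" "s \<le> r" "\<bar>w s\<bar> - M = 0"
      "\<And>x. 0 \<le> x \<Longrightarrow> x < s \<Longrightarrow> \<bar>w x\<bar> - M < 0"
      using first_zero[of 0 r "\<lambda>r. \<bar>w r\<bar> - M"] r fw(4) M by (auto simp: not_less)
    have "sol_on s a f w"
      unfolding sol_on_def
    proof (intro conjI allI impI)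
      fix x assume x: "0 < x \<and> x < s"
      then have "c (w x) = w x" using s(4)[of x] c(3) by auto
      then show "(f has_real_derivative - p_flux (m + 1) (w x)) (at x)" using fw(5)[of x] x s r by auto
    qed (use fw s r in \<open>auto intro: continuous_on_subset\<close>)
    then have "\<bar>w s\<bar> \<le> flux_bound \<bar>a\<bar> s"
      using s by (intro sol_flux_le) auto
    also have "\<dots> \<le> flux_bound a b"
      unfolding flux_bound_def using m_gt_1 s r by (intro add_left_mono mult_left_mono mult_mono) auto
    finally show False using s(3) by (simp add: M_def)
  qed
  have "sol_on b a f w"
    unfolding sol_on_def
  proof (intro conjI allI impI)
    fix x assume x: "0 < x \<and> x < b"
    then have "c (w x) = w x" using small[of x] c(3) by auto
    then show "(f has_real_derivative - p_flux (m + 1) (w x)) (at x)" using fw(5)[of x] x by auto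
  qed (use fw in auto)
  then show ?thesis by blast
qed

definition sol :: "real \<Rightarrow> (real \<Rightarrow> real) \<Rightarrow> (real \<Rightarrow> real) \<Rightarrow> bool" where
  "sol a f w \<longleftrightarrow> (\<forall>b. sol_on b a f w)"

text \<open>The solutions on the intervals [0, n + 1] agree on overlaps by uniqueness, so they glue
  together.\<close>

lemma sol_exists: "\<exists>f w. sol a f w"
proof -
  have "\<exists>fw. sol_on (real n + 1) a (fst fw) (snd fw)" for n
    using sol_on_exists[of "real n + 1" a] by auto
  then obtain fw where fw: "\<And>n. sol_on (real n + 1) a (fst (fw n)) (snd (fw n))" by metis
  define i where "i r = nat \<lceil>r\<rceil>" for r :: real
  define f where "f r = fst (fw (i r)) r" for r
  define w where "w r = snd (fw (i r)) r" for r
  have eq: "f r = fst (fw n) r" "w r = snd (fw n) r" if "0 \<le> r" "r \<le> real n + 1" for r n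
  proof -
    define c where "c = min (real n + 1) (real (i r) + 1)"
    have s: "sol_on c a (fst (fw (i r))) (snd (fw (i r)))" "sol_on c a (fst (fw n)) (snd (fw n))"
      using sol_on_mono[OF fw, of c] by (auto simp: c_def)
    have "r \<le> c" using that by (auto simp: c_def i_def) linarith
    from sol_unique[OF s that(1) this] show "f r = fst (fw n) r" "w r = snd (fw n) r"
      by (simp_all add: f_def w_def)
  qed
  have "sol_on (real n + 1) a f w" for n
    unfolding sol_on_def
  proof (intro conjI allI impI)
    have eqn: "fst (fw n) x = f x" "snd (fw n) x = w x" if "0 \<le> x" "x \<le> real n + 1" for x
      using eq[OF that] by simp_all
    show "continuous_on {0..real n + 1} f"
      using eqn by (intro continuous_on_eq[OF sol_onD(1)[OF fw[of n]]]) simp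
    show "continuous_on {0..real n + 1} w"
      using eqn by (intro continuous_on_eq[OF sol_onD(2)[OF fw[of n]]]) simp
    show "f 0 = a" "w 0 = 0"
      using sol_onD(3,4)[OF fw[of n]] eqn[of 0] by auto
    fix r assume r: "0 < r \<and> r < real n + 1"
    have ev: "\<forall>\<^sub>F x in nhds r. fst (fw n) x = f x" "\<forall>\<^sub>F x in nhds r. snd (fw n) x = w x"
      using eventually_nhds_in_open[of "{0<..<real n + 1}" r] r eqn by (auto elim!: eventually_mono)
    show "(f has_real_derivative - p_flux (m + 1) (w r)) (at r)"
      using sol_onD(5)[OF fw[of n], of r] DERIV_cong_ev[OF refl ev(1) refl] eqn[of r] r by auto
    show "(w has_real_derivative f r - (real N - 1) / r * w r - \<bar>w r\<bar>) (at r)"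
      using sol_onD(6)[OF fw[of n], of r] DERIV_cong_ev[OF refl ev(2) refl] eqn[of r] r by auto
  qed
  then have "sol_on b a f w" for b
    using sol_on_mono[of "real (i b) + 1" a f w b] by (auto simp: i_def) linarith
  then show ?thesis by (auto simp: sol_def)
qed

end

section \<open>Solutions on the half-line\<close>

lemma DERIV_nonneg_le:
  fixes f :: "real \<Rightarrow> real"
  assumes "a \<le> b" "continuous_on {a..b} f"
    "\<And>x. a < x \<Longrightarrow> x < b \<Longrightarrow> (f has_real_derivative f' x) (at x)" "\<And>x. a < x \<Longrightarrow> x < b \<Longrightarrow> f' x \<ge> 0"
  shows "f a \<le> f b"
  using assms by (intro DERIV_nonneg_imp_increasing_open[of a b f]) blast+

lemma DERIV_nonpos_ge:
  fixes f :: "real \<Rightarrow> real"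
  assumes "a \<le> b" "continuous_on {a..b} f"
    "\<And>x. a < x \<Longrightarrow> x < b \<Longrightarrow> (f has_real_derivative f' x) (at x)" "\<And>x. a < x \<Longrightarrow> x < b \<Longrightarrow> f' x \<le> 0"
  shows "f b \<le> f a"
  using assms by (intro DERIV_nonpos_imp_decreasing_open[of a b f]) blast+

lemma DERIV_pos_less:
  fixes f :: "real \<Rightarrow> real"
  assumes "a < b" "continuous_on {a..b} f"
    "\<And>x. a < x \<Longrightarrow> x < b \<Longrightarrow> (f has_real_derivative f' x) (at x)" "\<And>x. a < x \<Longrightarrow> x < b \<Longrightarrow> f' x > 0"
  shows "f a < f b"
  using assms by (intro DERIV_pos_imp_increasing_open[of a b f]) blast+

lemma DERIV_neg_gt:
  fixes f :: "real \<Rightarrow> real"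
  assumes "a < b" "continuous_on {a..b} f"
    "\<And>x. a < x \<Longrightarrow> x < b \<Longrightarrow> (f has_real_derivative f' x) (at x)" "\<And>x. a < x \<Longrightarrow> x < b \<Longrightarrow> f' x < 0"
  shows "f b < f a"
  using assms by (intro DERIV_neg_imp_decreasing_open[of a b f]) blast+

lemma at_within_halfline_pos: "(r::real) > 0 \<Longrightarrow> at r within {0..} = at r"
  by (rule at_within_interior) simp

lemma at_within_halfline_nontrivial: "(r::real) \<ge> 0 \<Longrightarrow> at r within {0..} \<noteq> bot"
  by (cases "r = 0") (auto simp: at_within_halfline_pos at_within_Ici_at_right)

lemma deriv_halflineI:
  assumes "(f has_real_derivative d) (at r within {0..})" "r \<ge> 0"
  shows "deriv_halfline f r = d"
  unfolding deriv_halfline_def using assms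
  by (intro vector_derivative_within at_within_halfline_nontrivial)
    (auto simp: has_real_derivative_iff_has_vector_derivative)

lemma deriv_halfline_works:
  assumes "f differentiable_on {0..}" "r \<ge> 0"
  shows "(f has_real_derivative deriv_halfline f r) (at r within {0..})"
  unfolding has_real_derivative_iff_has_vector_derivative deriv_halfline_def
  using assms by (subst vector_derivative_works[symmetric]) (auto simp: differentiable_on_def)

lemma C1_halflineI:
  assumes "\<And>r. r \<ge> 0 \<Longrightarrow> (f has_real_derivative g r) (at r within {0..})" "continuous_on {0..} g"
  shows "C1_halfline f"
  unfolding C1_halfline_def
proof
  show "f differentiable_on {0..}"
    using assms(1) by (auto simp: differentiable_on_def real_differentiable_def)
  show "continuous_on {0..} (deriv_halfline f)"
    by (rule continuous_on_eq[OF assms(2)]) (use assms(1) deriv_halflineI in force)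
qed

lemma halfline_tendsto_0: "continuous_on {0..} f \<Longrightarrow> (f \<longlongrightarrow> f 0) (at_right (0::real))"
  unfolding continuous_on_def at_within_Ici_at_right[symmetric] by simp

text \<open>The equation says nothing at r = 0; by l'Hospital's rule the one-sided derivative there
  is the limit of the interior derivatives.\<close>

lemma halfline_DERIV_0:
  fixes f :: "real \<Rightarrow> real"
  assumes cont: "continuous_on {0..} f"
    and der: "\<And>r. r > 0 \<Longrightarrow> (f has_real_derivative f' r) (at r)"
    and lim: "(f' \<longlongrightarrow> l) (at_right 0)"
  shows "(f has_real_derivative l) (at 0 within {0..})"
proof -
  have "(f \<longlongrightarrow> f 0) (at_right 0)"
    using cont by (rule halfline_tendsto_0)
  then have "((\<lambda>r. f r - f 0) \<longlongrightarrow> 0) (at_right 0)"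
    by (auto intro!: tendsto_eq_intros)
  then have "((\<lambda>r. (f r - f 0) / r) \<longlongrightarrow> l) (at_right 0)"
  proof (rule lhopital_right)
    have "((\<lambda>r. f r - f 0) has_real_derivative f' r) (at r)" if "r > 0" for r
      using der[OF that] by (auto intro!: derivative_eq_intros)
    then show "\<forall>\<^sub>F r in at_right 0. ((\<lambda>r. f r - f 0) has_real_derivative f' r) (at r)"
      by (auto simp: eventually_at_right_field intro!: exI[of _ 1])
    show "\<forall>\<^sub>F r in at_right 0. ((\<lambda>r::real. r) has_real_derivative 1) (at r)" by simp
  qed (use lim in \<open>auto simp: eventually_at_filter tendsto_ident_at\<close>)
  then show ?thesis by (simp add: has_field_derivative_iff at_within_Ici_at_right)
qed

context radial_system
begin

lemma solD:
  assumes "sol a f w"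
  shows "continuous_on {0..} f" "continuous_on {0..} w" "f 0 = a" "w 0 = 0"
    "0 < r \<Longrightarrow> (f has_real_derivative - p_flux (m + 1) (w r)) (at r)"
    "0 < r \<Longrightarrow> (w has_real_derivative f r - (real N - 1) / r * w r - \<bar>w r\<bar>) (at r)"
proof -
  have s: "sol_on b a f w" for b using assms by (simp add: sol_def)
  have "continuous_on {0..} g" if "\<And>b. continuous_on {0..b} g" for g :: "real \<Rightarrow> real"
    unfolding continuous_on_eq_continuous_within
  proof
    fix x :: real assume x: "x \<in> {0..}"
    have "at x within {0..} = at x within {0..x + 1}"
      by (rule at_within_nhd[where S = "{..<x + 1}"]) auto
    then show "continuous (at x within {0..}) g"
      using that[of "x + 1"] x by (simp add: continuous_on_eq_continuous_within)
  qed
  then show "continuous_on {0..} f" "continuous_on {0..} w" using sol_onD(1,2)[OF s] by blast+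
  show "f 0 = a" "w 0 = 0" using sol_onD(3,4)[OF s] .
  assume "0 < r"
  then show "(f has_real_derivative - p_flux (m + 1) (w r)) (at r)"
    "(w has_real_derivative f r - (real N - 1) / r * w r - \<bar>w r\<bar>) (at r)"
    using sol_onD(5,6)[OF s, of r "r + 1"] by auto
qed

text \<open>The derivative of r^(N-1) w is r^(N-1) (f - |w|), and f - |w| tends to a; comparison
  with c r^N / N for c slightly above and below a pins down the slope. It gives w'(0), and later the
  limit of the quotient of two fluxes at 0.\<close>

lemma sol_flux_slope:
  assumes s: "sol a f w"
  shows "((\<lambda>r. w r / r) \<longlongrightarrow> a / real N) (at_right 0)"
proof -
  define F where "F r = f r - \<bar>w r\<bar>" for r
  have Fc: "continuous_on {0..} F" unfolding F_def[abs_def] using solD[OF s] by (intro continuous_intros)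
  define h where "h c x = x ^ (N - 1) * w x - c * x ^ N / real N" for c x :: real
  have hc: "continuous_on {0..} (h c)" for c
    unfolding h_def[abs_def] using solD[OF s] N_pos by (intro continuous_intros) auto
  have h0: "h c 0 = 0" for c using solD(4)[OF s] N_pos by (simp add: h_def)
  have hd: "(h c has_real_derivative x ^ (N - 1) * (F x - c)) (at x)" if x: "x > 0" for c x
  proof -
    obtain k where k: "N = Suc k" using N_pos by (cases N) auto
    have kx: "real k * x ^ (k - 1) = real k * x ^ k / x" using x by (cases k) auto
    have "((\<lambda>x. c * x ^ Suc k / real (Suc k)) has_real_derivative c * x ^ k) (at x)"
      using DERIV_cdivide[OF DERIV_cmult[OF DERIV_pow[of "Suc k" x]], of c "real (Suc k)"] by simp
    moreover have "((\<lambda>x. x ^ k) has_real_derivative real k * x ^ (k - 1)) (at x)"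
      using DERIV_pow[of k x] by simp
    moreover have "(w has_real_derivative f x - real k / x * w x - \<bar>w x\<bar>) (at x)"
      using solD(6)[OF s x] by (simp add: k)
    ultimately have "(h c has_real_derivative
      (real k * x ^ (k - 1) * w x + (f x - real k / x * w x - \<bar>w x\<bar>) * x ^ k) - c * x ^ k) (at x)"
      unfolding h_def[abs_def] k diff_Suc_1 by (intro DERIV_diff DERIV_mult)
    moreover have "(real k * x ^ (k - 1) * w x + (f x - real k / x * w x - \<bar>w x\<bar>) * x ^ k) - c * x ^ k
        = x ^ (N - 1) * (F x - c)"
      unfolding kx by (simp add: F_def k algebra_simps)
    ultimately show ?thesis by simp
  qed
  have hw: "h c x = x ^ N * (w x / x - c / real N)" if "x > 0" for c x
  proof -
    have "x ^ N = x * x ^ (N - 1)" using N_pos by (simp add: power_eq_if)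
    then show ?thesis using that by (simp add: h_def algebra_simps)
  qed
  show ?thesis
  proof (rule tendstoI)
    fix e :: real assume e: "e > 0"
    have "(F \<longlongrightarrow> a) (at_right 0)"
      using halfline_tendsto_0[OF Fc] solD(3,4)[OF s] by (simp add: F_def)
    then have "\<forall>\<^sub>F x in at_right 0. dist (F x) a < e / 2" using e by (intro tendstoD) auto
    then obtain d where d: "d > 0" "\<And>x. 0 < x \<Longrightarrow> x < d \<Longrightarrow> \<bar>F x - a\<bar> < e / 2"
      by (auto simp: eventually_at_right_field dist_real_def)
    have "\<bar>w x / x - a / real N\<bar> < e" if x: "0 < x" "x < d" for x
    proof -
      have sub: "continuous_on {0..x} (h c)" for c using hc by (rule continuous_on_subset) auto
      have "h (a + e / 2) 0 \<ge> h (a + e / 2) x"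
      proof (rule DERIV_nonpos_ge[OF _ sub hd])
        show "y ^ (N - 1) * (F y - (a + e / 2)) \<le> 0" if "0 < y" "y < x" for y
        proof -
          have "\<bar>F y - a\<bar> < e / 2" using d(2)[of y] that x by simp
          then have "F y - (a + e / 2) \<le> 0" by linarith
          then show ?thesis using that by (intro mult_nonneg_nonpos) auto
        qed
      qed (use x in auto)
      then have 1: "w x / x - (a + e / 2) / real N \<le> 0"
        using x hw[of x "a + e/2"] h0 zero_less_power[OF x(1), of N]
        by (simp add: mult_le_0_iff del: zero_less_power)
      have "h (a - e / 2) 0 \<le> h (a - e / 2) x"
      proof (rule DERIV_nonneg_le[OF _ sub hd])
        show "y ^ (N - 1) * (F y - (a - e / 2)) \<ge> 0" if "0 < y" "y < x" for y
        proof -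
          have "\<bar>F y - a\<bar> < e / 2" using d(2)[of y] that x by simp
          then have "F y - (a - e / 2) \<ge> 0" by linarith
          then show ?thesis using that by (intro mult_nonneg_nonneg) auto
        qed
      qed (use x in auto)
      then have 2: "w x / x - (a - e / 2) / real N \<ge> 0"
        using x hw[of x "a - e/2"] h0 zero_less_power[OF x(1), of N]
        by (simp add: zero_le_mult_iff del: zero_less_power)
      have "e / 2 / real N \<le> e / 2 / 1" using N_pos e by (intro divide_left_mono) auto
      then show ?thesis using 1 2 e unfolding add_divide_distrib diff_divide_distrib by (simp add: abs_less_iff)
    qed
    then show "\<forall>\<^sub>F x in at_right 0. dist (w x / x) (a / real N) < e"
      using d(1) by (auto simp: eventually_at_right_field dist_real_def)
  qed
qed

lemma sol_deriv_halfline: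
  assumes s: "sol a f w" and r: "r \<ge> 0"
  shows "(f has_real_derivative - p_flux (m + 1) (w r)) (at r within {0..})"
    "deriv_halfline f r = - p_flux (m + 1) (w r)"
proof -
  show *: "(f has_real_derivative - p_flux (m + 1) (w r)) (at r within {0..})"
  proof (cases "r = 0")
    case True
    have "continuous_on {0..} (\<lambda>r. - p_flux (m + 1) (w r))"
      using solD[OF s] m_gt_1 by (intro continuous_intros continuous_on_p_flux) auto
    then have "((\<lambda>r. - p_flux (m + 1) (w r)) \<longlongrightarrow> - p_flux (m + 1) (w 0)) (at_right 0)"
      by (rule halfline_tendsto_0)
    from halfline_DERIV_0[OF solD(1)[OF s] solD(5)[OF s] this] show ?thesis using True by simp
  next
    case False
    then show ?thesis using r solD(5)[OF s, of r] by (simp add: at_within_halfline_pos)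
  qed
  then show "deriv_halfline f r = - p_flux (m + 1) (w r)" using r by (rule deriv_halflineI)
qed

lemma sol_imp_is_solution:
  assumes s: "sol a f w" and p: "(p - 1) * m = 1"
  shows "is_solution N p a f"
proof -
  have inv: "p_flux p (p_flux (m + 1) x) = x" for x using p by (intro p_flux_inverse) simp
  have fl: "p_flux p (deriv_halfline f r) = - w r" if "r \<ge> 0" for r
    using sol_deriv_halfline[OF s that] by (simp add: p_flux_minus inv)
  \<comment> \<open>The value at 0 is the limit of the right-hand side: w/r tends to a/N, and a -
    (N-1) a/N = a/N.\<close>
  define w' where "w' r = (if r = 0 then a / real N else f r - (real N - 1) / r * w r - \<bar>w r\<bar>)" for r
  have lim0: "(w' \<longlongrightarrow> a / real N) (at_right 0)"
  proof -
    have fw: "(f \<longlongrightarrow> a) (at_right 0)" "(w \<longlongrightarrow> 0) (at_right 0)"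
      using halfline_tendsto_0[OF solD(1)[OF s]] halfline_tendsto_0[OF solD(2)[OF s]] solD(3,4)[OF s] by auto
    have "((\<lambda>r. f r - (real N - 1) * (w r / r) - \<bar>w r\<bar>) \<longlongrightarrow> a - (real N - 1) * (a / real N) - \<bar>0\<bar>) (at_right 0)"
      by (intro tendsto_intros fw sol_flux_slope[OF s])
    moreover have "a - (real N - 1) * (a / real N) - \<bar>0\<bar> = a / real N"
      using N_pos by (simp add: field_simps)
    moreover have "\<forall>\<^sub>F r in at_right 0. f r - (real N - 1) * (w r / r) - \<bar>w r\<bar> = w' r"
      by (auto simp: eventually_at_filter w'_def)
    ultimately show ?thesis by (auto intro: Lim_transform_eventually)
  qed
  have w: "(w has_real_derivative w' r) (at r within {0..})" if "r \<ge> 0" for r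
  proof (cases "r = 0")
    case True
    have "(w has_real_derivative w' r) (at r)" if "r > 0" for r
      using solD(6)[OF s that] that by (simp add: w'_def)
    from halfline_DERIV_0[OF solD(2)[OF s] this lim0] show ?thesis using True by (simp add: w'_def)
  next
    case False
    then show ?thesis using that solD(6)[OF s, of r] by (simp add: at_within_halfline_pos w'_def)
  qed
  have w'c: "continuous_on {0..} w'"
    unfolding continuous_on_def
  proof
    fix r :: real assume r: "r \<in> {0..}"
    show "(w' \<longlongrightarrow> w' r) (at r within {0..})"
    proof (cases "r = 0")
      case True
      then show ?thesis using lim0 by (simp add: at_within_Ici_at_right w'_def)
    next
      case False
      then have "r > 0" using r by simp
      have "isCont f r" "isCont w r" using solD(5,6)[OF s \<open>r > 0\<close>] by (auto intro: DERIV_isCont)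
      then have "isCont (\<lambda>r. f r - (real N - 1) / r * w r - \<bar>w r\<bar>) r"
        using False by (intro continuous_intros) auto
      then have "((\<lambda>r. f r - (real N - 1) / r * w r - \<bar>w r\<bar>) \<longlongrightarrow> w' r) (at r)"
        using False by (simp add: isCont_def w'_def)
      moreover have "\<forall>\<^sub>F x in at r. x \<in> {0<..}"
        using \<open>r > 0\<close> by (intro eventually_at_in_open') auto
      then have "\<forall>\<^sub>F x in at r. f x - (real N - 1) / x * w x - \<bar>w x\<bar> = w' x"
        by (rule eventually_mono) (auto simp: w'_def)
      ultimately have "(w' \<longlongrightarrow> w' r) (at r)" by (rule Lim_transform_eventually)
      then show ?thesis using \<open>r > 0\<close> by (simp add: at_within_halfline_pos)
    qed
  qed
  have flux: "((\<lambda>r. p_flux p (deriv_halfline f r)) has_real_derivative - w' r) (at r within {0..})"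
    if "r \<ge> 0" for r
  proof (rule has_field_derivative_transform_within[where d = 1])
    show "((\<lambda>r. - w r) has_real_derivative - w' r) (at r within {0..})"
      using w[OF that] by (rule DERIV_minus)
  qed (use that fl in auto)
  have "C1_halfline f"
    by (rule C1_halflineI[OF sol_deriv_halfline(1)[OF s]])
      (use solD[OF s] m_gt_1 in \<open>auto intro!: continuous_intros continuous_on_p_flux\<close>)
  moreover have "C1_halfline (\<lambda>r. p_flux p (deriv_halfline f r))"
    by (rule C1_halflineI[OF flux]) (use w'c in \<open>auto intro!: continuous_intros\<close>)
  moreover have "deriv_halfline (\<lambda>s. p_flux p (deriv_halfline f s)) r
            + (real N - 1) / r * p_flux p (deriv_halfline f r)
            + f r - \<bar>deriv_halfline f r\<bar> powr (p - 1) = 0" if "r > 0" for r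
    using that deriv_halflineI[OF flux, of r] fl[of r]
    by (simp add: abs_p_flux[of p, symmetric] w'_def)
  moreover have "deriv_halfline f 0 = 0"
    using sol_deriv_halfline[OF s, of 0] solD(4)[OF s] by (simp add: p_flux_def)
  ultimately show ?thesis using solD(3)[OF s] by (simp add: is_solution_def)
qed

lemma is_solution_imp_sol:
  assumes s: "is_solution N p a f" and p: "(p - 1) * m = 1"
  shows "sol a f (\<lambda>r. - p_flux p (deriv_halfline f r))"
proof -
  have inv: "p_flux (m + 1) (p_flux p x) = x" for x
    using p by (intro p_flux_inverse) (simp add: mult.commute)
  define v where "v r = p_flux p (deriv_halfline f r)" for r
  have f: "(f has_real_derivative deriv_halfline f r) (at r within {0..})"
    and v: "(v has_real_derivative deriv_halfline v r) (at r within {0..})" if "r \<ge> 0" for r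
    using s that unfolding v_def[abs_def] by (auto simp: is_solution_def C1_halfline_def intro!: deriv_halfline_works)
  have c: "continuous_on {0..} f" "continuous_on {0..} v"
    using f v by (auto intro!: DERIV_continuous_on)
  have "sol a f (\<lambda>r. - v r)"
    unfolding sol_def sol_on_def
  proof (intro conjI allI impI)
    fix b
    show "continuous_on {0..b} f" "continuous_on {0..b} (\<lambda>r. - v r)"
      using c by (auto intro!: continuous_intros intro: continuous_on_subset)
    show "f 0 = a" "- v 0 = 0" using s by (auto simp: is_solution_def v_def p_flux_def)
    fix r assume "0 < r \<and> r < b"
    then have r: "r > 0" by simp
    show "(f has_real_derivative - p_flux (m + 1) (- v r)) (at r)"
      using f[of r] r by (simp add: at_within_halfline_pos v_def p_flux_minus inv)
    have "deriv_halfline v r + (real N - 1) / r * v r + f r - \<bar>v r\<bar> = 0"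
      using s r unfolding v_def by (simp add: is_solution_def abs_p_flux)
    then have "f r - (real N - 1) / r * - v r - \<bar>- v r\<bar> = - deriv_halfline v r" by simp
    then show "((\<lambda>r. - v r) has_real_derivative f r - (real N - 1) / r * - v r - \<bar>- v r\<bar>) (at r)"
      using DERIV_minus[OF v[of r]] r by (simp add: at_within_halfline_pos)
  qed
  then show ?thesis by (simp add: v_def)
qed


section \<open>Weights and the Pohozaev function\<close>

text \<open>The integrating factor of the linear terms (N-1)/r * w + w. Below, \<open>vol\<close> is
  the variable t of the overview and \<open>damp\<close> is the logarithmic derivative of
  \<open>wt\<close>.\<close>

definition wt :: "real \<Rightarrow> real" where "wt r = r ^ (N - 1) * exp r"

definition vol :: "real \<Rightarrow> real" where "vol r = integral {0..r} wt"

definition damp :: "real \<Rightarrow> real" where "damp r = 1 + (real N - 1) / r"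

lemma real_N: "real N \<ge> 1" using N_pos by simp

lemma wt_pos: "r > 0 \<Longrightarrow> wt r > 0" by (simp add: wt_def)

lemma wt_nonneg: "r \<ge> 0 \<Longrightarrow> wt r \<ge> 0" by (simp add: wt_def)

lemma damp_ge: "r > 0 \<Longrightarrow> damp r \<ge> 1" using real_N by (simp add: damp_def)

lemma wt_continuous: "continuous_on S wt"
  unfolding wt_def[abs_def] by (intro continuous_intros)

lemma wt_DERIV:
  assumes "r > 0"
  shows "(wt has_real_derivative wt r * damp r) (at r)"
proof -
  obtain k where k: "N - 1 = k" "real N = real k + 1" using N_pos by (cases N) auto
  have kr: "real k * r ^ (k - 1) = real k * r ^ k / r" using assms by (cases k) auto
  have "((\<lambda>r. r ^ k) has_real_derivative real k * r ^ (k - 1)) (at r)"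
    using DERIV_pow[of k r] by simp
  from DERIV_mult[OF this DERIV_exp]
  have "(wt has_real_derivative real k * r ^ (k - 1) * exp r + exp r * r ^ k) (at r)"
    unfolding wt_def[abs_def] k .
  then show ?thesis unfolding kr by (rule DERIV_cong) (simp add: wt_def damp_def k(2) algebra_simps flip: k(1))
qed

lemma wt_mono: "0 \<le> x \<Longrightarrow> x \<le> y \<Longrightarrow> wt x \<le> wt y"
  unfolding wt_def by (intro mult_mono power_mono) auto

lemma vol_0: "vol 0 = 0" by (simp add: vol_def)

lemma vol_continuous: "continuous_on {0..b} vol"
  unfolding vol_def[abs_def]
  by (intro indefinite_integral_continuous_1 integrable_continuous_real wt_continuous)

lemma vol_DERIV:
  assumes "r > 0"
  shows "(vol has_real_derivative wt r) (at r)"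
proof -
  have "(vol has_real_derivative wt r) (at r within {0..r + 1})"
    unfolding vol_def[abs_def] using assms by (intro integral_has_real_derivative wt_continuous) auto
  then show ?thesis using assms by (simp add: at_within_Icc_at)
qed

lemma vol_pos: "r > 0 \<Longrightarrow> vol r > 0"
  using DERIV_pos_less[of 0 r vol wt] by (simp add: vol_continuous vol_DERIV vol_0 wt_pos)

lemma vol_nonneg: "r \<ge> 0 \<Longrightarrow> vol r \<ge> 0"
  using vol_pos[of r] vol_0 by (cases "r = 0") auto

text \<open>The difference of the two sides has derivative r * wt. The estimate is sharp as r tends
  to 0, which is why it bounds \<open>gain\<close> near 0 by values close to (N-1)/N.\<close>

lemma vol_le:
  assumes "r \<ge> 0"
  shows "real N * vol r \<le> r * wt r"
proof -
  have "(0::real) * wt 0 - real N * vol 0 \<le> r * wt r - real N * vol r"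
  proof (rule DERIV_nonneg_le[OF assms])
    show "continuous_on {0..r} (\<lambda>r. r * wt r - real N * vol r)"
      by (intro continuous_intros wt_continuous vol_continuous)
    fix x :: real assume x: "0 < x" "x < r"
    show "((\<lambda>r. r * wt r - real N * vol r) has_real_derivative
        (1 * wt x + wt x * damp x * x) - real N * wt x) (at x)"
      by (intro DERIV_diff DERIV_mult DERIV_cmult DERIV_ident wt_DERIV vol_DERIV x)
    have "(1 * wt x + wt x * damp x * x) - real N * wt x = x * wt x"
      using x by (simp add: damp_def field_simps)
    then show "(1 * wt x + wt x * damp x * x) - real N * wt x \<ge> 0" using x by (simp add: wt_nonneg)
  qed
  then show ?thesis by (simp add: vol_0)
qed

lemma vol_le_wt:
  assumes "r \<ge> 0"
  shows "vol r \<le> wt r"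
proof -
  have "wt 0 - vol 0 \<le> wt r - vol r"
  proof (rule DERIV_nonneg_le[OF assms])
    show "continuous_on {0..r} (\<lambda>r. wt r - vol r)"
      by (intro continuous_intros wt_continuous vol_continuous)
    fix x :: real assume x: "0 < x" "x < r"
    show "((\<lambda>r. wt r - vol r) has_real_derivative wt x * damp x - wt x) (at x)"
      by (intro DERIV_diff wt_DERIV vol_DERIV x)
    show "wt x * damp x - wt x \<ge> 0"
      using mult_left_mono[OF damp_ge[OF x(1)] wt_nonneg[of x]] x by simp
  qed
  moreover have "wt 0 \<ge> 0" by (simp add: wt_nonneg)
  ultimately show ?thesis by (simp add: vol_0)
qed

lemma vol_ge:
  assumes "r \<ge> 0"
  shows "r ^ N / real N \<le> vol r"
proof -
  have "vol 0 - 0 ^ N / real N \<le> vol r - r ^ N / real N"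
  proof (rule DERIV_nonneg_le[OF assms])
    show "continuous_on {0..r} (\<lambda>r. vol r - r ^ N / real N)"
      by (intro continuous_intros vol_continuous) (use N_pos in auto)
    fix x :: real assume x: "0 < x" "x < r"
    have "((\<lambda>x. x ^ N / real N) has_real_derivative x ^ (N - 1)) (at x)"
      using DERIV_cdivide[OF DERIV_pow[of N x], of "real N"] N_pos by simp
    then show "((\<lambda>r. vol r - r ^ N / real N) has_real_derivative wt x - x ^ (N - 1)) (at x)"
      by (intro DERIV_diff vol_DERIV x)
    show "wt x - x ^ (N - 1) \<ge> 0" using x by (simp add: wt_def)
  qed
  then show ?thesis using N_pos by (simp add: vol_0 zero_power)
qed

lemma wt_at_top: "filterlim wt at_top at_top"
proof (rule filterlim_at_top_mono[OF exp_at_top])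
  show "\<forall>\<^sub>F r in at_top. exp r \<le> wt r"
    using eventually_ge_at_top[of 1]
  proof eventually_elim
    case (elim r)
    then have "1 * exp r \<le> r ^ (N - 1) * exp r" by (intro mult_right_mono one_le_power) auto
    then show ?case by (simp add: wt_def)
  qed
qed

lemma vol_wt_tendsto: "((\<lambda>r. vol r / wt r) \<longlongrightarrow> 1) at_top"
proof (rule lhospital_at_top_at_top[OF wt_at_top])
  show "\<forall>\<^sub>F r in at_top. wt r * damp r \<noteq> 0"
    using eventually_gt_at_top[of 0]
    by eventually_elim (use damp_ge wt_pos in force)
  show "\<forall>\<^sub>F r in at_top. (vol has_real_derivative wt r) (at r)"
    using eventually_gt_at_top[of 0] by eventually_elim (rule vol_DERIV)
  show "\<forall>\<^sub>F r in at_top. (wt has_real_derivative wt r * damp r) (at r)"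
    using eventually_gt_at_top[of 0] by eventually_elim (rule wt_DERIV)
  have "((\<lambda>r. 1 / (1 + (real N - 1) / r)) \<longlongrightarrow> 1 / (1 + 0)) at_top"
    by (intro tendsto_intros real_tendsto_divide_at_top[OF tendsto_const filterlim_ident]) auto
  moreover have "\<forall>\<^sub>F r in at_top. 1 / (1 + (real N - 1) / r) = wt r / (wt r * damp r)"
    using eventually_gt_at_top[of 0]
    by eventually_elim (use wt_pos in \<open>force simp: damp_def\<close>)
  ultimately show "((\<lambda>r. wt r / (wt r * damp r)) \<longlongrightarrow> 1) at_top"
    by (auto intro: Lim_transform_eventually)
qed

text \<open>Equal to vol * wt' / wt^2. It competes with \<open>theta\<close> in the derivative of
  the Pohozaev function: growth where it is smaller, decay where it is larger.\<close>

definition gain :: "real \<Rightarrow> real" where "gain r = vol r * damp r / wt r"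

lemma gain_le:
  assumes "r > 0"
  shows "gain r \<le> (real N - 1 + r) / real N"
proof -
  have "gain r \<le> (r * wt r / real N) * damp r / wt r"
    unfolding gain_def using vol_le[of r] assms wt_pos[OF assms] damp_ge[OF assms] real_N
    by (intro divide_right_mono mult_right_mono) (auto simp: field_simps)
  also have "\<dots> = (real N - 1 + r) / real N"
    using assms wt_pos[OF assms] N_pos by (simp add: damp_def divide_simps)
  finally show ?thesis .
qed

text \<open>This is gain' \<ge> 0 cleared of denominators. Divided by the bracket it reads vol \<le>
  wt * u, and the difference wt * u - vol has derivative 2 x (N-1) wt / Q^2 \<ge> 0.\<close>

lemma vol_le_gain_deriv_bound:
  assumes r: "r > 0"
  shows "vol r * ((r + real N - 1)\<^sup>2 + (real N - 1)) \<le> wt r * (r * (r + real N - 1))"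
proof -
  define s where "s r = r + real N - 1" for r :: real
  define Q where "Q r = (s r)\<^sup>2 + (real N - 1)" for r :: real
  define u where "u r = r * s r / Q r" for r
  have s: "s x > 0" and Q: "Q x > 0" if "x > 0" for x
    using that real_N by (auto simp: s_def Q_def intro!: add_pos_nonneg)
  have u: "u x \<ge> 0" if "x > 0" for x using s[OF that] Q[OF that] that by (simp add: u_def)
  have D: "((\<lambda>r. wt r * u r - vol r) has_real_derivative
      (wt x * damp x * u x + ((s x + x) * Q x - x * s x * (2 * s x)) / (Q x * Q x) * wt x) - wt x) (at x)"
    if x: "x > 0" for x
  proof -
    have "(s has_real_derivative 1) (at x)"
      unfolding s_def[abs_def] by (auto intro!: derivative_eq_intros)
    then have "(u has_real_derivative ((s x + x) * Q x - x * s x * (2 * s x)) / (Q x * Q x)) (at x)"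
      unfolding u_def[abs_def] Q_def[abs_def] using Q[OF x, unfolded Q_def]
      by (auto intro!: derivative_eq_intros simp: algebra_simps power2_eq_square)
    then show ?thesis by (intro DERIV_diff DERIV_mult wt_DERIV vol_DERIV x)
  qed
  have pos: "(wt x * damp x * u x + ((s x + x) * Q x - x * s x * (2 * s x)) / (Q x * Q x) * wt x) - wt x \<ge> 0"
    if x: "x > 0" for x
  proof -
    have "damp x = s x / x" using x by (simp add: damp_def s_def field_simps)
    then have "damp x * u x + ((s x + x) * Q x - x * s x * (2 * s x)) / (Q x * Q x) - 1
      = (s x * s x * Q x + ((s x + x) * Q x - x * s x * (2 * s x)) - Q x * Q x) / (Q x * Q x)"
      using x Q[OF x] by (simp add: u_def field_simps)
    also have "s x * s x * Q x + ((s x + x) * Q x - x * s x * (2 * s x)) - Q x * Q x = 2 * x * (real N - 1)"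
      unfolding Q_def s_def by algebra
    finally have "damp x * u x + ((s x + x) * Q x - x * s x * (2 * s x)) / (Q x * Q x) - 1 \<ge> 0"
      using x real_N Q[OF x] by simp
    from mult_nonneg_nonneg[OF wt_nonneg this, of x] show ?thesis using x by (simp add: algebra_simps)
  qed
  \<comment> \<open>For N = 1 the bracket \<open>Q\<close> vanishes at 0, so the comparison starts
    at e > 0 and then e tends to 0.\<close>
  have "- vol e \<le> wt r * u r - vol r" if e: "0 < e" "e < r" for e
  proof -
    have "wt e * u e - vol e \<le> wt r * u r - vol r"
      by (rule DERIV_nonneg_le[where f = "\<lambda>r. wt r * u r - vol r", OF _ _ D pos])
        (use e in \<open>auto intro!: continuous_at_imp_continuous_on DERIV_isCont[OF D]\<close>)
    moreover have "wt e * u e \<ge> 0" using e u wt_nonneg[of e] by simp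
    ultimately show ?thesis by linarith
  qed
  moreover have "((\<lambda>e. - vol e) \<longlongrightarrow> - 0) (at_right 0)"
    using vol_continuous[of 1] vol_0
    by (intro tendsto_minus) (auto simp: continuous_on_def at_within_Icc_at_right dest!: bspec[of _ _ 0])
  ultimately have "- 0 \<le> wt r * u r - vol r"
    using r by (intro tendsto_upperbound[of "\<lambda>e. - vol e" _ "at_right 0"])
      (auto simp: eventually_at_right_field)
  then have "vol r * Q r \<le> wt r * u r * Q r" using Q[OF r] by (intro mult_right_mono) auto
  also have "\<dots> = wt r * (r * s r)" using Q[OF r] by (simp add: u_def)
  finally show ?thesis by (simp add: Q_def s_def)
qed

text \<open>Consequently the set where gain \<le> theta is an initial interval, and the Pohozaev
  function cannot grow again after it has begun to decrease.\<close>

lemma gain_mono: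
  assumes "0 < x" "x \<le> y"
  shows "gain x \<le> gain y"
proof -
  have D: "(gain has_real_derivative
      ((wt r * damp r + (- (real N - 1) / r\<^sup>2) * vol r) * wt r - vol r * damp r * (wt r * damp r)) / (wt r * wt r)) (at r)"
    if r: "r > 0" for r
  proof -
    have "(damp has_real_derivative - (real N - 1) / r\<^sup>2) (at r)"
      unfolding damp_def[abs_def] using r by (auto intro!: derivative_eq_intros simp: power2_eq_square)
    then show ?thesis
      unfolding gain_def[abs_def] using wt_pos[OF r] by (intro DERIV_divide DERIV_mult wt_DERIV vol_DERIV r) auto
  qed
  have pos: "((wt r * damp r + (- (real N - 1) / r\<^sup>2) * vol r) * wt r - vol r * damp r * (wt r * damp r)) / (wt r * wt r) \<ge> 0"
    if r: "r > 0" for r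
  proof -
    have "(wt r * damp r + (- (real N - 1) / r\<^sup>2) * vol r) * wt r - vol r * damp r * (wt r * damp r)
        = wt r * (wt r * (r * (r + real N - 1)) - vol r * ((r + real N - 1)\<^sup>2 + (real N - 1))) / r\<^sup>2"
      using r by (simp add: damp_def field_simps power2_eq_square)
    also have "\<dots> \<ge> 0"
      using vol_le_gain_deriv_bound[OF r] wt_nonneg[of r] r by simp
    finally show ?thesis using wt_pos[OF r] by simp
  qed
  show ?thesis
    by (rule DERIV_nonneg_le[where f = gain, OF _ _ D pos])
      (use assms in \<open>auto intro!: continuous_at_imp_continuous_on DERIV_isCont[OF D]\<close>)
qed

text \<open>Equal to 1/2 + 1/(m+1), the contributions of the two summands of the Pohozaev function
  to its derivative.\<close>

definition theta :: real where "theta = (m + 3) / (2 * (m + 1))"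

text \<open>Equivalent to the subcriticality of m: at r = 0, where \<open>gain\<close> starts from
  (N-1)/N, the Pohozaev function grows.\<close>

lemma theta_gt: "theta > (real N - 1) / real N"
proof -
  have "m * real N - 2 * m < real N + 2" using subcritical by (simp add: algebra_simps)
  then have "(real N - 1) * (2 * (m + 1)) < (m + 3) * real N" by (simp add: algebra_simps)
  then show ?thesis unfolding theta_def using real_N m_gt_1 by (simp add: divide_simps)
qed

text \<open>Half the radius at which the bound (N-1+r)/N for \<open>gain\<close> reaches
  \<open>theta\<close>, so that half of the initial gap is still left there. The cap 1 keeps exp r
  below 3.\<close>

definition sub_radius :: real where "sub_radius = min 1 ((theta * real N - (real N - 1)) / 2)"

lemma sub_radius: "0 < sub_radius" "sub_radius \<le> 1"
  using theta_gt real_N by (auto simp: sub_radius_def divide_simps)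

lemma gain_lt_theta:
  assumes "0 < r" "r \<le> sub_radius"
  shows "gain r \<le> theta - (theta - (real N - 1) / real N) / 2"
proof -
  have "gain r \<le> (real N - 1 + r) / real N" by (rule gain_le[OF assms(1)])
  also have "\<dots> \<le> (real N - 1 + (theta * real N - (real N - 1)) / 2) / real N"
    using assms by (intro divide_right_mono) (auto simp: sub_radius_def)
  also have "\<dots> = theta - (theta - (real N - 1) / real N) / 2"
    using real_N by (simp add: field_simps)
  finally show ?thesis .
qed


section \<open>Solutions on an interval of positivity\<close>

text \<open>Positivity is required on [0, R) only, so that R may be the first zero of f.\<close>

definition pos_on :: "real \<Rightarrow> real \<Rightarrow> (real \<Rightarrow> real) \<Rightarrow> (real \<Rightarrow> real) \<Rightarrow> bool" where
  "pos_on R a f w \<longleftrightarrow> sol a f w \<and> a > 0 \<and> (\<forall>r. 0 \<le> r \<and> r < R \<longrightarrow> f r > 0)"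

lemma pos_on_mono: "pos_on R a f w \<Longrightarrow> S \<le> R \<Longrightarrow> pos_on S a f w"
  by (auto simp: pos_on_def)

lemma sol_continuous:
  assumes "sol a f w" "0 \<le> x"
  shows "continuous_on {x..y} f" "continuous_on {x..y} w"
  using continuous_on_subset[OF solD(1)[OF assms(1)]] continuous_on_subset[OF solD(2)[OF assms(1)]] assms(2)
  by auto

text \<open>The sign must be known before |w| can be merged with the linear terms, so it is proved
  by Gronwall's argument for the negative part: where w < 0, the terms with f > 0 and with the
  singular coefficient both push w upwards, and only |w| contributes growth.\<close>

lemma pos_on_flux_nonneg:
  assumes pos: "pos_on R a f w" and r: "0 \<le> r" "r \<le> R"
  shows "w r \<ge> 0"
proof -
  have s: "sol a f w" using pos by (simp add: pos_on_def)
  \<comment> \<open>\<open>d\<close> is the square of the negative part of \<open>w\<close>, in a form whose differentiability is evident.\<close>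
  define d where "d r = (w r)\<^sup>2 - p_flux 3 (w r)" for r
  have d: "d x = (w x)\<^sup>2 - \<bar>w x\<bar> * w x" for x by (simp add: d_def p_flux_def)
  have "d r * exp (- 2 * r) \<le> d 0 * exp (- 2 * 0)"
  proof (rule DERIV_nonpos_ge[OF r(1)])
    show "continuous_on {0..r} (\<lambda>r. d r * exp (- 2 * r))"
      unfolding d_def by (intro continuous_intros continuous_on_p_flux sol_continuous(2)[OF s]) auto
    fix x assume x: "0 < x" "x < r"
    define v where "v = f x - (real N - 1) / x * w x - \<bar>w x\<bar>"
    define D where "D = 2 * w x * v - 2 * \<bar>w x\<bar> * v"
    have dw: "(w has_real_derivative v) (at x)" unfolding v_def by (rule solD(6)[OF s x(1)])
    have "((\<lambda>r. (w r)\<^sup>2) has_real_derivative 2 * w x * v) (at x)"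
      by (auto intro!: derivative_eq_intros dw)
    moreover have "((\<lambda>r. p_flux 3 (w r)) has_real_derivative 2 * \<bar>w x\<bar> * v) (at x)"
      using DERIV_chain2[OF DERIV_p_flux dw, of 3] by simp
    ultimately have "(d has_real_derivative D) (at x)"
      unfolding d_def[abs_def] D_def by (rule DERIV_diff)
    moreover have "((\<lambda>r. exp (- 2 * r)) has_real_derivative - 2 * exp (- 2 * x)) (at x)"
      by (auto intro!: derivative_eq_intros)
    ultimately show "((\<lambda>r. d r * exp (- 2 * r)) has_real_derivative
        D * exp (- 2 * x) + (- 2 * exp (- 2 * x)) * d x) (at x)"
      by (rule DERIV_mult)
    have "D \<le> 2 * d x"
    proof (cases "w x \<ge> 0")
      case True
      then show ?thesis by (simp add: D_def d power2_eq_square)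
    next
      case False
      have "f x > 0" using pos x r by (simp add: pos_on_def)
      then have "w x * f x \<le> 0" using False by (simp add: mult_nonpos_nonneg)
      moreover define k where "k = (real N - 1) / x"
      moreover have "k * (w x * w x) \<ge> 0" using real_N x by (simp add: k_def)
      moreover have "D = 4 * (w x * f x) - 4 * (k * (w x * w x)) + 4 * (w x * w x)"
        using False unfolding D_def v_def k_def[symmetric] by (simp add: algebra_simps)
      moreover have "2 * d x = 4 * (w x * w x)" using False by (simp add: d power2_eq_square)
      ultimately show ?thesis by linarith
    qed
    then have "(D - 2 * d x) * exp (- 2 * x) \<le> 0" by (intro mult_nonpos_nonneg) auto
    then show "D * exp (- 2 * x) + (- 2 * exp (- 2 * x)) * d x \<le> 0" by (simp add: algebra_simps)
  qed
  then have "d r \<le> 0" using solD(4)[OF s] by (simp add: d mult_le_0_iff)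
  moreover have "d r = 2 * (w r)\<^sup>2" if "w r < 0" using that by (simp add: d power2_eq_square)
  ultimately show ?thesis by (metis not_le zero_less_power2 mult_pos_pos zero_less_numeral less_irrefl)
qed

text \<open>With respect to t this is y' = f for y = wt * w; the sign of w turns |w| into w, which
  the integrating factor absorbs.\<close>

lemma mass_DERIV:
  assumes pos: "pos_on R a f w" and r: "0 < r" "r \<le> R"
  shows "((\<lambda>r. wt r * w r) has_real_derivative wt r * f r) (at r)"
proof -
  have s: "sol a f w" using pos by (simp add: pos_on_def)
  have "w r \<ge> 0" using pos_on_flux_nonneg[OF pos] r by simp
  with DERIV_mult[OF wt_DERIV[OF r(1)] solD(6)[OF s r(1)]]
  show ?thesis by (simp add: damp_def algebra_simps)
qed

lemma pos_on_flux_pos: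
  assumes pos: "pos_on R a f w" and r: "0 < r" "r \<le> R"
  shows "w r > 0"
proof -
  have s: "sol a f w" using pos by (simp add: pos_on_def)
  have "wt 0 * w 0 < wt r * w r"
    by (rule DERIV_pos_less[where f = "\<lambda>r. wt r * w r", OF r(1) _ mass_DERIV[OF pos]])
      (use r pos in \<open>auto intro!: continuous_intros wt_continuous sol_continuous[OF s] simp: pos_on_def wt_pos\<close>)
  then show ?thesis using wt_pos[OF r(1)] solD(4)[OF s] by (simp add: zero_less_mult_iff)
qed

lemma pos_on_DERIV:
  assumes pos: "pos_on R a f w" and r: "0 < r" "r \<le> R"
  shows "(f has_real_derivative - (w r powr m)) (at r)"
    "(w has_real_derivative f r - damp r * w r) (at r)"
proof -
  have s: "sol a f w" using pos by (simp add: pos_on_def)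
  have w: "w r > 0" using pos_on_flux_pos[OF pos r] .
  show "(f has_real_derivative - (w r powr m)) (at r)"
    using solD(5)[OF s r(1)] w by (simp add: p_flux_pos)
  show "(w has_real_derivative f r - damp r * w r) (at r)"
    using solD(6)[OF s r(1)] w by (simp add: damp_def algebra_simps)
qed

lemma pos_on_decreasing:
  assumes pos: "pos_on R a f w" and xy: "0 \<le> x" "x < y" "y \<le> R"
  shows "f y < f x"
proof -
  have s: "sol a f w" using pos by (simp add: pos_on_def)
  show ?thesis
    by (rule DERIV_neg_gt[where f = f, OF xy(2) _ pos_on_DERIV(1)[OF pos]])
      (use xy pos_on_flux_pos[OF pos] in \<open>auto intro!: sol_continuous[OF s] simp: less_imp_neq[symmetric]\<close>)
qed

text \<open>With respect to t, y is strictly concave with y(0) = 0, hence t y' < y. It serves as a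
  lower bound vol / wt for w / f.\<close>

lemma vol_f_less_mass:
  assumes pos: "pos_on R a f w" and r: "0 < r" "r \<le> R"
  shows "vol r * f r < wt r * w r"
proof -
  have s: "sol a f w" using pos by (simp add: pos_on_def)
  have "wt 0 * w 0 - vol 0 * f 0 < wt r * w r - vol r * f r"
  proof (rule DERIV_pos_less[OF r(1)])
    show "continuous_on {0..r} (\<lambda>r. wt r * w r - vol r * f r)"
      by (intro continuous_intros wt_continuous vol_continuous sol_continuous[OF s]) auto
    fix x assume x: "0 < x" "x < r"
    then have xR: "x \<le> R" using r by simp
    show "((\<lambda>r. wt r * w r - vol r * f r) has_real_derivative
        wt x * f x - (wt x * f x + (- (w x powr m)) * vol x)) (at x)"
      by (intro DERIV_diff DERIV_mult mass_DERIV[OF pos] pos_on_DERIV[OF pos] vol_DERIV x xR)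
    show "wt x * f x - (wt x * f x + (- (w x powr m)) * vol x) > 0"
      using vol_pos[OF x(1)] pos_on_flux_pos[OF pos x(1) xR] by simp
  qed
  then show ?thesis using solD(4)[OF s] by (simp add: vol_0)
qed

text \<open>The formula of the overview with t = vol, y = wt * w and y' = f; the weight Q disappears
  because Q y^(m+1) = w^(m+1).\<close>

definition poh :: "(real \<Rightarrow> real) \<Rightarrow> (real \<Rightarrow> real) \<Rightarrow> real \<Rightarrow> real" where
  "poh f w r = f r * (vol r * f r - wt r * w r) / 2 + vol r * w r powr (m + 1) / (m + 1)"

lemma poh_0: "sol a f w \<Longrightarrow> poh f w 0 = 0"
  using solD(4)[of a f w] by (simp add: poh_def vol_0)

lemma poh_continuous:
  assumes pos: "pos_on R a f w"
  shows "continuous_on {0..R} (poh f w)"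
proof -
  have s: "sol a f w" using pos by (simp add: pos_on_def)
  show ?thesis
    unfolding poh_def[abs_def] using m_gt_1 pos_on_flux_nonneg[OF pos]
    by (intro continuous_intros continuous_on_powr' wt_continuous vol_continuous sol_continuous[OF s]) auto
qed

text \<open>All terms containing \<open>f\<close> cancel. What remains is w^(m+1) times theta * wt -
  vol * damp, homogeneous of degree m + 1 in the flux.\<close>

lemma poh_DERIV:
  assumes pos: "pos_on R a f w" and r: "0 < r" "r \<le> R"
  shows "(poh f w has_real_derivative w r powr (m + 1) * (wt r * (theta - gain r))) (at r)"
proof -
  have w: "w r > 0" using pos_on_flux_pos[OF pos r] .
  define W where "W = w r powr m"
  have W1: "w r powr (m + 1) = w r * W" using w by (simp add: W_def powr_add mult.commute)
  have df: "(f has_real_derivative - W) (at r)" and dw: "(w has_real_derivative f r - damp r * w r) (at r)"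
    using pos_on_DERIV[OF pos r] by (simp_all add: W_def)
  have dW: "((\<lambda>r. w r powr (m + 1)) has_real_derivative (m + 1) * W * (f r - damp r * w r)) (at r)"
    using DERIV_chain2[OF has_real_derivative_powr[OF w] dw, of "m + 1"] by (simp add: W_def)
  have dV: "((\<lambda>r. vol r * f r - wt r * w r) has_real_derivative (wt r * f r + (- W) * vol r) - wt r * f r) (at r)"
    by (intro DERIV_diff DERIV_mult mass_DERIV[OF pos r] df vol_DERIV r)
  have "(poh f w has_real_derivative
      ((- W) * (vol r * f r - wt r * w r) + ((wt r * f r + (- W) * vol r) - wt r * f r) * f r) / 2
      + (wt r * w r powr (m + 1) + (m + 1) * W * (f r - damp r * w r) * vol r) / (m + 1)) (at r)"
    unfolding poh_def[abs_def]
    by (intro DERIV_add DERIV_cdivide DERIV_mult df dV dW vol_DERIV r)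
  moreover have "((- W) * (vol r * f r - wt r * w r) + ((wt r * f r + (- W) * vol r) - wt r * f r) * f r) / 2
      + (wt r * w r powr (m + 1) + (m + 1) * W * (f r - damp r * w r) * vol r) / (m + 1)
      = w r powr (m + 1) * (theta * wt r - vol r * damp r)"
    unfolding W1 theta_def using m_gt_1 by (simp add: field_simps)
  moreover have "theta * wt r - vol r * damp r = wt r * (theta - gain r)"
    using wt_pos[OF r(1)] by (simp add: gain_def field_simps)
  ultimately show ?thesis by simp
qed

lemma poh_mono_sub:
  assumes pos: "pos_on R a f w" and xy: "0 \<le> x" "x \<le> y" "y \<le> R" and g: "\<And>r. x < r \<Longrightarrow> r < y \<Longrightarrow> gain r \<le> theta"
  shows "poh f w x \<le> poh f w y"
  by (rule DERIV_nonneg_le[where f = "poh f w", OF xy(2) _ poh_DERIV[OF pos]])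
    (use xy g wt_nonneg in \<open>auto intro: continuous_on_subset[OF poh_continuous[OF pos]]\<close>)

text \<open>Strict growth is obtained on an interval inside \<open>sub_radius\<close>, where the gap
  between \<open>gain\<close> and \<open>theta\<close> is explicit; from there to \<open>r\<close>
  weak monotonicity is enough.\<close>

lemma poh_sub_pos:
  assumes pos: "pos_on R a f w" and r: "0 < r" "r \<le> R" "gain r \<le> theta"
  shows "poh f w r > 0"
proof -
  define e where "e = min r sub_radius"
  have e: "0 < e" "e \<le> r" "e \<le> sub_radius" using r sub_radius by (auto simp: e_def)
  have s: "sol a f w" using pos by (simp add: pos_on_def)
  have "poh f w 0 < poh f w e"
  proof (rule DERIV_pos_less[OF e(1) _ poh_DERIV[OF pos]])
    show "continuous_on {0..e} (poh f w)"
      using e r by (intro continuous_on_subset[OF poh_continuous[OF pos]]) auto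
    fix x assume x: "0 < x" "x < e"
    then have "gain x < theta" using gain_lt_theta[of x] theta_gt e by (simp add: field_simps)
    moreover have "w x > 0" using pos_on_flux_pos[OF pos, of x] x e r by simp
    ultimately show "w x powr (m + 1) * (wt x * (theta - gain x)) > 0" using wt_pos[OF x(1)] by simp
  qed (use e r in auto)
  also have "poh f w e \<le> poh f w r"
  proof (rule poh_mono_sub[OF pos])
    show "gain z \<le> theta" if "e < z" "z < r" for z
      using gain_mono[of z r] that e r by simp
  qed (use e r in auto)
  finally show ?thesis using poh_0[OF s] by simp
qed

lemma poh_super_decreasing:
  assumes pos: "pos_on R a f w" and xy: "0 < x" "x < y" "y \<le> R" "gain x > theta"
  shows "poh f w y < poh f w x"
proof (rule DERIV_neg_gt[OF xy(2) _ poh_DERIV[OF pos]])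
  show "continuous_on {x..y} (poh f w)"
    using xy by (intro continuous_on_subset[OF poh_continuous[OF pos]]) auto
  fix z assume z: "x < z" "z < y"
  then have "gain z > theta" using gain_mono[of x z] xy by simp
  moreover have "w z > 0" using pos_on_flux_pos[OF pos, of z] xy z by simp
  ultimately show "w z powr (m + 1) * (wt z * (theta - gain z)) < 0"
    using wt_pos[of z] xy z by (intro mult_pos_neg) auto
qed (use xy in auto)

text \<open>At a zero of f the first summand vanishes, so the Pohozaev function ends at a
  nonnegative value, and on the decreasing branch it must have been larger before.\<close>

lemma poh_pos_of_zero:
  assumes pos: "pos_on R a f w" and R: "f R = 0" and r: "0 < r" "r < R"
  shows "poh f w r > 0"
proof (cases "gain r \<le> theta")
  case True
  then show ?thesis using poh_sub_pos[OF pos, of r] r by simp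
next
  case False
  have "poh f w R \<ge> 0" using R m_gt_1 r vol_nonneg[of R] by (simp add: poh_def)
  then show ?thesis using poh_super_decreasing[OF pos, of r R] r False by simp
qed

lemma poh_pos_of_limit:
  assumes pos: "\<And>R. pos_on R a f w" and lim: "(poh f w \<longlongrightarrow> 0) at_top" and r: "0 < r"
  shows "poh f w r > 0"
proof (cases "gain r \<le> theta")
  case True
  then show ?thesis using poh_sub_pos[OF pos, of r r] r by simp
next
  case False
  \<comment> \<open>The limit at infinity only gives a weak inequality; strictness comes from the
    strict decrease between r and r + 1.\<close>
  have "poh f w (r + 1) \<ge> 0"
  proof (rule tendsto_upperbound[OF lim])
    show "\<forall>\<^sub>F x in at_top. poh f w x \<le> poh f w (r + 1)"
      using eventually_gt_at_top[of "r + 1"]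
    proof eventually_elim
      case (elim x)
      have "gain (r + 1) > theta" using False gain_mono[of r "r + 1"] r by simp
      then show ?case using poh_super_decreasing[OF pos[of x], of "r + 1" x] r elim by simp
    qed
  qed simp
  then show ?thesis using poh_super_decreasing[OF pos[of "r + 1"], of r "r + 1"] r False by simp
qed


section \<open>Comparison of two solutions\<close>

context
  fixes R a1 a2 :: real and f1 w1 f2 w2 :: "real \<Rightarrow> real"
  assumes pos1: "pos_on R a1 f1 w1" and pos2: "pos_on R a2 f2 w2" and a12: "a1 < a2"
    and poh1: "\<And>r. 0 < r \<Longrightarrow> r < R \<Longrightarrow> poh f1 w1 r > 0"
begin

text \<open>Multiplied by \<open>wt\<close> this is the Wronskian y2' y1 - y1' y2 with respect to t;
  its sign is that of the derivative of the quotient q = y2 / y1 introduced next.\<close>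

private definition wr where "wr r = f2 r * w1 r - f1 r * w2 r"

private definition q where "q r = w2 r / w1 r"

text \<open>The power m + 1 is the homogeneity of the derivative of \<open>poh\<close> in the flux.
  So the parts with theta - gain cancel, and the derivative of \<open>Delta\<close> retains only the
  term with q'.\<close>

private definition Delta where "Delta r = poh f2 w2 r - q r powr (m + 1) * poh f1 w1 r"

private lemma sols: "sol a1 f1 w1" "sol a2 f2 w2" "0 < a1" "0 < a2"
  using pos1 pos2 by (auto simp: pos_on_def)

private lemma wpos: "0 < r \<Longrightarrow> r \<le> R \<Longrightarrow> w1 r > 0" "0 < r \<Longrightarrow> r \<le> R \<Longrightarrow> w2 r > 0"
  using pos_on_flux_pos[OF pos1] pos_on_flux_pos[OF pos2] by auto

private lemma qpos: "0 < r \<Longrightarrow> r \<le> R \<Longrightarrow> q r > 0"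
  using wpos by (simp add: q_def)

private lemma wr_continuous: "0 \<le> x \<Longrightarrow> continuous_on {x..y} wr"
  unfolding wr_def[abs_def] using sols by (intro continuous_intros sol_continuous) auto

private lemma wt_wr_DERIV:
  assumes r: "0 < r" "r \<le> R"
  shows "((\<lambda>r. wt r * wr r) has_real_derivative wt r * (w1 r powr m * w2 r - w2 r powr m * w1 r)) (at r)"
proof -
  have "(wr has_real_derivative
      ((- (w2 r powr m)) * w1 r + (f1 r - damp r * w1 r) * f2 r)
      - ((- (w1 r powr m)) * w2 r + (f2 r - damp r * w2 r) * f1 r)) (at r)"
    unfolding wr_def[abs_def]
    by (intro DERIV_diff DERIV_mult pos_on_DERIV[OF pos1] pos_on_DERIV[OF pos2] r)
  from DERIV_mult[OF wt_DERIV[OF r(1)] this] show ?thesis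
    by (rule DERIV_cong) (simp add: wr_def algebra_simps)
qed

private lemma q_DERIV:
  assumes r: "0 < r" "r \<le> R"
  shows "(q has_real_derivative wr r / (w1 r * w1 r)) (at r)"
proof -
  have "(q has_real_derivative
      ((f2 r - damp r * w2 r) * w1 r - w2 r * (f1 r - damp r * w1 r)) / (w1 r * w1 r)) (at r)"
    unfolding q_def[abs_def] using wpos(1)[OF r]
    by (intro DERIV_divide pos_on_DERIV[OF pos1] pos_on_DERIV[OF pos2] r) auto
  then show ?thesis by (rule DERIV_cong) (simp add: wr_def algebra_simps)
qed

private lemma q_continuous: "0 < x \<Longrightarrow> y \<le> R \<Longrightarrow> continuous_on {x..y} q"
  by (intro continuous_at_imp_continuous_on ballI DERIV_isCont[OF q_DERIV]) auto

private lemma q_tendsto: "(q \<longlongrightarrow> a2 / a1) (at_right 0)"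
proof -
  have "((\<lambda>r. (w2 r / r) / (w1 r / r)) \<longlongrightarrow> (a2 / real N) / (a1 / real N)) (at_right 0)"
    using sols real_N by (intro tendsto_divide sol_flux_slope) auto
  moreover have "\<forall>\<^sub>F r in at_right 0. (w2 r / r) / (w1 r / r) = q r"
    by (auto simp: eventually_at_right_field q_def intro!: exI[of _ 1])
  moreover have "(a2 / real N) / (a1 / real N) = a2 / a1" using real_N by simp
  ultimately show ?thesis by (auto intro: Lim_transform_eventually)
qed

text \<open>Superlinearity: for w2 > w1 one has w1^m w2 < w2^m w1, since m > 1. So wt * wr decreases
  from its value 0 at the origin.\<close>

private lemma wr_neg_if_q:
  assumes x: "0 < x" "x \<le> R" and q: "\<And>r. 0 < r \<Longrightarrow> r < x \<Longrightarrow> q r > 1"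
  shows "wr x < 0"
proof -
  have "wt x * wr x < wt 0 * wr 0"
  proof (rule DERIV_neg_gt[OF x(1) _ wt_wr_DERIV])
    show "continuous_on {0..x} (\<lambda>r. wt r * wr r)"
      by (intro continuous_intros wt_continuous wr_continuous) auto
    fix r assume r: "0 < r" "r < x"
    then have w: "0 < w1 r" "w1 r < w2 r" using wpos[of r] q[OF r] x by (auto simp: q_def)
    have "w1 r powr (m - 1) < w2 r powr (m - 1)" using w m_gt_1 by (intro powr_less_mono2) auto
    then have "w1 r * w2 r * (w1 r powr (m - 1) - w2 r powr (m - 1)) < 0"
      using w by (intro mult_pos_neg) auto
    moreover have "w1 r powr m = w1 r * w1 r powr (m - 1)" "w2 r powr m = w2 r * w2 r powr (m - 1)"
      using w by (simp_all add: powr_mult_base)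
    ultimately have "w1 r powr m * w2 r - w2 r powr m * w1 r < 0" by (simp add: algebra_simps)
    then show "wt r * (w1 r powr m * w2 r - w2 r powr m * w1 r) < 0"
      using wt_pos[OF r(1)] by (rule mult_pos_neg[rotated])
  qed (use x in auto)
  moreover have "wr 0 = 0" using sols by (simp add: wr_def solD(4))
  ultimately show ?thesis using wt_pos[OF x(1)] by (simp add: mult_less_0_iff)
qed

private lemma Delta_DERIV:
  assumes r: "0 < r" "r \<le> R"
  shows "(Delta has_real_derivative - ((m + 1) * q r powr m * (wr r / (w1 r * w1 r)) * poh f1 w1 r)) (at r)"
proof -
  have qp: "q r > 0" using qpos[OF r] .
  have dq: "((\<lambda>r. q r powr (m + 1)) has_real_derivative (m + 1) * q r powr m * (wr r / (w1 r * w1 r))) (at r)"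
    using DERIV_chain2[OF has_real_derivative_powr[OF qp] q_DERIV[OF r], of "m + 1"] by simp
  have "w2 r = q r * w1 r" using wpos[OF r] by (simp add: q_def)
  then have w2: "w2 r powr (m + 1) = q r powr (m + 1) * w1 r powr (m + 1)"
    using qp wpos[OF r] by (simp add: powr_mult)
  have "(Delta has_real_derivative w2 r powr (m + 1) * (wt r * (theta - gain r)) -
      ((m + 1) * q r powr m * (wr r / (w1 r * w1 r)) * poh f1 w1 r
        + w1 r powr (m + 1) * (wt r * (theta - gain r)) * q r powr (m + 1))) (at r)"
    unfolding Delta_def[abs_def]
    by (intro DERIV_diff DERIV_mult dq poh_DERIV[OF pos1] poh_DERIV[OF pos2] r)
  then show ?thesis unfolding w2 by (rule DERIV_cong) (simp add: algebra_simps)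
qed

private lemma Delta_increasing:
  assumes "0 < x" "x < y" "y < R" and wr: "\<And>r. x < r \<Longrightarrow> r < y \<Longrightarrow> wr r < 0"
  shows "Delta x < Delta y"
proof (rule DERIV_pos_less[OF assms(2) _ Delta_DERIV])
  show "continuous_on {x..y} Delta"
    using assms by (intro continuous_at_imp_continuous_on ballI DERIV_isCont[OF Delta_DERIV]) auto
  fix r assume r: "x < r" "r < y"
  then have r': "0 < r" "r \<le> R" "r < R" using assms by auto
  have "wr r / (w1 r * w1 r) < 0"
    using wr[OF r] wpos[OF r'(1,2)] by (intro divide_neg_pos) auto
  then have "(m + 1) * q r powr m * (wr r / (w1 r * w1 r)) * poh f1 w1 r < 0"
    using m_gt_1 qpos[OF r'(1,2)] poh1[OF r'(1,3)] by (intro mult_neg_pos mult_pos_neg) auto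
  then show "- ((m + 1) * q r powr m * (wr r / (w1 r * w1 r)) * poh f1 w1 r) > 0" by simp
qed (use assms in auto)

private lemma Delta_tendsto: "R > 0 \<Longrightarrow> (Delta \<longlongrightarrow> 0) (at_right 0)"
proof -
  assume R: "R > 0"
  have lim: "(poh f w \<longlongrightarrow> 0) (at_right 0)" if "pos_on R a f w" for a f w
  proof -
    have "(poh f w \<longlongrightarrow> poh f w 0) (at 0 within {0..R})"
      using poh_continuous[OF that] R by (simp add: continuous_on_def)
    then show ?thesis using that R poh_0[of a f w] by (simp add: at_within_Icc_at_right pos_on_def)
  qed
  have "(Delta \<longlongrightarrow> 0 - (a2 / a1) powr (m + 1) * 0) (at_right 0)"
    unfolding Delta_def[abs_def] using sols
    by (intro tendsto_intros lim[OF pos1] lim[OF pos2] q_tendsto) auto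
  then show ?thesis by simp
qed

private lemma Delta_pos:
  assumes "0 < s" "s < R" and wr: "\<And>r. 0 < r \<Longrightarrow> r < s \<Longrightarrow> wr r < 0"
  shows "Delta s > 0"
proof -
  have "0 \<le> Delta (s / 2)"
  proof (rule tendsto_upperbound[OF Delta_tendsto])
    show "\<forall>\<^sub>F x in at_right 0. Delta x \<le> Delta (s / 2)"
      using assms Delta_increasing
      by (auto simp: eventually_at_right_field intro!: exI[of _ "s / 2"] less_imp_le)
  qed (use assms in auto)
  also have "\<dots> < Delta s" using assms by (intro Delta_increasing) auto
  finally show ?thesis .
qed

private lemma q_decreasing:
  assumes "0 < x" "x < y" "y \<le> R" and wr: "\<And>r. x < r \<Longrightarrow> r < y \<Longrightarrow> wr r < 0"
  shows "q y < q x"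
proof (rule DERIV_neg_gt[OF assms(2) _ q_DERIV])
  fix r assume r: "x < r" "r < y"
  show "wr r / (w1 r * w1 r) < 0"
    using wr[OF r] wpos[of r] r assms by (intro divide_neg_pos) auto
qed (use assms q_continuous in auto)

text \<open>At a first zero \<open>s\<close> of \<open>wr\<close> the two solutions are proportional with a factor \<open>q s < 1\<close>, which makes
  \<open>Delta s\<close> negative, whereas \<open>Delta\<close> increases from \<open>0\<close> up to \<open>s\<close>.\<close>

lemma compare_wronskian:
  assumes r: "0 < r" "r < R"
  shows "f2 r * w1 r < f1 r * w2 r"
proof (rule ccontr)
  assume "\<not> ?thesis"
  then have wr_r: "wr r \<ge> 0" by (simp add: wr_def)
  have "a2 / a1 > 1" using a12 sols by simp
  from order_tendstoD(1)[OF q_tendsto this] obtain e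
    where e: "e > 0" "\<And>x. 0 < x \<Longrightarrow> x < e \<Longrightarrow> q x > 1" by (auto simp: eventually_at_right_field)
  have near: "wr x < 0" if "0 < x" "x < e" "x \<le> R" for x
    using that e by (intro wr_neg_if_q) auto
  define x0 where "x0 = min (e / 2) r"
  have x0: "0 < x0" "x0 \<le> r" "x0 < e" using e r by (auto simp: x0_def)
  obtain s where s: "x0 < s" "s \<le> r" "wr s = 0" "\<And>x. x0 \<le> x \<Longrightarrow> x < s \<Longrightarrow> wr x < 0"
    using first_zero[of x0 r wr] wr_continuous[of x0 r] x0 near[of x0] wr_r r by auto
  have neg: "wr x < 0" if "0 < x" "x < s" for x
    using that s near[of x] x0 r by (cases "x < x0") auto
  have sR: "0 < s" "s < R" "s \<le> R" using s x0 r by auto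
  define k where "k = q s"
  have k0: "k > 0" using qpos[OF sR(1,3)] by (simp add: k_def)
  \<comment> \<open>As q decreases up to s, k \<ge> 1 would mean q > 1 on all of (0, s), and
    superlinearity would make the Wronskian negative at s.\<close>
  have k1: "k < 1"
  proof (rule ccontr)
    assume "\<not> k < 1"
    have "wr s < 0"
    proof (rule wr_neg_if_q[OF sR(1,3)])
      fix x assume x: "0 < x" "x < s"
      have "q s < q x" using x sR neg by (intro q_decreasing) auto
      then show "q x > 1" using \<open>\<not> k < 1\<close> by (simp add: k_def)
    qed
    then show False using s(3) by simp
  qed
  have w2: "w2 s = k * w1 s" using wpos[OF sR(1,3)] by (simp add: k_def q_def)
  then have f2: "f2 s = k * f1 s" using s(3) wpos[OF sR(1,3)] by (simp add: wr_def)
  have w2m: "w2 s powr (m + 1) = k powr (m + 1) * w1 s powr (m + 1)"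
    unfolding w2 using k0 wpos[OF sR(1,3)] by (simp add: powr_mult)
  have "f2 s * (vol s * f2 s - wt s * w2 s) = k\<^sup>2 * (f1 s * (vol s * f1 s - wt s * w1 s))"
    unfolding f2 w2 by (simp add: algebra_simps power2_eq_square)
  then have "poh f2 w2 s = k\<^sup>2 * (f1 s * (vol s * f1 s - wt s * w1 s) / 2)
      + k powr (m + 1) * (vol s * w1 s powr (m + 1) / (m + 1))"
    unfolding poh_def w2m by simp
  \<comment> \<open>The summands homogeneous of degree m + 1 cancel. The quadratic summand is left;
    it is negative by concavity, while k < 1 and m + 1 > 2 give k^(m+1) \<le> k^2.\<close>
  then have "Delta s = (k\<^sup>2 - k powr (m + 1)) * (f1 s * (vol s * f1 s - wt s * w1 s) / 2)"
    unfolding Delta_def poh_def k_def[symmetric] by (simp only: ring_distribs)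
  also have "\<dots> \<le> 0"
  proof (rule mult_nonneg_nonpos)
    have "k powr (m + 1) \<le> k powr 2" using k0 k1 m_gt_1 by (intro powr_mono') auto
    then show "k\<^sup>2 - k powr (m + 1) \<ge> 0" using k0 by (simp add: powr_numeral)
    have "f1 s > 0" using pos1 sR by (simp add: pos_on_def)
    then show "f1 s * (vol s * f1 s - wt s * w1 s) / 2 \<le> 0"
      using vol_f_less_mass[OF pos1 sR(1,3)] by (simp add: mult_nonneg_nonpos)
  qed
  finally show False using Delta_pos[OF sR(1,2) neg] by simp
qed

lemma compare_ratio_decreasing:
  assumes "0 < x" "x < y" "y \<le> R"
  shows "w2 y / w1 y < w2 x / w1 x"
  using q_decreasing[OF assms] compare_wronskian assms by (simp add: q_def wr_def)

lemma compare_poh_pos: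
  assumes "0 < x" "x < R"
  shows "poh f2 w2 x - (w2 x / w1 x) powr (m + 1) * poh f1 w1 x > 0"
  using Delta_pos[of x] compare_wronskian assms by (simp add: Delta_def q_def wr_def)

lemma compare_poh_increasing:
  assumes "0 < x" "x < y" "y < R"
  shows "poh f2 w2 x - (w2 x / w1 x) powr (m + 1) * poh f1 w1 x
    < poh f2 w2 y - (w2 y / w1 y) powr (m + 1) * poh f1 w1 y"
  using Delta_increasing[of x y] compare_wronskian assms by (simp add: Delta_def q_def wr_def)

end

text \<open>At the zero R of f1 the Wronskian reduces to f2 * w1, which would be positive although
  the Wronskian is negative before R. The interval up to R + 1 is there to include f2(R) >
  0.\<close>

lemma cross_mono:
  assumes pos1: "pos_on R a1 f1 w1" and R: "R > 0" "f1 R = 0" and a12: "a1 < a2"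
  shows "\<not> pos_on (R + 1) a2 f2 w2"
proof
  assume pos2: "pos_on (R + 1) a2 f2 w2"
  then have pos2': "pos_on R a2 f2 w2" by (rule pos_on_mono) simp
  have s: "sol a1 f1 w1" "sol a2 f2 w2" using pos1 pos2 by (auto simp: pos_on_def)
  define h where "h r = f2 r * w1 r - f1 r * w2 r" for r
  have "isCont h R"
    unfolding h_def[abs_def] using DERIV_isCont[OF solD(5)[OF s(1) R(1)]] DERIV_isCont[OF solD(6)[OF s(1) R(1)]]
      DERIV_isCont[OF solD(5)[OF s(2) R(1)]] DERIV_isCont[OF solD(6)[OF s(2) R(1)]]
    by (intro continuous_intros)
  then have "(h \<longlongrightarrow> h R) (at_left R)" by (simp add: isCont_def filterlim_at_split)
  then have "h R \<le> 0"
  proof (rule tendsto_upperbound)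
    have "h r < 0" if "0 < r" "r < R" for r
      using compare_wronskian[OF pos1 pos2' a12 poh_pos_of_zero[OF pos1 R(2)] that] by (simp add: h_def)
    then show "\<forall>\<^sub>F r in at_left R. h r \<le> 0"
      using R(1) by (auto simp: eventually_at_left_field intro!: exI[of _ 0] less_imp_le)
  qed simp
  moreover have "f2 R > 0" using pos2 R by (simp add: pos_on_def)
  moreover have "w1 R > 0" using pos_on_flux_pos[OF pos1] R by simp
  ultimately show False using R by (simp add: h_def mult_le_0_iff)
qed

section \<open>Solutions that stay positive\<close>

definition global_pos :: "real \<Rightarrow> (real \<Rightarrow> real) \<Rightarrow> (real \<Rightarrow> real) \<Rightarrow> bool" where
  "global_pos a f w \<longleftrightarrow> (\<forall>R. pos_on R a f w)"

lemma global_posD: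
  assumes "global_pos a f w"
  shows "pos_on R a f w" "sol a f w" "a > 0" "0 \<le> r \<Longrightarrow> f r > 0" "0 < r \<Longrightarrow> w r > 0"
    "0 < r \<Longrightarrow> (f has_real_derivative - (w r powr m)) (at r)"
    "0 < r \<Longrightarrow> (w has_real_derivative f r - damp r * w r) (at r)"
    "0 < r \<Longrightarrow> ((\<lambda>r. wt r * w r) has_real_derivative wt r * f r) (at r)"
    "0 < r \<Longrightarrow> vol r * f r < wt r * w r"
    "0 \<le> x \<Longrightarrow> x < y \<Longrightarrow> f y < f x"
proof -
  have p: "pos_on R a f w" for R using assms by (simp add: global_pos_def)
  show "pos_on R a f w" using p .
  show "sol a f w" "a > 0" using p by (auto simp: pos_on_def)
  show "0 \<le> r \<Longrightarrow> f r > 0" using p[of "r + 1"] by (auto simp: pos_on_def)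
  show "0 < r \<Longrightarrow> w r > 0" using pos_on_flux_pos[OF p[of r]] by simp
  show "0 < r \<Longrightarrow> (f has_real_derivative - (w r powr m)) (at r)"
    "0 < r \<Longrightarrow> (w has_real_derivative f r - damp r * w r) (at r)"
    using pos_on_DERIV[OF p[of r]] by auto
  show "0 < r \<Longrightarrow> ((\<lambda>r. wt r * w r) has_real_derivative wt r * f r) (at r)"
    using mass_DERIV[OF p[of r]] by auto
  show "0 < r \<Longrightarrow> vol r * f r < wt r * w r" using vol_f_less_mass[OF p[of r]] by auto
  show "0 \<le> x \<Longrightarrow> x < y \<Longrightarrow> f y < f x" using pos_on_decreasing[OF p[of y]] by auto
qed

text \<open>The power 1 - m turns f' = - w^m into an equation that sees only the quotient w/f:
  bounds on w/f become linear growth of f^(1-m).\<close>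

lemma f_powr_DERIV:
  assumes g: "global_pos a f w" and x: "x > 0"
  shows "((\<lambda>r. f r powr (1 - m)) has_real_derivative (m - 1) * (w x / f x) powr m) (at x)"
proof -
  have fx: "f x > 0" "w x > 0" using global_posD(4,5)[OF g] x by auto
  have "((\<lambda>r. f r powr (1 - m)) has_real_derivative ((1 - m) * f x powr (1 - m - 1)) * - (w x powr m)) (at x)"
    using DERIV_chain2[OF has_real_derivative_powr[OF fx(1)] global_posD(6)[OF g x]] .
  moreover have "f x powr (1 - m - 1) = 1 / f x powr m" using fx by (simp add: powr_minus_divide)
  ultimately show ?thesis using fx by (simp add: powr_divide algebra_simps diff_divide_distrib)
qed

text \<open>Since w/f > vol/wt and vol/wt tends to 1, the power f^(1-m) grows at least
  linearly.\<close>

lemma global_pos_tendsto_0: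
  assumes g: "global_pos a f w"
  shows "(f \<longlongrightarrow> 0) at_top"
proof -
  have "\<forall>\<^sub>F r in at_top. vol r / wt r > 1 / 2"
    using order_tendstoD(1)[OF vol_wt_tendsto, of "1 / 2"] by simp
  then obtain r0 where r0: "\<And>r. r \<ge> r0 \<Longrightarrow> vol r / wt r > 1 / 2" by (auto simp: eventually_at_top_linorder)
  define r1 where "r1 = max r0 1"
  define c where "c = (m - 1) * (1 / 2) powr m"
  have c: "c > 0" using m_gt_1 by (simp add: c_def)
  note D = f_powr_DERIV[OF g]
  have lower: "f r powr (1 - m) \<ge> c * (- r1 + r)" if r: "r \<ge> r1" for r
  proof -
    have "f r1 powr (1 - m) - c * (- r1 + r1) \<le> f r powr (1 - m) - c * (- r1 + r)"
    proof (rule DERIV_nonneg_le[OF r])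
      have pos: "x > 0" if "x \<in> {r1..r}" for x using that by (auto simp: r1_def)
      then show "continuous_on {r1..r} (\<lambda>r. f r powr (1 - m) - c * (- r1 + r))"
        by (intro continuous_intros continuous_at_imp_continuous_on ballI DERIV_isCont[OF D]) auto
      fix x assume x: "r1 < x" "x < r"
      then have x0: "x > 0" "x \<ge> r0" by (auto simp: r1_def)
      show "((\<lambda>r. f r powr (1 - m) - c * (- r1 + r)) has_real_derivative (m - 1) * (w x / f x) powr m - c) (at x)"
        by (rule DERIV_cong[OF DERIV_diff[OF D[OF x0(1)] DERIV_cmult[OF DERIV_add[OF DERIV_const DERIV_ident]]]]) simp
      have fx: "f x > 0" "w x > 0" using global_posD(4,5)[OF g] x0 by auto
      have "1 / 2 < vol x / wt x" by (rule r0[OF x0(2)])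
      also have "vol x / wt x < w x / f x"
        using global_posD(9)[OF g x0(1)] wt_pos[OF x0(1)] fx by (simp add: field_simps)
      finally have "c \<le> (m - 1) * (w x / f x) powr m"
        unfolding c_def using m_gt_1 by (intro mult_left_mono powr_mono2) auto
      then show "(m - 1) * (w x / f x) powr m - c \<ge> 0" by simp
    qed
    moreover have "f r1 powr (1 - m) \<ge> 0" "c * (- r1 + r1) = 0" by simp_all
    ultimately show ?thesis by linarith
  qed
  have "filterlim (\<lambda>r. - r1 + r) at_top at_top"
    by (rule filterlim_tendsto_add_at_top[OF tendsto_const filterlim_ident])
  then have "filterlim (\<lambda>r. c * (- r1 + r)) at_top at_top"
    by (rule filterlim_tendsto_pos_mult_at_top[OF tendsto_const c])
  then have "filterlim (\<lambda>r. f r powr (1 - m)) at_top at_top"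
    by (rule filterlim_at_top_mono) (use lower in \<open>auto simp: eventually_at_top_linorder intro!: exI[of _ r1]\<close>)
  from tendsto_neg_powr[OF _ this, of "1 / (1 - m)"]
  have "((\<lambda>r. (f r powr (1 - m)) powr (1 / (1 - m))) \<longlongrightarrow> 0) at_top" using m_gt_1 by simp
  then show ?thesis
  proof (rule Lim_transform_eventually)
    show "\<forall>\<^sub>F r in at_top. (f r powr (1 - m)) powr (1 / (1 - m)) = f r"
      using eventually_ge_at_top[of 0]
    proof eventually_elim
      case (elim r)
      then have "f r > 0" using global_posD(4)[OF g] by simp
      then show ?case using m_gt_1 by (simp add: powr_powr)
    qed
  qed
qed

text \<open>A bounded mass forces w \<le> C/wt, so the two summands of \<open>poh\<close> are
  dominated by C f and C w^m, both of which tend to 0.\<close>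

lemma poh_tendsto_0:
  assumes g: "global_pos a f w" and C: "\<And>r. r \<ge> 1 \<Longrightarrow> wt r * w r \<le> C"
  shows "(poh f w \<longlongrightarrow> 0) at_top" "(w \<longlongrightarrow> 0) at_top"
proof -
  have "((\<lambda>r. C / wt r) \<longlongrightarrow> 0) at_top"
    by (rule real_tendsto_divide_at_top[OF tendsto_const wt_at_top])
  moreover have "\<forall>\<^sub>F r in at_top. norm (w r) \<le> C / wt r"
    using eventually_ge_at_top[of 1]
  proof eventually_elim
    case (elim r)
    then show ?case using C[of r] wt_pos[of r] global_posD(5)[OF g, of r] by (simp add: field_simps)
  qed
  ultimately show w0: "(w \<longlongrightarrow> 0) at_top" by (rule Lim_null_comparison[rotated])
  have wm: "((\<lambda>r. w r powr m) \<longlongrightarrow> 0) at_top"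
  proof (rule tendsto_zero_powrI[OF w0 tendsto_const])
    show "\<forall>\<^sub>F r in at_top. w r \<ge> 0"
      using eventually_gt_at_top[of 0] by eventually_elim (use global_posD(5)[OF g] in \<open>auto intro: less_imp_le\<close>)
  qed (use m_gt_1 in auto)
  have "((\<lambda>r. C * f r + C * w r powr m) \<longlongrightarrow> C * 0 + C * 0) at_top"
    by (intro tendsto_intros global_pos_tendsto_0[OF g] wm)
  then have "((\<lambda>r. C * f r + C * w r powr m) \<longlongrightarrow> 0) at_top" by simp
  moreover have "\<forall>\<^sub>F r in at_top. norm (poh f w r) \<le> C * f r + C * w r powr m"
    using eventually_ge_at_top[of 1]
  proof eventually_elim
    case (elim r)
    then have r: "r > 0" by simp
    have fw: "f r > 0" "w r > 0" using global_posD(4,5)[OF g] r by auto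
    have "\<bar>f r * (vol r * f r - wt r * w r) / 2\<bar> = f r * (wt r * w r - vol r * f r) / 2"
      using fw global_posD(9)[OF g r] by (simp add: abs_mult)
    also have "\<dots> \<le> f r * (wt r * w r) / 2"
      using fw vol_nonneg[of r] r by (intro divide_right_mono mult_left_mono) auto
    also have "\<dots> \<le> f r * (wt r * w r) / 1"
      using fw wt_nonneg[of r] r by (intro divide_left_mono) auto
    also have "\<dots> \<le> C * f r" using C[OF elim] fw by (simp add: mult.commute)
    finally have 1: "\<bar>f r * (vol r * f r - wt r * w r) / 2\<bar> \<le> C * f r" .
    have "vol r * w r powr (m + 1) / (m + 1) \<le> vol r * w r powr (m + 1) / 1"
      using m_gt_1 vol_nonneg[of r] r by (intro divide_left_mono) auto
    also have "\<dots> = (vol r * w r) * w r powr m" using fw by (simp add: powr_add mult.commute)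
    also have "\<dots> \<le> (wt r * w r) * w r powr m"
      using vol_le_wt[of r] r fw by (intro mult_right_mono) auto
    also have "\<dots> \<le> C * w r powr m" using C[OF elim] by (intro mult_right_mono) auto
    finally have 2: "vol r * w r powr (m + 1) / (m + 1) \<le> C * w r powr m" .
    have "vol r * w r powr (m + 1) / (m + 1) \<ge> 0" using m_gt_1 vol_nonneg[of r] r by simp
    then show ?case using 1 2 unfolding poh_def real_norm_def by linarith
  qed
  ultimately show "(poh f w \<longlongrightarrow> 0) at_top" by (rule Lim_null_comparison[rotated])
qed

text \<open>Two globally positive solutions, the smaller one of bounded mass: both Pohozaev functions vanish at
  infinity and the ratio of the fluxes stays bounded, so the increasing positive function of
  \<open>compare_poh_increasing\<close> would tend to \<open>0\<close>.\<close>

lemma bounded_mass_not_global: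
  assumes g1: "global_pos a1 f1 w1" and C: "\<And>r. r \<ge> 1 \<Longrightarrow> wt r * w1 r \<le> C" and a12: "a1 < a2"
  shows "\<not> global_pos a2 f2 w2"
proof
  assume g2: "global_pos a2 f2 w2"
  have poh1: "poh f1 w1 r > 0" if "0 < r" for r
    using poh_pos_of_limit[OF global_posD(1)[OF g1] poh_tendsto_0(1)[OF g1 C] that] by simp
  define q where "q r = w2 r / w1 r" for r
  define Delta where "Delta r = poh f2 w2 r - q r powr (m + 1) * poh f1 w1 r" for r
  note cmp = global_posD(1)[OF g1] global_posD(1)[OF g2] a12 poh1
  have inc: "Delta x < Delta y" if "0 < x" "x < y" for x y
    using compare_poh_increasing[OF cmp, of "y + 1" x y] that by (simp add: Delta_def q_def)
  have pos: "Delta x > 0" if "0 < x" for x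
    using compare_poh_pos[OF cmp, of "x + 1" x] that by (simp add: Delta_def q_def)
  have w: "w1 r > 0" "w2 r > 0" if "r > 0" for r
    using global_posD(5)[OF g1] global_posD(5)[OF g2] that by auto
  have q1: "q r \<le> q 1" if "r \<ge> 1" for r
    using compare_ratio_decreasing[OF cmp, of r 1 r] that by (cases "r = 1") (auto simp: q_def)
  have q0: "q r > 0" if "r > 0" for r using w that by (simp add: q_def)
  have C2: "wt r * w2 r \<le> q 1 * C" if r: "r \<ge> 1" for r
  proof -
    have "wt r * w2 r = q r * (wt r * w1 r)" using w(1)[of r] r by (simp add: q_def)
    also have "\<dots> \<le> q 1 * C"
      using q1[OF r] C[OF r] q0[of 1] w(1)[of r] wt_nonneg[of r] r by (intro mult_mono) auto
    finally show ?thesis .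
  qed
  have "((\<lambda>r. poh f2 w2 r - 0) \<longlongrightarrow> 0 - 0) at_top"
    by (intro tendsto_intros poh_tendsto_0(1)[OF g2 C2])
  moreover have "\<forall>\<^sub>F r in at_top. Delta r \<le> poh f2 w2 r - 0"
    using eventually_gt_at_top[of 0]
    by eventually_elim (use poh1 in \<open>auto simp: Delta_def less_imp_le\<close>)
  moreover have "\<forall>\<^sub>F r in at_top. Delta 1 \<le> Delta r"
    using eventually_gt_at_top[of 1] by eventually_elim (use inc in \<open>auto intro: less_imp_le\<close>)
  then have "\<forall>\<^sub>F r in at_top. Delta 1 \<le> poh f2 w2 r - 0"
    using calculation(2) by eventually_elim simp
  ultimately have "Delta 1 \<le> 0 - 0" by (intro tendsto_lowerbound[of "\<lambda>r. poh f2 w2 r - 0" _ at_top]) auto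
  then show False using pos[of 1] by simp
qed

end

section \<open>Slow and fast decay\<close>

text \<open>The case 0/0 at infinity. For large x, f - (L + e/2) G is nondecreasing with limit 0,
  hence nonpositive; the bound from below is symmetric.\<close>

lemma lhopital_at_top_0:
  fixes f G :: "real \<Rightarrow> real"
  assumes f0: "(f \<longlongrightarrow> 0) at_top" and G0: "(G \<longlongrightarrow> 0) at_top"
    and df: "\<And>x. x > b \<Longrightarrow> (f has_real_derivative f' x) (at x)"
    and dG: "\<And>x. x > b \<Longrightarrow> (G has_real_derivative G' x) (at x)"
    and G: "\<And>x. x > b \<Longrightarrow> G x > 0" and G': "\<And>x. x > b \<Longrightarrow> G' x < 0"
    and lim: "((\<lambda>x. f' x / G' x) \<longlongrightarrow> L) at_top"
  shows "((\<lambda>x. f x / G x) \<longlongrightarrow> L) at_top"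
proof (rule tendstoI)
  fix e :: real assume e: "e > 0"
  have "\<forall>\<^sub>F x in at_top. dist (f' x / G' x) L < e / 2" using lim e by (intro tendstoD) auto
  then obtain x0 where x0: "\<And>x. x \<ge> x0 \<Longrightarrow> \<bar>f' x / G' x - L\<bar> < e / 2"
    by (auto simp: eventually_at_top_linorder dist_real_def)
  have tail: "k x \<le> 0" if k: "(k \<longlongrightarrow> 0) at_top" and dk: "\<And>y. y > b \<Longrightarrow> (k has_real_derivative k' y) (at y)"
    and k': "\<And>y. y \<ge> x \<Longrightarrow> k' y \<ge> 0" and x: "x > b" for k k' :: "real \<Rightarrow> real" and x
  proof (rule tendsto_lowerbound[OF k])
    have "k x \<le> k y" if "y \<ge> x" for y
      by (rule DERIV_nonneg_le[OF that _ dk k'])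
        (use x in \<open>auto intro!: continuous_at_imp_continuous_on DERIV_isCont[OF dk]\<close>)
    then show "\<forall>\<^sub>F y in at_top. k x \<le> k y" by (auto simp: eventually_at_top_linorder)
  qed simp
  have "\<bar>f x / G x - L\<bar> < e" if x: "x \<ge> x0" "x > b" for x
  proof -
    have b': "f' y \<ge> (L + e / 2) * G' y" "f' y \<le> (L - e / 2) * G' y" if "y \<ge> x" for y
    proof -
      have "\<bar>f' y / G' y - L\<bar> < e / 2" using x0[of y] x that by simp
      then have q: "f' y / G' y \<le> L + e / 2" "L - e / 2 \<le> f' y / G' y" by linarith+
      have "G' y < 0" using G'[of y] x that by simp
      then show "f' y \<ge> (L + e / 2) * G' y" "f' y \<le> (L - e / 2) * G' y"
        using mult_right_mono_neg[OF q(1), of "G' y"] mult_right_mono_neg[OF q(2), of "G' y"] by auto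
    qed
    have "f x - (L + e / 2) * G x \<le> 0"
    proof (rule tail[where k = "\<lambda>x. f x - (L + e / 2) * G x"])
      show "((\<lambda>x. f x - (L + e / 2) * G x) \<longlongrightarrow> 0) at_top"
        using tendsto_diff[OF f0 tendsto_mult_left[OF G0, of "L + e / 2"]] by simp
      show "((\<lambda>x. f x - (L + e / 2) * G x) has_real_derivative f' y - (L + e / 2) * G' y) (at y)"
        if "y > b" for y by (intro DERIV_diff DERIV_cmult df dG that)
    qed (use b' x in auto)
    moreover have "(L - e / 2) * G x - f x \<le> 0"
    proof (rule tail[where k = "\<lambda>x. (L - e / 2) * G x - f x"])
      show "((\<lambda>x. (L - e / 2) * G x - f x) \<longlongrightarrow> 0) at_top"
        using tendsto_diff[OF tendsto_mult_left[OF G0, of "L - e / 2"] f0] by simp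
      show "((\<lambda>x. (L - e / 2) * G x - f x) has_real_derivative (L - e / 2) * G' y - f' y) (at y)"
        if "y > b" for y by (intro DERIV_diff DERIV_cmult df dG that)
    qed (use b' x in auto)
    ultimately have "f x / G x \<le> L + e / 2" "L - e / 2 \<le> f x / G x"
      using G[OF x(2)] by (auto simp: field_simps)
    then show ?thesis using e by (simp add: abs_less_iff)
  qed
  then have "\<forall>x \<ge> max x0 (b + 1). dist (f x / G x) L < e" by (auto simp: dist_real_def)
  then show "\<forall>\<^sub>F x in at_top. dist (f x / G x) L < e" unfolding eventually_at_top_linorder by blast
qed

context radial_system
begin

text \<open>Chosen so that w < 2 delta gives w^m \<le> w/8. Then w < 2f yields w^m \<le> f/4, which
  makes the slow region invariant and keeps f above a multiple of exp (-r/4).\<close>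

definition delta :: real where "delta = (1 / 8) powr (1 / (m - 1)) / 2"

lemma delta_pos: "delta > 0" by (simp add: delta_def)

lemma powr_le_if_delta:
  assumes "0 \<le> x" "x \<le> 2 * delta"
  shows "x powr (m - 1) \<le> 1 / 8"
proof -
  have "x powr (m - 1) \<le> (2 * delta) powr (m - 1)" using assms m_gt_1 by (intro powr_mono2) auto
  also have "\<dots> = 1 / 8" using m_gt_1 by (simp add: delta_def powr_powr)
  finally show ?thesis .
qed

lemma powr_m_split: "(x::real) > 0 \<Longrightarrow> x powr m = x * x powr (m - 1)"
  by (simp add: powr_mult_base)

text \<open>On the edge w = 2f one has (w - 2f)' \<le> f - w + 2 w^m < 0, so the edge is not reached
  from inside. Nor does f reach 0 first: there w > 0 = 2f, so the edge would have been crossed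
  before.\<close>

lemma slow_region_invariant:
  assumes s: "sol a f w" and a: "a > 0" and R: "R \<ge> 0" and fpos: "\<And>r. 0 \<le> r \<Longrightarrow> r \<le> R \<Longrightarrow> f r > 0"
    and fR: "f R < delta" and wR: "w R < 2 * f R"
  shows "global_pos a f w" "r \<ge> R \<Longrightarrow> w r < 2 * f r"
proof -
  define h where "h r = w r - 2 * f r" for r
  have hc: "continuous_on {R..b} h" for b
    unfolding h_def[abs_def] by (intro continuous_intros sol_continuous[OF s] R)
  have pos: "f r > 0" if t: "\<And>x. R \<le> x \<Longrightarrow> x < t \<Longrightarrow> h x < 0" and r: "0 \<le> r" "r \<le> t" for r t
  proof (rule ccontr)
    assume nf: "\<not> f r > 0"
    then have "R < r" using fpos[of r] r by force
    obtain z where z: "R < z" "z \<le> r" "- f z = 0" "\<And>x. R \<le> x \<Longrightarrow> x < z \<Longrightarrow> - f x < 0"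
      using first_zero[of R r "\<lambda>x. - f x"] nf \<open>R < r\<close> fpos[of R] R
        continuous_on_minus[OF sol_continuous(1)[OF s R]] by auto
    have "f x > 0" if "0 \<le> x" "x < z" for x
      using fpos[of x] z(4)[of x] that by (cases "x \<le> R") auto
    then have "pos_on z a f w" using s a by (simp add: pos_on_def)
    then have "w z > 0" using pos_on_flux_pos[of z a f w z] z R by simp
    then have "h z > 0" using z by (simp add: h_def)
    moreover have "h R < 0" using wR by (simp add: h_def)
    ultimately obtain y where y: "R < y" "y \<le> z" "h y = 0"
      using first_zero[OF hc[of z]] z by (metis less_imp_le)
    then show False using t[of y] z r \<open>h z > 0\<close> by (cases "y = z") auto
  qed
  have h: "h b < 0" if b: "b \<ge> R" for b
  proof (rule barrier[OF hc b])
    show "h R < 0" using wR by (simp add: h_def)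
    fix z assume z: "R < z" "z \<le> b" "h z = 0" "\<And>x. R \<le> x \<Longrightarrow> x < z \<Longrightarrow> h x < 0"
    have fz: "f x > 0" if "0 \<le> x" "x \<le> z" for x using pos[OF z(4)] that by blast
    then have p: "pos_on z a f w" using s a by (simp add: pos_on_def)
    have z0: "0 < z" using z R by simp
    have wz: "w z = 2 * f z" "w z > 0" using z(3) fz[of z] z0 by (auto simp: h_def)
    have "f z < delta" using pos_on_decreasing[OF p R z(1)] fR by simp
    then have "w z powr (m - 1) \<le> 1 / 8" using wz by (intro powr_le_if_delta) auto
    then have "w z powr m \<le> w z * (1 / 8)"
      using wz unfolding powr_m_split[OF wz(2)] by (intro mult_left_mono) auto
    moreover have "w z \<le> damp z * w z" using damp_ge[OF z0] wz by simp
    ultimately have "(f z - damp z * w z) - 2 * - (w z powr m) < 0" using wz by linarith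
    moreover have "(h has_real_derivative (f z - damp z * w z) - 2 * - (w z powr m)) (at z)"
      unfolding h_def[abs_def] by (intro DERIV_diff DERIV_cmult pos_on_DERIV[OF p z0]) auto
    ultimately show "\<exists>d<0. (h has_real_derivative d) (at z)" by blast
  qed
  then show "r \<ge> R \<Longrightarrow> w r < 2 * f r" by (auto simp: h_def)
  have "f x > 0" if "0 \<le> x" for x
    using h pos[of "max R x" x] that by auto
  then show "global_pos a f w" using s a by (simp add: global_pos_def pos_on_def)
qed

text \<open>A Riccati equation: with h = f/w the right-hand side is logistic, h (damp - h), up to
  the perturbation w^(m-1), which vanishes at infinity in both the slow and the fast case.\<close>

lemma ratio_DERIV:
  assumes g: "global_pos a f w" and x: "x > 0"
  shows "((\<lambda>r. f r / w r) has_real_derivative f x / w x * (damp x - f x / w x) - w x powr (m - 1)) (at x)"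
proof -
  have w: "w x > 0" using global_posD(5)[OF g x] .
  have "((\<lambda>r. f r / w r) has_real_derivative
      (- (w x powr m) * w x - f x * (f x - damp x * w x)) / (w x * w x)) (at x)"
    using w by (intro DERIV_divide global_posD[OF g] x) auto
  then show ?thesis
    by (rule DERIV_cong) (use w in \<open>simp add: powr_m_split[of "w x"] field_simps\<close>)
qed

text \<open>As long as 1/2 < h \<le> 1 - e, the Riccati equation makes h grow at rate at least e/4,
  so h passes 1 - e and cannot return. The bound from above is wt/vol, by concavity.\<close>

lemma slow_ratio_tendsto:
  assumes g: "global_pos a f w" and R: "\<And>r. r \<ge> R \<Longrightarrow> w r < 2 * f r"
  shows "((\<lambda>r. f r / w r) \<longlongrightarrow> 1) at_top"
proof -
  define h where "h r = f r / w r" for r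
  note D = ratio_DERIV[OF g, folded h_def]
  have fw: "f r > 0" "w r > 0" if "r > 0" for r using global_posD(4,5)[OF g] that by auto
  have "((\<lambda>r. 2 * f r) \<longlongrightarrow> 0) at_top"
    using tendsto_mult_left[OF global_pos_tendsto_0[OF g], of 2] by simp
  moreover have "\<forall>\<^sub>F r in at_top. norm (w r) \<le> 2 * f r"
    using eventually_gt_at_top[of "max R 0"] by eventually_elim (use R fw in \<open>auto simp: abs_of_pos intro: less_imp_le\<close>)
  ultimately have w0: "(w \<longlongrightarrow> 0) at_top" by (rule Lim_null_comparison[rotated])
  have wm: "((\<lambda>r. w r powr (m - 1)) \<longlongrightarrow> 0) at_top"
  proof (rule tendsto_zero_powrI[OF w0 tendsto_const])
    show "\<forall>\<^sub>F r in at_top. w r \<ge> 0"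
      using eventually_gt_at_top[of 0] by eventually_elim (use fw in \<open>auto intro: less_imp_le\<close>)
  qed (use m_gt_1 in auto)
  have lower: "\<forall>\<^sub>F r in at_top. h r > 1 - e" if e: "0 < e" "e < 1 / 2" for e
  proof -
    have "\<forall>\<^sub>F r in at_top. w r powr (m - 1) < e / 4"
      using order_tendstoD(2)[OF wm, of "e / 4"] e by simp
    then obtain r0 where r0: "\<And>r. r \<ge> r0 \<Longrightarrow> w r powr (m - 1) < e / 4" by (auto simp: eventually_at_top_linorder)
    define r1 where "r1 = max r0 (max R 1)"
    have h2: "h r > 1 / 2" if "r \<ge> r1" for r
      using R[of r] fw[of r] that by (auto simp: h_def r1_def field_simps)
    have step: "h r * (damp r - h r) - w r powr (m - 1) \<ge> e / 4" if r: "r \<ge> r1" "h r \<le> 1 - e" for r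
    proof -
      have "damp r \<ge> 1" using damp_ge[of r] r by (simp add: r1_def)
      then have "1 / 2 * e \<le> h r * (damp r - h r)"
        using h2[OF r(1)] r e by (intro mult_mono) auto
      then show ?thesis using r0[of r] r by (simp add: r1_def)
    qed
    have "\<exists>r2\<ge>r1. h r2 > 1 - e"
    proof (rule ccontr)
      assume "\<not> ?thesis"
      then have le: "h r \<le> 1 - e" if "r \<ge> r1" for r using that by force
      \<comment> \<open>Growth at rate e/4 over the length 4/e would raise h by 1, which does not
        fit between 1/2 and 1 - e.\<close>
      define r where "r = r1 + 4 / e"
      have r: "r1 \<le> r" using e by (simp add: r_def)
      have "h r1 - e / 4 * r1 \<le> h r - e / 4 * r"
      proof (rule DERIV_nonneg_le[where f = "\<lambda>r. h r - e / 4 * r", OF r])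
        show "((\<lambda>r. h r - e / 4 * r) has_real_derivative h x * (damp x - h x) - w x powr (m - 1) - e / 4) (at x)"
          if "r1 < x" for x
          by (rule DERIV_cong[OF DERIV_diff[OF D DERIV_cmult[OF DERIV_ident]]]) (use that in \<open>auto simp: r1_def\<close>)
        show "continuous_on {r1..r} (\<lambda>r. h r - e / 4 * r)"
          by (intro continuous_at_imp_continuous_on ballI continuous_intros DERIV_isCont[OF D]) (auto simp: r1_def)
        show "h x * (damp x - h x) - w x powr (m - 1) - e / 4 \<ge> 0" if "r1 < x" for x
          using step[of x] le[of x] that by simp
      qed
      moreover have "e / 4 * r = e / 4 * r1 + 1" using e by (simp add: r_def field_simps)
      ultimately show False using h2[of r1] le[OF r] e by simp
    qed
    then obtain r2 where r2: "r2 \<ge> r1" "h r2 > 1 - e" by blast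
    have "1 - e - h b < 0" if b: "b \<ge> r2" for b
    proof (rule barrier[where h = "\<lambda>r. 1 - e - h r", OF _ b])
      show "continuous_on {r2..b} (\<lambda>r. 1 - e - h r)"
        using r2 by (intro continuous_at_imp_continuous_on ballI continuous_intros DERIV_isCont[OF D]) (auto simp: r1_def)
      show "1 - e - h r2 < 0" using r2 by simp
      fix z assume z: "r2 < z" "1 - e - h z = 0"
      have "z > 0" using z r2 by (simp add: r1_def)
      have "((\<lambda>r. 1 - e - h r) has_real_derivative - (h z * (damp z - h z) - w z powr (m - 1))) (at z)"
        by (rule DERIV_cong[OF DERIV_diff[OF DERIV_const D]]) (use \<open>z > 0\<close> in auto)
      moreover have "- (h z * (damp z - h z) - w z powr (m - 1)) < 0"
        using step[of z] z r2 e by simp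
      ultimately show "\<exists>d<0. ((\<lambda>r. 1 - e - h r) has_real_derivative d) (at z)" by blast
    qed
    then show ?thesis by (auto simp: eventually_at_top_linorder intro!: exI[of _ r2])
  qed
  have "((\<lambda>r. 1 / (vol r / wt r)) \<longlongrightarrow> 1 / 1) at_top"
    by (intro tendsto_intros vol_wt_tendsto) auto
  then have upper: "((\<lambda>r. 1 / (vol r / wt r)) \<longlongrightarrow> 1) at_top" by simp
  have "(h \<longlongrightarrow> 1) at_top"
  proof (rule order_tendstoI)
    fix y :: real assume "y < 1"
    define e where "e = min (1 - y) (1 / 3)"
    have "\<forall>\<^sub>F r in at_top. h r > 1 - e" using \<open>y < 1\<close> by (intro lower) (auto simp: e_def min_def)
    then show "\<forall>\<^sub>F r in at_top. h r > y" by eventually_elim (auto simp: e_def)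
  next
    fix y :: real assume "y > 1"
    from order_tendstoD(2)[OF upper this] eventually_gt_at_top[of 0]
    show "\<forall>\<^sub>F r in at_top. h r < y"
    proof eventually_elim
      case (elim r)
      have "h r < 1 / (vol r / wt r)"
        using global_posD(9)[OF g elim(2)] vol_pos[OF elim(2)] fw[OF elim(2)] by (simp add: h_def field_simps)
      then show ?case using elim by simp
    qed
  qed
  then show ?thesis by (simp add: h_def[abs_def])
qed

text \<open>As w/f tends to 1, the derivative of f^(1-m) tends to m - 1, and l'Hospital's rule gives
  f^(1-m) / r the same limit.\<close>

lemma slow_asymptotics:
  assumes g: "global_pos a f w" and R: "\<And>r. r \<ge> R \<Longrightarrow> w r < 2 * f r"
  shows "f \<sim>[at_top] (\<lambda>r. ((m - 1) * r) powr (- (1 / (m - 1))))"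
proof (rule asymp_equivI')
  have fw: "f r > 0" "w r > 0" if "r > 0" for r using global_posD(4,5)[OF g] that by auto
  have "((\<lambda>r. f r powr (1 - m) / r) \<longlongrightarrow> m - 1) at_top"
  proof (rule lhospital_at_top_at_top[OF filterlim_ident])
    show "\<forall>\<^sub>F r in at_top. ((\<lambda>r. f r powr (1 - m)) has_real_derivative (m - 1) * (w r / f r) powr m) (at r)"
      using eventually_gt_at_top[of 0] by eventually_elim (rule f_powr_DERIV[OF g])
    have "((\<lambda>r. (m - 1) * (1 / (f r / w r)) powr m / 1) \<longlongrightarrow> (m - 1) * (1 / 1) powr m / 1) at_top"
      by (intro tendsto_intros slow_ratio_tendsto[OF g R]) auto
    then show "((\<lambda>r. (m - 1) * (w r / f r) powr m / 1) \<longlongrightarrow> m - 1) at_top" by simp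
  qed auto
  then have "((\<lambda>r. (f r powr (1 - m) / r / (m - 1)) powr (- (1 / (m - 1)))) \<longlongrightarrow>
      ((m - 1) / (m - 1)) powr (- (1 / (m - 1)))) at_top"
    using m_gt_1 by (intro tendsto_intros) auto
  then have "((\<lambda>r. (f r powr (1 - m) / r / (m - 1)) powr (- (1 / (m - 1)))) \<longlongrightarrow> 1) at_top"
    using m_gt_1 by simp
  then show "((\<lambda>r. f r / ((m - 1) * r) powr (- (1 / (m - 1)))) \<longlongrightarrow> 1) at_top"
  proof (rule Lim_transform_eventually)
    show "\<forall>\<^sub>F r in at_top. (f r powr (1 - m) / r / (m - 1)) powr (- (1 / (m - 1)))
        = f r / ((m - 1) * r) powr (- (1 / (m - 1)))"
      using eventually_gt_at_top[of 0]
    proof eventually_elim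
      case (elim r)
      have "(f r powr (1 - m) / r / (m - 1)) powr (- (1 / (m - 1)))
          = (f r powr (1 - m)) powr (- (1 / (m - 1))) / ((m - 1) * r) powr (- (1 / (m - 1)))"
        using elim m_gt_1 by (simp add: mult.commute flip: powr_divide)
      also have "(f r powr (1 - m)) powr (- (1 / (m - 1))) = f r powr ((1 - m) * (- (1 / (m - 1))))"
        by (rule powr_powr)
      also have "(1 - m) * (- (1 / (m - 1))) = 1" using m_gt_1 by (simp add: field_simps)
      finally show ?case using fw[OF elim] by simp
    qed
  qed
qed

text \<open>In the slow region w^m \<le> f/4, so f exp (r/4) does not decrease; fast decay would
  bound f by a multiple of exp (-m r) with m > 1.\<close>

lemma slow_not_fast:
  assumes g: "global_pos a f w" and R: "\<And>r. r \<ge> R \<Longrightarrow> w r < 2 * f r" and p: "(p - 1) * m = 1"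
  shows "\<not> fast_decay N p f"
proof
  assume fast: "fast_decay N p f"
  then obtain c where c: "c > 0"
    and as: "f \<sim>[at_top] (\<lambda>r. c * r powr (- (real N - 1) / (p - 1)) * exp (- r / (p - 1)))"
    by (auto simp: fast_decay_def)
  have p': "p - 1 > 0" using p m_gt_1 by (metis mult_less_0_iff not_less_iff_gr_or_eq less_trans zero_less_one mult_zero_left)
  have pm: "1 / (p - 1) = m" using p p' by (simp add: field_simps)
  have "\<forall>\<^sub>F r in at_top. f r < delta"
    using order_tendstoD(2)[OF global_pos_tendsto_0[OF g] delta_pos] .
  then obtain r0 where r0: "\<And>r. r \<ge> r0 \<Longrightarrow> f r < delta" by (auto simp: eventually_at_top_linorder)
  define r1 where "r1 = max r0 (max R 1)"
  have D: "((\<lambda>r. f r * exp (r / 4)) has_real_derivative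
      - (w x powr m) * exp (x / 4) + exp (x / 4) * (1 / 4) * f x) (at x)" if "x > 0" for x
    by (intro DERIV_mult global_posD(6)[OF g that]) (auto intro!: derivative_eq_intros)
  have low: "f r1 * exp (r1 / 4) \<le> f r * exp (r / 4)" if r: "r \<ge> r1" for r
  proof (rule DERIV_nonneg_le[where f = "\<lambda>r. f r * exp (r / 4)", OF r _ D])
    show "continuous_on {r1..r} (\<lambda>r. f r * exp (r / 4))"
      by (intro continuous_at_imp_continuous_on ballI DERIV_isCont[OF D]) (auto simp: r1_def)
    fix x assume "r1 < x"
    then have x: "x > 0" "x \<ge> R" "x \<ge> r0" by (auto simp: r1_def)
    have wx: "w x > 0" "w x < 2 * f x" using global_posD(5)[OF g x(1)] R[OF x(2)] by auto
    have "w x powr (m - 1) \<le> 1 / 8" using wx r0[OF x(3)] by (intro powr_le_if_delta) auto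
    then have "w x powr m \<le> w x * (1 / 8)"
      using wx unfolding powr_m_split[OF wx(1)] by (intro mult_left_mono) auto
    then have "w x powr m \<le> f x / 4" using wx by linarith
    then have "exp (x / 4) * (f x / 4 - w x powr m) \<ge> 0" by simp
    then show "- (w x powr m) * exp (x / 4) + exp (x / 4) * (1 / 4) * f x \<ge> 0" by (simp add: algebra_simps)
  qed (auto simp: r1_def)
  define G where "G r = c * r powr (- (real N - 1) / (p - 1)) * exp (- r / (p - 1))" for r
  have "((\<lambda>r. f r / G r) \<longlongrightarrow> 1) at_top"
    using c by (intro asymp_equivD_strong[OF as, folded G_def]) (auto simp: G_def eventually_at_top_linorder intro!: exI[of _ 1])
  moreover have "((\<lambda>r. G r * exp (r / 4)) \<longlongrightarrow> 0) at_top"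
  proof (rule Lim_null_comparison)
    show "\<forall>\<^sub>F r in at_top. norm (G r * exp (r / 4)) \<le> c * exp (- (m - 1 / 4) * r)"
      using eventually_ge_at_top[of 1]
    proof eventually_elim
      case (elim r)
      have "r powr (- (real N - 1) / (p - 1)) \<le> r powr 0"
        using elim p' real_N by (intro powr_mono divide_nonpos_pos) auto
      then have "c * r powr (- (real N - 1) / (p - 1)) \<le> c * 1" using elim c by (intro mult_left_mono) auto
      then have "c * r powr (- (real N - 1) / (p - 1)) * (exp (- r / (p - 1)) * exp (r / 4))
          \<le> c * 1 * (exp (- r / (p - 1)) * exp (r / 4))" by (intro mult_right_mono) auto
      moreover have "- r / (p - 1) = - (m * r)" using pm by (metis minus_divide_left mult.commute times_divide_eq_right mult.right_neutral)
      then have "exp (- r / (p - 1)) * exp (r / 4) = exp (- (m - 1 / 4) * r)"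
        by (simp add: mult_exp_exp algebra_simps)
      ultimately show ?case using c by (simp add: G_def abs_mult mult.assoc)
    qed
    have "filterlim (\<lambda>r. - (m - 1 / 4) * r) at_bot at_top"
      using m_gt_1 by (intro filterlim_tendsto_neg_mult_at_bot[OF tendsto_const _ filterlim_ident]) auto
    then have "((\<lambda>r. exp (- (m - 1 / 4) * r)) \<longlongrightarrow> 0) at_top"
      using filterlim_compose[OF exp_at_bot] by blast
    from tendsto_mult_left[OF this, of c] show "((\<lambda>r. c * exp (- (m - 1 / 4) * r)) \<longlongrightarrow> 0) at_top" by simp
  qed
  ultimately have "((\<lambda>r. (f r / G r) * (G r * exp (r / 4))) \<longlongrightarrow> 1 * 0) at_top" by (rule tendsto_mult)
  moreover have "\<forall>\<^sub>F r in at_top. f r1 * exp (r1 / 4) \<le> (f r / G r) * (G r * exp (r / 4))"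
    using eventually_ge_at_top[of r1]
  proof eventually_elim
    case (elim r)
    have "G r \<noteq> 0" using c elim by (auto simp: G_def r1_def)
    then show ?case using low[OF elim] by simp
  qed
  ultimately have "f r1 * exp (r1 / 4) \<le> 1 * 0" by (rule tendsto_lowerbound) simp
  moreover have "f r1 > 0" using global_posD(4)[OF g, of r1] by (simp add: r1_def le_max_iff_disj)
  ultimately show False by (simp add: mult_le_0_iff)
qed

lemma mass_mono:
  assumes g: "global_pos a f w" and xy: "0 < x" "x \<le> y"
  shows "wt x * w x \<le> wt y * w y"
proof (rule DERIV_nonneg_le[where f = "\<lambda>r. wt r * w r", OF xy(2) _ global_posD(8)[OF g]])
  show "continuous_on {x..y} (\<lambda>r. wt r * w r)"
    using xy by (intro continuous_at_imp_continuous_on ballI DERIV_isCont[OF global_posD(8)[OF g]]) auto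
  show "wt z * f z \<ge> 0" if "x < z" for z
    using that xy global_posD(4)[OF g, of z] wt_nonneg[of z] by simp
qed (use xy in auto)

text \<open>Outside the slow region f \<le> w/2 for large r, so w decays at least like exp (-r/2).
  Instability of h = 0 then forces h \<le> 2 w^(m-1), which is exponentially small; since h is the
  logarithmic derivative of the mass, the mass stays bounded.\<close>

lemma bounded_mass:
  assumes g: "global_pos a f w" and out: "\<And>r. 0 \<le> r \<Longrightarrow> f r < delta \<Longrightarrow> 2 * f r \<le> w r"
  shows "\<exists>C. \<forall>r\<ge>1. wt r * w r \<le> C"
proof -
  have fw: "f r > 0" "w r > 0" if "r > 0" for r using global_posD(4,5)[OF g] that by auto
  have "\<forall>\<^sub>F r in at_top. f r < delta"
    using order_tendstoD(2)[OF global_pos_tendsto_0[OF g] delta_pos] .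
  then obtain r0 where r0: "\<And>r. r \<ge> r0 \<Longrightarrow> f r < delta" by (auto simp: eventually_at_top_linorder)
  define R where "R = max r0 1"
  have R: "R \<ge> 1" "R > 0" by (auto simp: R_def)
  have w2f: "2 * f r \<le> w r" if "r \<ge> R" for r using out[of r] r0[of r] that by (auto simp: R_def)
  have Dw: "((\<lambda>r. w r * exp (r / 2)) has_real_derivative
      (f x - damp x * w x) * exp (x / 2) + exp (x / 2) * (1 / 2) * w x) (at x)" if "x > 0" for x
    by (intro DERIV_mult global_posD(7)[OF g that]) (auto intro!: derivative_eq_intros)
  have wexp: "w y * exp (y / 2) \<le> w x * exp (x / 2)" if xy: "R \<le> x" "x \<le> y" for x y
  proof (rule DERIV_nonpos_ge[where f = "\<lambda>r. w r * exp (r / 2)", OF xy(2) _ Dw])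
    show "continuous_on {x..y} (\<lambda>r. w r * exp (r / 2))"
      using xy R by (intro continuous_at_imp_continuous_on ballI DERIV_isCont[OF Dw]) auto
    fix z assume z: "x < z"
    then have "w z \<le> damp z * w z" using damp_ge[of z] fw[of z] xy R by simp
    then have "f z - damp z * w z + w z / 2 \<le> 0" using w2f[of z] z xy by simp
    then have "exp (z / 2) * (f z - damp z * w z + w z / 2) \<le> 0" by (simp add: mult_nonneg_nonpos)
    then show "(f z - damp z * w z) * exp (z / 2) + exp (z / 2) * (1 / 2) * w z \<le> 0" by (simp add: algebra_simps)
  qed (use xy R in auto)
  have wdec: "w y \<le> w x" if xy: "R \<le> x" "x \<le> y" for x y
  proof -
    have "w x * exp (x / 2) \<le> w x * exp (y / 2)" using xy fw[of x] R by (intro mult_left_mono) auto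
    then have "w y * exp (y / 2) \<le> w x * exp (y / 2)" using wexp[OF xy] by linarith
    then show ?thesis by simp
  qed
  define h where "h r = f r / w r" for r
  note D = ratio_DERIV[OF g, folded h_def]
  have h12: "h r \<le> 1 / 2" "h r > 0" if "r \<ge> R" for r
    using w2f[OF that] fw[of r] that R by (auto simp: h_def field_simps)
  \<comment> \<open>If h exceeded 2e at r by k > 0, then, w being nonincreasing, h' \<ge> (h - 2e)/2
    from r on. After the time 2/k the excess is at least k exp (1/k) \<ge> k + 1, against h \<le>
    1/2.\<close>
  have hle: "h r \<le> 2 * w r powr (m - 1)" if r: "r \<ge> R" for r
  proof (rule ccontr)
    define e where "e = w r powr (m - 1)"
    define k where "k = h r - 2 * e"
    assume "\<not> ?thesis"
    then have k: "k > 0" by (simp add: k_def e_def)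
    define y where "y = r + 2 / k"
    have y: "r \<le> y" using k by (simp add: y_def)
    have De: "((\<lambda>r. (h r - 2 * e) * exp (- r / 2)) has_real_derivative
        (h x * (damp x - h x) - w x powr (m - 1)) * exp (- x / 2) + exp (- x / 2) * (- (1 / 2)) * (h x - 2 * e)) (at x)"
      if "x > 0" for x
    proof (intro DERIV_mult)
      show "((\<lambda>r. h r - 2 * e) has_real_derivative h x * (damp x - h x) - w x powr (m - 1)) (at x)"
        by (rule DERIV_cong[OF DERIV_diff[OF D[OF that] DERIV_const]]) simp
    qed (auto intro!: derivative_eq_intros)
    have "(h r - 2 * e) * exp (- r / 2) \<le> (h y - 2 * e) * exp (- y / 2)"
    proof (rule DERIV_nonneg_le[where f = "\<lambda>r. (h r - 2 * e) * exp (- r / 2)", OF y _ De])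
      show "continuous_on {r..y} (\<lambda>r. (h r - 2 * e) * exp (- r / 2))"
        using r R by (intro continuous_at_imp_continuous_on ballI DERIV_isCont[OF De]) auto
      fix z assume z: "r < z"
      have "w z powr (m - 1) \<le> e"
        unfolding e_def using wdec[of r z] fw[of z] z r R m_gt_1 by (intro powr_mono2) auto
      moreover have "h z * (1 / 2) \<le> h z * (damp z - h z)"
        using h12[of z] damp_ge[of z] z r R by (intro mult_left_mono) auto
      ultimately have "h z * (damp z - h z) - w z powr (m - 1) - (h z - 2 * e) / 2 \<ge> 0" by (simp add: diff_divide_distrib)
      then have "exp (- z / 2) * (h z * (damp z - h z) - w z powr (m - 1) - (h z - 2 * e) / 2) \<ge> 0" by simp
      then show "(h z * (damp z - h z) - w z powr (m - 1)) * exp (- z / 2)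
          + exp (- z / 2) * (- (1 / 2)) * (h z - 2 * e) \<ge> 0" by (simp add: algebra_simps)
    qed (use r R in auto)
    then have "k * exp (- r / 2) * exp (y / 2) \<le> (h y - 2 * e) * exp (- y / 2) * exp (y / 2)"
      unfolding k_def by (intro mult_right_mono) auto
    moreover have "exp (- r / 2) * exp (y / 2) = exp (1 / k)"
      using k by (simp add: y_def mult_exp_exp field_simps)
    moreover have "exp (- y / 2) * exp (y / 2) = 1" by (simp add: mult_exp_exp)
    ultimately have "k * exp (1 / k) \<le> h y - 2 * e" by (simp only: mult.assoc mult_1_right)
    moreover have "k * (1 + 1 / k) \<le> k * exp (1 / k)"
      using k exp_ge_add_one_self[of "1 / k"] by (intro mult_left_mono) auto
    moreover have "k * (1 + 1 / k) = k + 1" using k by (simp add: field_simps)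
    moreover have "h y \<le> 1 / 2" using h12[of y] y r by simp
    moreover have "e \<ge> 0" by (simp add: e_def)
    ultimately show False using k by linarith
  qed
  define K where "K = 2 * (w R * exp (R / 2)) powr (m - 1)"
  have wK: "2 * w r powr (m - 1) \<le> K * exp (- (m - 1) / 2 * r)" if r: "r \<ge> R" for r
  proof -
    have "w r = w r * exp (r / 2) * exp (- r / 2)" by (simp add: mult.assoc mult_exp_exp)
    also have "\<dots> \<le> w R * exp (R / 2) * exp (- r / 2)" using wexp[of R r] r by (intro mult_right_mono) auto
    finally have "w r powr (m - 1) \<le> (w R * exp (R / 2) * exp (- r / 2)) powr (m - 1)"
      using fw[of r] r R m_gt_1 by (intro powr_mono2) auto
    also have "\<dots> = (w R * exp (R / 2)) powr (m - 1) * exp (- r / 2) powr (m - 1)"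
      by (rule powr_mult)
    also have "exp (- r / 2) powr (m - 1) = exp (- (m - 1) / 2 * r)" by (simp add: powr_def field_simps)
    finally show ?thesis by (simp add: K_def)
  qed
  define l where "l = (m - 1) / 2"
  have l: "l > 0" using m_gt_1 by (simp add: l_def)
  \<comment> \<open>The added term is a primitive of - K exp (-l x); it absorbs the bound on h and
    makes the sum nonincreasing.\<close>
  define Lg where "Lg r = ln (wt r * w r) + K / l * exp (- l * r)" for r
  have DL: "(Lg has_real_derivative h x - K * exp (- l * x)) (at x)" if x: "x > 0" for x
  proof -
    have pos: "wt x * w x > 0" using wt_pos[OF x] fw[OF x] by simp
    have "((\<lambda>r. ln (wt r * w r)) has_real_derivative 1 / (wt x * w x) * (wt x * f x)) (at x)"
      by (rule DERIV_chain2[OF DERIV_ln_divide[OF pos] global_posD(8)[OF g x]])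
    moreover have "1 / (wt x * w x) * (wt x * f x) = h x" using wt_pos[OF x] by (simp add: h_def)
    moreover have "((\<lambda>r. K / l * exp (- l * r)) has_real_derivative K / l * (exp (- l * x) * (- l))) (at x)"
      by (auto intro!: derivative_eq_intros)
    moreover have "K / l * (exp (- l * x) * (- l)) = - (K * exp (- l * x))" using l by simp
    ultimately show ?thesis unfolding Lg_def[abs_def] by (metis DERIV_add diff_conv_add_uminus)
  qed
  have Lg: "Lg r \<le> Lg R" if r: "r \<ge> R" for r
  proof (rule DERIV_nonpos_ge[where f = Lg, OF r _ DL])
    show "continuous_on {R..r} Lg"
      using R by (intro continuous_at_imp_continuous_on ballI DERIV_isCont[OF DL]) auto
    show "h x - K * exp (- l * x) \<le> 0" if "R < x" for x
    proof -
      have "- (m - 1) / 2 * x = - l * x" by (simp add: l_def field_simps)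
      then show ?thesis using hle[of x] wK[of x] that by simp
    qed
  qed (use R in auto)
  have "wt r * w r \<le> exp (Lg R)" if r: "r \<ge> R" for r
  proof -
    have "K \<ge> 0" by (simp add: K_def)
    then have "ln (wt r * w r) \<le> Lg R" using Lg[OF r] l by (simp add: Lg_def add_increasing2 order.trans[rotated])
    then have "exp (ln (wt r * w r)) \<le> exp (Lg R)" by simp
    then show ?thesis using wt_pos[of r] fw[of r] r R by simp
  qed
  then have "wt r * w r \<le> exp (Lg R)" if "r \<ge> 1" for r
    using that mass_mono[OF g, of r R] by (cases "r \<ge> R") (force intro: order.trans)+
  then show ?thesis by blast
qed

text \<open>The increasing, bounded mass M has a limit l > 0. L'Hospital's rule compares f with G =
  wt^(-m): the quotient of derivatives is M^m / (m damp), so f/G tends to l^m / m, which is the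
  constant c of the decay law.\<close>

lemma fast_asymptotics:
  assumes g: "global_pos a f w" and C: "\<And>r. r \<ge> 1 \<Longrightarrow> wt r * w r \<le> C" and p: "(p - 1) * m = 1"
  shows "fast_decay N p f"
proof -
  have fw: "f r > 0" "w r > 0" if "r > 0" for r using global_posD(4,5)[OF g] that by auto
  define M where "M r = wt r * w r" for r
  define l where "l = (SUP r\<in>{1..}. M r)"
  have bdd: "bdd_above (M ` {1..})" using C by (auto simp: bdd_above_def M_def)
  have Ml: "M r \<le> l" if "r \<ge> 1" for r
    unfolding l_def using bdd that by (intro cSUP_upper) auto
  have "M 1 > 0" using fw[of 1] wt_pos[of 1] by (simp add: M_def)
  then have l: "l > 0" using Ml[of 1] by simp
  have Mlim: "(M \<longlongrightarrow> l) at_top"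
  proof (rule increasing_tendsto)
    show "\<forall>\<^sub>F r in at_top. M r \<le> l" using Ml by (auto simp: eventually_at_top_linorder)
    fix x assume "x < l"
    then obtain r where r: "r \<ge> 1" "x < M r"
      unfolding l_def using less_cSUP_iff[OF _ bdd] by auto
    have "x < M s" if "s \<ge> r" for s using mass_mono[OF g, of r s] that r by (simp add: M_def)
    then show "\<forall>\<^sub>F s in at_top. x < M s" by (auto simp: eventually_at_top_linorder)
  qed
  have damp1: "(damp \<longlongrightarrow> 1) at_top"
  proof -
    have "((\<lambda>r. 1 + (real N - 1) / r) \<longlongrightarrow> 1 + 0) at_top"
      by (intro tendsto_intros real_tendsto_divide_at_top[OF tendsto_const filterlim_ident])
    then show ?thesis by (simp add: damp_def[abs_def])
  qed
  define G where "G r = wt r powr (- m)" for r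
  have dG: "(G has_real_derivative (- m) * G x * damp x) (at x)" if x: "x > 0" for x
  proof -
    have "(G has_real_derivative ((- m) * wt x powr (- m - 1)) * (wt x * damp x)) (at x)"
      unfolding G_def[abs_def]
      by (rule DERIV_chain2[OF has_real_derivative_powr[OF wt_pos[OF x]] wt_DERIV[OF x]])
    moreover have "wt x powr (- m - 1) * wt x = G x"
      using powr_mult_base[of "wt x" "- m - 1"] wt_nonneg[of x] x by (simp add: G_def mult.commute)
    then have "((- m) * wt x powr (- m - 1)) * (wt x * damp x) = (- m) * G x * damp x"
      by (simp add: mult.assoc[symmetric])
    ultimately show ?thesis by (rule DERIV_cong)
  qed
  have Gpos: "G x > 0" if "x > 0" for x using wt_pos[OF that] by (simp add: G_def)
  have "((\<lambda>r. f r / G r) \<longlongrightarrow> l powr m / (m * 1)) at_top"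
  proof (rule lhopital_at_top_0[where b = 0])
    show "(f \<longlongrightarrow> 0) at_top" by (rule global_pos_tendsto_0[OF g])
    show "(G \<longlongrightarrow> 0) at_top"
      unfolding G_def[abs_def] by (rule tendsto_neg_powr[OF _ wt_at_top]) (use m_gt_1 in simp)
    show "(- m) * G x * damp x < 0" if "x > 0" for x
      using m_gt_1 Gpos[OF that] damp_ge[OF that] by (simp add: mult_pos_pos)
    have "((\<lambda>r. M r powr m / (m * damp r)) \<longlongrightarrow> l powr m / (m * 1)) at_top"
      using l m_gt_1 by (intro tendsto_intros Mlim damp1) auto
    then show "((\<lambda>r. - (w r powr m) / ((- m) * G r * damp r)) \<longlongrightarrow> l powr m / (m * 1)) at_top"
    proof (rule Lim_transform_eventually)
      show "\<forall>\<^sub>F r in at_top. M r powr m / (m * damp r) = - (w r powr m) / ((- m) * G r * damp r)"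
        using eventually_gt_at_top[of 0]
      proof eventually_elim
        case (elim r)
        have "M r powr m = w r powr m / G r"
          using wt_pos[OF elim] fw[OF elim] by (simp add: M_def G_def powr_mult powr_minus field_simps)
        then show ?case by (simp add: mult_ac)
      qed
    qed
  qed (use global_posD(6)[OF g] dG Gpos in auto)
  moreover define c where "c = l powr m / m"
  moreover have c: "c > 0" using l m_gt_1 by (simp add: c_def)
  ultimately have "((\<lambda>r. f r / G r / c) \<longlongrightarrow> c / c) at_top" by (intro tendsto_divide) auto
  then have lim: "((\<lambda>r. f r / (c * G r)) \<longlongrightarrow> 1) at_top" using c by (simp add: mult.commute)
  have p': "p - 1 \<noteq> 0" using p by auto
  have "m = 1 / (p - 1)" using p p' by (simp add: eq_divide_eq mult.commute)
  then have pm: "x / (p - 1) = m * x" for x by simp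
  have "f \<sim>[at_top] (\<lambda>r. c * r powr (- (real N - 1) / (p - 1)) * exp (- r / (p - 1)))"
  proof (rule asymp_equivI', rule Lim_transform_eventually[OF lim])
    show "\<forall>\<^sub>F r in at_top. f r / (c * G r) = f r / (c * r powr (- (real N - 1) / (p - 1)) * exp (- r / (p - 1)))"
      using eventually_gt_at_top[of 0]
    proof eventually_elim
      case (elim r)
      have "r ^ (N - 1) = r powr (real N - 1)" using elim N_pos by (simp add: powr_realpow[symmetric] of_nat_diff)
      moreover have "- (m * (real N - 1)) = m * (1 - real N)" by (simp add: algebra_simps)
      ultimately have "G r = r powr (- (real N - 1) / (p - 1)) * exp (- r / (p - 1))"
        unfolding G_def wt_def pm using elim
        by (simp add: powr_mult powr_powr exp_powr_real mult.commute)
      then show ?case by (simp add: mult.assoc)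
    qed
  qed
  then show ?thesis using c global_posD(4)[OF g] by (auto simp: fast_decay_def)
qed


section \<open>Dependence on the initial value\<close>

definition prof :: "real \<Rightarrow> (real \<Rightarrow> real) \<times> (real \<Rightarrow> real)" where
  "prof a = (SOME fw. sol a (fst fw) (snd fw))"

abbreviation "pf a \<equiv> fst (prof a)"

abbreviation "pw a \<equiv> snd (prof a)"

lemma prof_sol: "sol a (pf a) (pw a)"
proof -
  obtain f w where "sol a f w" using sol_exists by blast
  then have "sol a (fst (f, w)) (snd (f, w))" by simp
  then show ?thesis unfolding prof_def by (rule someI)
qed

definition crossing :: "real \<Rightarrow> bool" where
  "crossing a \<longleftrightarrow> (\<exists>R>0. pos_on R a (pf a) (pw a) \<and> pf a R = 0)"

lemma crossing_iff:
  assumes "a > 0"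
  shows "crossing a \<longleftrightarrow> \<not> global_pos a (pf a) (pw a)"
proof
  assume "crossing a"
  then obtain R where "R > 0" "pf a R = 0" by (auto simp: crossing_def)
  then show "\<not> global_pos a (pf a) (pw a)" using global_posD(4)[of a "pf a" "pw a" R] by auto
next
  assume "\<not> global_pos a (pf a) (pw a)"
  then obtain r where r: "0 \<le> r" "\<not> pf a r > 0"
    using assms prof_sol by (auto simp: global_pos_def pos_on_def)
  have "- pf a 0 < 0" using solD(3)[OF prof_sol, of a] assms by simp
  moreover have "continuous_on {0..r} (\<lambda>x. - pf a x)" "- pf a r \<ge> 0"
    using r(2) by (auto intro!: continuous_on_minus sol_continuous(1)[OF prof_sol])
  ultimately obtain R where R: "0 < R" "- pf a R = 0" "\<And>x. 0 \<le> x \<Longrightarrow> x < R \<Longrightarrow> - pf a x < 0"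
    using first_zero[of 0 r "\<lambda>x. - pf a x"] r(1) by blast
  then have "pos_on R a (pf a) (pw a)" using assms prof_sol by (auto simp: pos_on_def)
  then show "crossing a" using R by (auto simp: crossing_def)
qed

lemma crossing_mono:
  assumes "crossing a1" "a1 < a2"
  shows "crossing a2"
proof -
  obtain R where R: "R > 0" "pos_on R a1 (pf a1) (pw a1)" "pf a1 R = 0" using assms by (auto simp: crossing_def)
  then have "a1 > 0" by (simp add: pos_on_def)
  then have "a2 > 0" using assms by simp
  then show ?thesis
    using cross_mono[OF R(2,1,3) assms(2)] by (auto simp: crossing_iff global_pos_def)
qed

text \<open>The flux is still positive at the first zero, so f goes on to negative values. The slope
  belongs to the classification; the negative value is what survives a perturbation.\<close>

lemma crossing_slope:
  assumes "R > 0" "pos_on R a (pf a) (pw a)" "pf a R = 0"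
  shows "deriv_halfline (pf a) R < 0" "\<exists>s>R. pf a s < 0"
proof -
  have w: "pw a R > 0" using pos_on_flux_pos[OF assms(2)] assms(1) by simp
  then show "deriv_halfline (pf a) R < 0"
    using sol_deriv_halfline(2)[OF prof_sol, of R a] assms(1) by (simp add: p_flux_pos)
  have "- (pw a R powr m) < 0" using w by simp
  from DERIV_neg_dec_right[OF pos_on_DERIV(1)[OF assms(2,1)] this]
  obtain d where d: "d > 0" "\<And>h. 0 < h \<Longrightarrow> h < d \<Longrightarrow> pf a R > pf a (R + h)" by auto
  show "\<exists>s>R. pf a s < 0"
    using d(2)[of "d / 2"] d(1) assms by (intro exI[of _ "R + d / 2"]) auto
qed

lemma prof_close:
  assumes "e > 0"
  obtains d where "d > 0" "\<And>a r. \<bar>a - a0\<bar> < d \<Longrightarrow> 0 \<le> r \<Longrightarrow> r \<le> b \<Longrightarrow>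
    \<bar>pf a r - pf a0 r\<bar> < e \<and> \<bar>pw a r - pw a0 r\<bar> < e"
proof -
  define A where "A = \<bar>a0\<bar> + 1"
  have s: "sol_on b a (pf a) (pw a)" for a using prof_sol by (simp add: sol_def)
  obtain K where K: "K > 0" "\<And>a1 f1 w1 a2 f2 w2 r. sol_on b a1 f1 w1 \<Longrightarrow> sol_on b a2 f2 w2 \<Longrightarrow>
    \<bar>a1\<bar> \<le> A \<Longrightarrow> \<bar>a2\<bar> \<le> A \<Longrightarrow> 0 \<le> r \<Longrightarrow> r \<le> b \<Longrightarrow>
    (f1 r - f2 r)\<^sup>2 + (w1 r - w2 r)\<^sup>2 \<le> K * (a1 - a2)\<^sup>2"
    using sol_dependence[of A b] by (auto simp: A_def)
  \<comment> \<open>The 1 keeps the initial values within \<open>A\<close>; K + 1 stands for the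
    square root of K, using K \<le> (K+1)^2.\<close>
  define d where "d = min 1 (e / (K + 1))"
  show thesis
  proof (rule that[of d])
    show "d > 0" using assms K(1) by (simp add: d_def)
    fix a r assume a: "\<bar>a - a0\<bar> < d" and r: "0 \<le> r" "r \<le> b"
    have "\<bar>a\<bar> \<le> A" "\<bar>a0\<bar> \<le> A" using a by (auto simp: A_def d_def)
    then have 1: "(pf a r - pf a0 r)\<^sup>2 + (pw a r - pw a0 r)\<^sup>2 \<le> K * (a - a0)\<^sup>2"
      using K(2)[OF s s] r by blast
    have "\<bar>a - a0\<bar> * (K + 1) < e" using a K(1) by (simp add: d_def field_simps)
    then have "(\<bar>a - a0\<bar> * (K + 1))\<^sup>2 < e\<^sup>2" using K(1) by (intro power_strict_mono) auto
    moreover have "K \<le> (K + 1)\<^sup>2" using K(1) by (simp add: power2_eq_square algebra_simps)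
    then have "K * (a - a0)\<^sup>2 \<le> (K + 1)\<^sup>2 * (a - a0)\<^sup>2" by (rule mult_right_mono) simp
    ultimately have "(pf a r - pf a0 r)\<^sup>2 + (pw a r - pw a0 r)\<^sup>2 < e\<^sup>2"
      using 1 by (simp add: power_mult_distrib mult.commute)
    moreover have "(pf a r - pf a0 r)\<^sup>2 \<ge> 0" "(pw a r - pw a0 r)\<^sup>2 \<ge> 0" by auto
    ultimately have "\<bar>pf a r - pf a0 r\<bar>\<^sup>2 < e\<^sup>2" "\<bar>pw a r - pw a0 r\<bar>\<^sup>2 < e\<^sup>2"
      unfolding power2_abs by linarith+
    then show "\<bar>pf a r - pf a0 r\<bar> < e \<and> \<bar>pw a r - pw a0 r\<bar> < e"
      using assms power_less_imp_less_base[of _ 2 e] by (meson less_imp_le)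
  qed
qed

text \<open>A zero could move under perturbation, but a negative value beyond it persists, and that
  already excludes positivity everywhere.\<close>

lemma crossing_open:
  assumes "crossing a0"
  obtains d where "d > 0" "\<And>a. a > 0 \<Longrightarrow> \<bar>a - a0\<bar> < d \<Longrightarrow> crossing a"
proof -
  obtain R where R: "R > 0" "pos_on R a0 (pf a0) (pw a0)" "pf a0 R = 0" using assms by (auto simp: crossing_def)
  obtain s where s: "s > R" "pf a0 s < 0" using crossing_slope(2)[OF R] by blast
  obtain d where d: "d > 0" "\<And>a r. \<bar>a - a0\<bar> < d \<Longrightarrow> 0 \<le> r \<Longrightarrow> r \<le> s \<Longrightarrow>
    \<bar>pf a r - pf a0 r\<bar> < - pf a0 s \<and> \<bar>pw a r - pw a0 r\<bar> < - pf a0 s"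
    using prof_close[of "- pf a0 s" a0 s] s by auto
  show thesis
  proof (rule that[OF d(1)])
    fix a assume a: "a > 0" "\<bar>a - a0\<bar> < d"
    have "pf a s < 0" using d(2)[OF a(2), of s] s R by auto
    then have "\<not> global_pos a (pf a) (pw a)" using global_posD(4)[of a "pf a" "pw a" s] s R by auto
    then show "crossing a" using crossing_iff[OF a(1)] by simp
  qed
qed

section \<open>Crossing for large initial values\<close>

text \<open>An a priori bound of Keller-Osserman type, uniform in the initial value. Positivity at x
  + 1 gives f(x) \<ge> w(z)^m for some z between x and x + 1, hence M' \<ge> const * M^m for the
  mass M on [s, s + 1]. A large M(s) would blow up within this interval.\<close>

lemma poh_sub_radius_bounded:
  obtains C where "\<And>a f w. global_pos a f w \<Longrightarrow> poh f w sub_radius \<le> C"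
proof -
  define s where "s = sub_radius"
  have s: "s > 0" using sub_radius by (simp add: s_def)
  \<comment> \<open>The rate at which M^(1-m) decreases on [s, s + 1]. The weight at s + 2 enters
    because the intermediate point z may lie up to one unit beyond s + 1.\<close>
  define c where "c = (m - 1) * (wt s * (1 / wt (s + 2)) powr m)"
  have c: "c > 0" using m_gt_1 wt_pos[of s] wt_pos[of "s + 2"] s by (simp add: c_def)
  define F where "F = c powr (- (1 / (m - 1)))"
  have "poh f w s \<le> vol s * (F / wt s) powr (m + 1)" if g: "global_pos a f w" for a f w
  proof -
    have fw: "f r > 0" "w r > 0" if "r > 0" for r using global_posD(4,5)[OF g] that by auto
    define M where "M r = wt r * w r" for r
    have Mpos: "M r > 0" if "r > 0" for r using wt_pos[OF that] fw[OF that] by (simp add: M_def)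
    note Mmono = mass_mono[OF g, folded M_def]
    have DM: "((\<lambda>r. M r powr (1 - m) + c * r) has_real_derivative
        (1 - m) * M x powr (1 - m - 1) * (wt x * f x) + c) (at x)" if x: "x > 0" for x
      by (rule DERIV_cong[OF DERIV_add[OF DERIV_chain2[OF has_real_derivative_powr[OF Mpos[OF x]]
            global_posD(8)[OF g x, folded M_def]] DERIV_cmult[OF DERIV_ident]]]) simp
    have "M (s + 1) powr (1 - m) + c * (s + 1) \<le> M s powr (1 - m) + c * s"
    proof (rule DERIV_nonpos_ge[where f = "\<lambda>r. M r powr (1 - m) + c * r", OF _ _ DM])
      show "continuous_on {s..s + 1} (\<lambda>r. M r powr (1 - m) + c * r)"
        using s by (intro continuous_at_imp_continuous_on ballI DERIV_isCont[OF DM]) auto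
      fix x assume x: "s < x" "x < s + 1"
      then have x0: "x > 0" using s by simp
      have "\<exists>z>x. z < x + 1 \<and> f (x + 1) - f x = (x + 1 - x) * (- (w z powr m))"
        using x0 by (intro MVT2 global_posD(6)[OF g]) auto
      then obtain z where z: "x < z" "z < x + 1" "f (x + 1) - f x = - (w z powr m)" by auto
      have "M x * (1 / wt (s + 2)) \<le> M z * (1 / wt z)"
        using z x x0 s Mmono[of x z] Mpos[of x] Mpos[of z] wt_mono[of z "s + 2"] wt_pos[of z]
        by (intro mult_mono divide_left_mono) (auto intro!: mult_pos_pos wt_pos)
      also have "\<dots> = w z" using wt_pos[of z] z x0 by (simp add: M_def)
      finally have "(M x * (1 / wt (s + 2))) powr m \<le> w z powr m"
        using Mpos[OF x0] wt_pos[of "s + 2"] s m_gt_1 by (intro powr_mono2) auto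
      also have "\<dots> \<le> f x" using z(3) fw[of "x + 1"] x0 by simp
      finally have "M x powr m * (1 / wt (s + 2)) powr m \<le> f x" by (simp only: powr_mult)
      then have "M x powr (- m) * (M x powr m * (1 / wt (s + 2)) powr m) \<le> M x powr (- m) * f x"
        by (intro mult_left_mono) auto
      moreover have "M x powr (- m) * M x powr m = 1" using Mpos[OF x0] by (simp flip: powr_add)
      ultimately have "(1 / wt (s + 2)) powr m \<le> M x powr (- m) * f x" by (simp only: mult.assoc[symmetric] mult_1_left)
      then have "wt s * (1 / wt (s + 2)) powr m \<le> wt x * (M x powr (- m) * f x)"
        using wt_mono[of s x] wt_nonneg[of x] s x by (intro mult_mono) auto
      then have "c \<le> (m - 1) * (wt x * (M x powr (- m) * f x))"
        unfolding c_def using m_gt_1 by (intro mult_left_mono) auto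
      moreover have "(1 - m) * M x powr (1 - m - 1) * (wt x * f x) = - ((m - 1) * (wt x * (M x powr (- m) * f x)))"
        by (simp add: algebra_simps)
      ultimately show "(1 - m) * M x powr (1 - m - 1) * (wt x * f x) + c \<le> 0" by simp
    qed (use s in auto)
    then have "M (s + 1) powr (1 - m) + c \<le> M s powr (1 - m)" by (simp add: algebra_simps)
    then have "c \<le> M s powr (1 - m)" by (rule order.trans[rotated]) simp
    then have "(M s powr (1 - m)) powr (- (1 / (m - 1))) \<le> F"
      unfolding F_def using c m_gt_1 by (intro powr_mono2') auto
    moreover have "(1 - m) * (- (1 / (m - 1))) = 1" using m_gt_1 by (simp add: field_simps)
    ultimately have "M s \<le> F" using Mpos[OF s] by (simp add: powr_powr)
    then have "w s \<le> F / wt s" using wt_pos[OF s] by (simp add: M_def field_simps)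
    then have "w s powr (m + 1) \<le> (F / wt s) powr (m + 1)" using fw[OF s] m_gt_1 by (intro powr_mono2) auto
    then have "vol s * w s powr (m + 1) \<le> vol s * (F / wt s) powr (m + 1)"
      using vol_nonneg[of s] s by (intro mult_left_mono) auto
    moreover have "vol s * w s powr (m + 1) / (m + 1) \<le> vol s * w s powr (m + 1) / 1"
      using m_gt_1 vol_nonneg[of s] s by (intro divide_left_mono) auto
    moreover have "f s * (vol s * f s - wt s * w s) / 2 \<le> 0"
      using fw[OF s] global_posD(9)[OF g s] by (simp add: mult_nonneg_nonpos)
    ultimately show ?thesis unfolding poh_def by simp
  qed
  then show thesis using that s_def by metis
qed

text \<open>As w \<le> a r, f loses at most (a s)^m s on (0, s); the smallness condition bounds this
  by a/2. So f \<ge> a/2, which bounds w from below linearly, and integrating the derivative of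
  \<open>poh\<close> gives the claim. Up to \<open>sub_radius\<close> nothing is lost again.\<close>

lemma poh_sub_radius_lower:
  obtains c where "c > 0" "\<And>a f w s. global_pos a f w \<Longrightarrow> 0 < s \<Longrightarrow> s \<le> sub_radius \<Longrightarrow>
    a powr (m - 1) * s powr (m + 1) \<le> 1 / 2 \<Longrightarrow>
    c * a powr (m + 1) * s powr (m + real N + 1) \<le> poh f w sub_radius"
proof -
  define k where "k = (theta - (real N - 1) / real N) / 2"
  have k: "k > 0" using theta_gt by (simp add: k_def)
  \<comment> \<open>The 6 N collects 2 from f \<ge> a/2, 3 from exp r \<le> 3, and N from vol \<ge>
    r^N / N. The exponent m + N + 1 arises by integrating r^(m+1) r^(N-1).\<close>
  define c where "c = k * (1 / (6 * real N)) powr (m + 1) / (m + real N + 1)"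
  have c: "c > 0" using k m_gt_1 real_N by (simp add: c_def)
  show thesis
  proof (rule that[OF c])
    fix a f w s assume g: "global_pos a f w" and s: "0 < s" "s \<le> sub_radius"
      and as: "a powr (m - 1) * s powr (m + 1) \<le> 1 / 2"
    have a: "a > 0" using global_posD(3)[OF g] .
    have so: "sol a f w" using global_posD(2)[OF g] .
    have f0: "f 0 = a" "w 0 = 0" using solD[OF so] by auto
    have fw: "f r > 0" "w r > 0" if "r > 0" for r using global_posD(4,5)[OF g] that by auto
    have fc: "continuous_on {0..r} f" "continuous_on {0..r} w" for r using sol_continuous[OF so] by auto
    have fa: "f r \<le> a" if "r > 0" for r using global_posD(10)[OF g, of 0 r] f0 that by simp
    have w_le: "w r \<le> a * r" if r: "r > 0" for r
    proof -
      have "a * vol 0 - wt 0 * w 0 \<le> a * vol r - wt r * w r"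
      proof (rule DERIV_nonneg_le[where f = "\<lambda>r. a * vol r - wt r * w r"])
        show "continuous_on {0..r} (\<lambda>r. a * vol r - wt r * w r)"
          by (intro continuous_intros vol_continuous wt_continuous fc)
        fix x :: real assume x: "0 < x"
        show "((\<lambda>r. a * vol r - wt r * w r) has_real_derivative a * wt x - wt x * f x) (at x)"
          by (intro DERIV_diff DERIV_cmult vol_DERIV global_posD(8)[OF g] x)
        show "a * wt x - wt x * f x \<ge> 0"
          using mult_left_mono[OF fa[OF x] wt_nonneg[of x]] x by (simp add: mult.commute)
      qed (use r in simp)
      then have "wt r * w r \<le> a * vol r" by (simp add: vol_0 f0)
      also have "vol r \<le> real N * vol r" using real_N vol_nonneg[of r] r by (simp add: mult_le_cancel_right1)
      also have "\<dots> \<le> r * wt r" using vol_le[of r] r by simp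
      finally have "wt r * w r \<le> wt r * (a * r)" using a by (simp add: mult_ac)
      then show ?thesis using wt_pos[OF r] by simp
    qed
    have f_ge: "f r \<ge> a / 2" if r: "0 < r" "r < s" for r
    proof -
      define L where "L = (a * s) powr m"
      have "f 0 + L * 0 \<le> f r + L * r"
      proof (rule DERIV_nonneg_le[where f = "\<lambda>r. f r + L * r"])
        show "continuous_on {0..r} (\<lambda>r. f r + L * r)" by (intro continuous_intros fc)
        fix x :: real assume x: "0 < x" "x < r"
        show "((\<lambda>r. f r + L * r) has_real_derivative - (w x powr m) + L) (at x)"
          by (rule DERIV_cong[OF DERIV_add[OF global_posD(6)[OF g x(1)] DERIV_cmult[OF DERIV_ident]]]) simp
        have "w x \<le> a * s" using w_le[OF x(1)] mult_left_mono[of x s a] x r a by linarith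
        then show "- (w x powr m) + L \<ge> 0" using fw[OF x(1)] m_gt_1 by (simp add: L_def powr_mono2)
      qed (use r in simp)
      moreover have "L * r \<le> L * s" using r by (intro mult_left_mono) (auto simp: L_def)
      moreover have "L * s = a * (a powr (m - 1) * s powr (m + 1))"
      proof -
        have "a powr m = a * a powr (m - 1)" "s powr (m + 1) = s * s powr m"
          using a s by (simp_all add: powr_mult_base add.commute)
        then show ?thesis using a s by (simp add: L_def powr_mult)
      qed
      moreover have "a * (a powr (m - 1) * s powr (m + 1)) \<le> a * (1 / 2)" using as a by (intro mult_left_mono) auto
      ultimately show ?thesis using f0 by simp
    qed
    have w_ge: "w r \<ge> a * r / (6 * real N)" if r: "0 < r" "r < s" for r
    proof -
      have "wt 0 * w 0 - a / 2 * vol 0 \<le> wt r * w r - a / 2 * vol r"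
      proof (rule DERIV_nonneg_le[where f = "\<lambda>r. wt r * w r - a / 2 * vol r"])
        show "continuous_on {0..r} (\<lambda>r. wt r * w r - a / 2 * vol r)"
          by (intro continuous_intros vol_continuous wt_continuous fc)
        fix x :: real assume x: "0 < x" "x < r"
        show "((\<lambda>r. wt r * w r - a / 2 * vol r) has_real_derivative wt x * f x - a / 2 * wt x) (at x)"
          by (intro DERIV_diff DERIV_cmult vol_DERIV global_posD(8)[OF g] x)
        have "f x \<ge> a / 2" using f_ge[of x] x r by simp
        from mult_left_mono[OF this wt_nonneg[of x]] show "wt x * f x - a / 2 * wt x \<ge> 0"
          using x by (simp add: mult.commute)
      qed (use r in simp)
      then have "a / 2 * vol r \<le> wt r * w r" by (simp add: vol_0 f0)
      moreover have "a / 2 * (r ^ N / real N) \<le> a / 2 * vol r" using vol_ge[of r] r a by (intro mult_left_mono) auto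
      moreover have "wt r * w r \<le> r ^ (N - 1) * 3 * w r"
      proof -
        have "exp r \<le> exp 1" using r s sub_radius by simp
        then have "exp r \<le> 3" using exp_le by linarith
        then show ?thesis unfolding wt_def using fw[OF r(1)] r by (intro mult_right_mono mult_left_mono) auto
      qed
      ultimately have "a / 2 * (r ^ N / real N) \<le> r ^ (N - 1) * 3 * w r" by linarith
      moreover have "r ^ N = r ^ (N - 1) * r" using N_pos by (simp add: power_eq_if)
      ultimately have "r ^ (N - 1) * (a / 2 * (r / real N)) \<le> r ^ (N - 1) * (3 * w r)" by (simp add: mult_ac)
      then have "a / 2 * (r / real N) \<le> 3 * w r" by (rule mult_left_le_imp_le) (use r in simp)
      then show ?thesis using real_N by (simp add: field_simps)
    qed
    define K where "K = k * (a * (1 / (6 * real N))) powr (m + 1)"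
    define e where "e = m + real N + 1"
    have e: "e > 0" using m_gt_1 real_N by (simp add: e_def)
    note pos = global_posD(1)[OF g]
    have "poh f w 0 - K / e * 0 powr e \<le> poh f w s - K / e * s powr e"
    proof (rule DERIV_nonneg_le[where f = "\<lambda>r. poh f w r - K / e * r powr e"])
      show "continuous_on {0..s} (\<lambda>r. poh f w r - K / e * r powr e)"
        using e by (intro continuous_intros poh_continuous[OF pos] continuous_on_powr') auto
      fix x :: real assume x: "0 < x" "x < s"
      have "((\<lambda>r. r powr e) has_real_derivative e * x powr (e - 1)) (at x)"
        using x by (intro has_real_derivative_powr)
      from DERIV_cmult[OF this, of "K / e"]
      have "((\<lambda>r. K / e * r powr e) has_real_derivative K * x powr (e - 1)) (at x)" using e by simp
      then show "((\<lambda>r. poh f w r - K / e * r powr e) has_real_derivative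
          w x powr (m + 1) * (wt x * (theta - gain x)) - K * x powr (e - 1)) (at x)"
        by (intro DERIV_diff poh_DERIV[OF pos x(1) order_refl])
      have "k \<le> theta - gain x" using gain_lt_theta[of x, folded k_def] x s by simp
      moreover have "x powr (real N - 1) * 1 \<le> wt x"
      proof -
        have "x powr (real N - 1) = x ^ (N - 1)" using x N_pos by (simp add: powr_realpow[symmetric] of_nat_diff)
        then show ?thesis unfolding wt_def using x by (intro mult_mono) auto
      qed
      ultimately have base: "x powr (real N - 1) * k \<le> wt x * (theta - gain x)"
        using k x wt_nonneg[of x] by (intro mult_mono) auto
      have "(a * (1 / (6 * real N)) * x) powr (m + 1) \<le> w x powr (m + 1)"
        using w_ge[OF x] a x real_N m_gt_1 by (intro powr_mono2) auto
      from mult_mono[OF this base] have "(a * (1 / (6 * real N)) * x) powr (m + 1) * (x powr (real N - 1) * k)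
          \<le> w x powr (m + 1) * (wt x * (theta - gain x))"
        using k by simp
      moreover have "(a * (1 / (6 * real N)) * x) powr (m + 1) * (x powr (real N - 1) * k) = K * x powr (e - 1)"
      proof -
        have "x powr (e - 1) = x powr (m + 1) * x powr (real N - 1)" by (simp add: e_def flip: powr_add)
        then show ?thesis unfolding K_def powr_mult[of "a * (1 / (6 * real N))" x] by simp
      qed
      ultimately show "w x powr (m + 1) * (wt x * (theta - gain x)) - K * x powr (e - 1) \<ge> 0" by simp
    qed (use s in simp)
    then have "K / e * s powr e \<le> poh f w s" using poh_0[OF so] e by simp
    also have "\<dots> \<le> poh f w sub_radius"
    proof (rule poh_mono_sub[OF pos])
      show "gain r \<le> theta" if "s < r" "r < sub_radius" for r
        using gain_lt_theta[of r, folded k_def] that s k by simp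
    qed (use s in auto)
    finally have low: "K / e * s powr e \<le> poh f w sub_radius" .
    have "K / e = c * a powr (m + 1)"
      unfolding K_def c_def e_def powr_mult[of a] by simp
    from low[unfolded this] show "c * a powr (m + 1) * s powr (m + real N + 1) \<le> poh f w sub_radius"
      by (simp add: e_def)
  qed
qed

text \<open>Without crossing, the upper bound at \<open>sub_radius\<close>, independent of a, would
  apply to every a, against a lower bound that is unbounded as a grows.\<close>

lemma crossing_exists: "\<exists>a>0. crossing a"
proof (rule ccontr)
  assume "\<not> ?thesis"
  then have g: "global_pos a (pf a) (pw a)" if "a > 0" for a using crossing_iff[OF that] that by blast
  obtain C where C: "\<And>a f w. global_pos a f w \<Longrightarrow> poh f w sub_radius \<le> C" using poh_sub_radius_bounded by blast
  obtain c where c: "c > 0" "\<And>a f w s. global_pos a f w \<Longrightarrow> 0 < s \<Longrightarrow> s \<le> sub_radius \<Longrightarrow>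
    a powr (m - 1) * s powr (m + 1) \<le> 1 / 2 \<Longrightarrow>
    c * a powr (m + 1) * s powr (m + real N + 1) \<le> poh f w sub_radius" using poh_sub_radius_lower by blast
  \<comment> \<open>With \<open>s = 1 / t\<close> and \<open>a\<close> chosen such that \<open>a powr (m - 1) * s powr (m + 1) = 1 / 2\<close>, the lower bound is a
    constant times \<open>t powr v\<close>, where \<open>v > 0\<close> by subcriticality.\<close>
  define v where "v = 2 * (m + 1) / (m - 1) - real N"
  have v: "v > 0"
  proof -
    have "real N * (m - 1) < 2 * (m + 1)" using subcritical by (simp add: algebra_simps)
    then show ?thesis using m_gt_1 by (simp add: v_def field_simps)
  qed
  define b where "b = c / 2 * (1 / 2) powr (2 / (m - 1))"
  have b: "b > 0" using c by (simp add: b_def)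
  \<comment> \<open>The first entry puts s = 1/t within \<open>sub_radius\<close>, the second makes
    b t^v at least |C| + 1.\<close>
  define t where "t = max (1 / sub_radius) (((\<bar>C\<bar> + 1) / b) powr (1 / v))"
  have t: "t > 0" using sub_radius by (simp add: t_def less_max_iff_disj)
  define a where "a = (t powr (m + 1) / 2) powr (1 / (m - 1))"
  have a: "a > 0" using t by (simp add: a_def)
  have am: "a powr (m - 1) = t powr (m + 1) / 2" using t m_gt_1 by (simp add: a_def powr_powr)
  have ts: "t powr x * (1 / t) powr x = 1" for x using t by (simp flip: powr_mult)
  have as: "a powr (m - 1) * (1 / t) powr (m + 1) = 1 / 2" using ts[of "m + 1"] by (simp add: am)
  have "1 / t \<le> sub_radius"
  proof -
    have "1 / sub_radius \<le> t" by (simp add: t_def)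
    then show ?thesis using t sub_radius by (simp add: field_simps)
  qed
  then have "c * a powr (m + 1) * (1 / t) powr (m + real N + 1) \<le> C"
    using c(2)[OF g[OF a], of "1 / t"] C[OF g[OF a]] t as by force
  moreover have "c * a powr (m + 1) * (1 / t) powr (m + real N + 1) = b * t powr v"
  proof -
    have "a powr (m + 1) = a powr (m - 1) * a powr 2" by (simp add: add.commute flip: powr_add)
    moreover have "(1 / t) powr (m + real N + 1) = (1 / t) powr (m + 1) * (1 / t) powr real N"
      by (simp add: algebra_simps flip: powr_add)
    moreover have "a powr 2 = t powr (2 * (m + 1) / (m - 1)) * (1 / 2) powr (2 / (m - 1))"
      using powr_mult[of "t powr (m + 1)" "1 / 2" "2 / (m - 1)"]
      by (simp add: a_def powr_powr mult.commute)
    moreover have "t powr (2 * (m + 1) / (m - 1)) * (1 / t) powr real N = t powr v"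
      using t by (simp add: v_def powr_diff powr_divide)
    ultimately have "c * a powr (m + 1) * (1 / t) powr (m + real N + 1)
        = c * (a powr (m - 1) * (1 / t) powr (m + 1)) * (1 / 2) powr (2 / (m - 1)) * t powr v"
      by (simp add: mult_ac)
    then show ?thesis unfolding as b_def by simp
  qed
  moreover have "b * t powr v \<ge> \<bar>C\<bar> + 1"
  proof -
    have "(\<bar>C\<bar> + 1) / b = (((\<bar>C\<bar> + 1) / b) powr (1 / v)) powr v"
      using v b by (simp add: powr_powr)
    also have "\<dots> \<le> t powr v" using v by (intro powr_mono2) (auto simp: t_def)
    finally show ?thesis using b by (simp add: field_simps)
  qed
  ultimately show False by linarith
qed


section \<open>Slow initial values and the threshold\<close>

text \<open>The condition concerns a bounded interval and a single radius, so that it passes to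
  nearby initial values; the invariance of the region turns it into a statement about all larger
  radii.\<close>

definition slow :: "real \<Rightarrow> bool" where
  "slow a \<longleftrightarrow> (\<exists>R\<ge>0. (\<forall>r. 0 \<le> r \<and> r \<le> R \<longrightarrow> pf a r > 0) \<and> pf a R < delta \<and> pw a R < 2 * pf a R)"

lemma slowD:
  assumes "slow a" "a > 0"
  obtains R where "R \<ge> 0" "global_pos a (pf a) (pw a)" "pf a R < delta" "pw a R < 2 * pf a R"
    "\<And>r. r \<ge> R \<Longrightarrow> pw a r < 2 * pf a r"
proof -
  obtain R where R: "R \<ge> 0" "\<And>r. 0 \<le> r \<Longrightarrow> r \<le> R \<Longrightarrow> pf a r > 0" "pf a R < delta" "pw a R < 2 * pf a R"
    using assms(1) by (auto simp: slow_def)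
  note inv = slow_region_invariant[OF prof_sol assms(2) R]
  show thesis by (rule that[OF R(1) inv(1) R(3,4) inv(2)])
qed

lemma small_slow:
  assumes "0 < a" "a < delta"
  shows "slow a"
proof -
  have "\<forall>r. 0 \<le> r \<and> r \<le> 0 \<longrightarrow> pf a r > 0" "pf a 0 < delta" "pw a 0 < 2 * pf a 0"
    using solD(3,4)[OF prof_sol, of a] assms by auto
  then show ?thesis unfolding slow_def by blast
qed

lemma slow_open:
  assumes "slow a0" "a0 > 0"
  obtains d where "d > 0" "\<And>a. \<bar>a - a0\<bar> < d \<Longrightarrow> slow a"
proof -
  obtain R where R: "R \<ge> 0" "global_pos a0 (pf a0) (pw a0)" "pf a0 R < delta" "pw a0 R < 2 * pf a0 R"
    using slowD[OF assms] by metis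
  have fR: "pf a0 R > 0" using global_posD(4)[OF R(2,1)] .
  \<comment> \<open>A change of both components by less than e alters 2f - w by less than
    3e.\<close>
  define gap where "gap = (2 * pf a0 R - pw a0 R) / 3"
  define e where "e = min (pf a0 R) (min (delta - pf a0 R) gap)"
  have "gap > 0" using R by (simp add: gap_def)
  then have e: "e > 0" "e \<le> pf a0 R" "e \<le> delta - pf a0 R" "e \<le> gap"
    using R fR by (auto simp: e_def)
  obtain d where d: "d > 0" "\<And>a r. \<bar>a - a0\<bar> < d \<Longrightarrow> 0 \<le> r \<Longrightarrow> r \<le> R \<Longrightarrow>
    \<bar>pf a r - pf a0 r\<bar> < e \<and> \<bar>pw a r - pw a0 r\<bar> < e"
    using prof_close[OF e(1), of a0 R] by auto
  show thesis
  proof (rule that[OF d(1)])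
    fix a assume a: "\<bar>a - a0\<bar> < d"
    have "pf a r > 0" if r: "0 \<le> r" "r \<le> R" for r
    proof -
      have "pf a0 R \<le> pf a0 r" using global_posD(10)[OF R(2) r(1), of R] r by (cases "r = R") auto
      then show ?thesis using d(2)[OF a r] e(2) by linarith
    qed
    moreover have "pf a R < delta" "pw a R < 2 * pf a R" using d(2)[OF a R(1) order_refl] e by (auto simp: gap_def abs_less_iff)
    ultimately show "slow a" using R(1) by (auto simp: slow_def)
  qed
qed

lemma not_slow_bounded_mass:
  assumes g: "global_pos a (pf a) (pw a)" and "\<not> slow a"
  shows "\<exists>C. \<forall>r\<ge>1. wt r * pw a r \<le> C"
proof (rule bounded_mass[OF g])
  fix r :: real assume "0 \<le> r" "pf a r < delta"
  then show "2 * pf a r \<le> pw a r"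
    using assms(2) global_posD(4)[OF g] unfolding slow_def by (meson not_le)
qed

text \<open>Completes a trichotomy of the positive initial values. Fast decay, an asymptotic
  statement, becomes the complement of two open conditions.\<close>

lemma fast_decay_iff:
  assumes a: "a > 0" and p: "(p - 1) * m = 1"
  shows "fast_decay N p (pf a) \<longleftrightarrow> \<not> crossing a \<and> \<not> slow a"
proof
  assume fast: "fast_decay N p (pf a)"
  then have "\<forall>r\<ge>0. pf a r > 0" by (simp add: fast_decay_def)
  then have "\<not> crossing a" unfolding crossing_def by (metis less_imp_le less_irrefl)
  moreover have "\<not> slow a"
  proof
    assume "slow a"
    then obtain R where R: "global_pos a (pf a) (pw a)" "\<And>r. r \<ge> R \<Longrightarrow> pw a r < 2 * pf a r"
      using slowD[OF _ a] by metis
    from slow_not_fast[OF R p] fast show False by blast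
  qed
  ultimately show "\<not> crossing a \<and> \<not> slow a" by blast
next
  assume "\<not> crossing a \<and> \<not> slow a"
  then have g: "global_pos a (pf a) (pw a)" and "\<not> slow a" using crossing_iff[OF a] by auto
  from not_slow_bounded_mass[OF this] show "fast_decay N p (pf a)"
    using fast_asymptotics[OF g _ p] by blast
qed

lemma fast_imp_crossing_above:
  assumes a: "0 < a" "\<not> crossing a" "\<not> slow a" and "a < b"
  shows "crossing b"
proof -
  have g: "global_pos a (pf a) (pw a)" using a crossing_iff by blast
  obtain C where "\<And>r. r \<ge> 1 \<Longrightarrow> wt r * pw a r \<le> C" using not_slow_bounded_mass[OF g a(3)] by blast
  from bounded_mass_not_global[OF g this assms(4)] show ?thesis using crossing_iff[of b] a assms(4) by simp
qed

lemma slow_not_crossing: "slow a \<Longrightarrow> a > 0 \<Longrightarrow> \<not> crossing a"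
  using slowD crossing_iff by metis

lemma threshold_exists: "\<exists>a>0. \<not> crossing a \<and> \<not> slow a"
proof -
  define S where "S = {a. a > 0 \<and> crossing a}"
  define c where "c = Inf S"
  have ne: "S \<noteq> {}" using crossing_exists by (auto simp: S_def)
  \<comment> \<open>Initial values below \<open>delta\<close> satisfy the slow condition already at
    radius 0, which keeps the threshold away from 0.\<close>
  have low: "a \<ge> delta" if "a \<in> S" for a
    using that small_slow[of a] slow_not_crossing[of a] by (force simp: S_def)
  then have bdd: "bdd_below S" by (auto simp: bdd_below_def)
  have "c \<ge> delta" unfolding c_def using ne low by (intro cInf_greatest) auto
  then have c: "c > 0" using delta_pos by simp
  have above: "crossing a" if "a > c" for a
    using that cInf_lessD[OF ne, of a] crossing_mono[of _ a] by (auto simp: c_def S_def)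
  have "\<not> crossing c"
  proof
    assume "crossing c"
    then obtain d where d: "d > 0" "\<And>a. a > 0 \<Longrightarrow> \<bar>a - c\<bar> < d \<Longrightarrow> crossing a"
      using crossing_open by metis
    define a where "a = c - min (d / 2) (c / 2)"
    have "0 < a" "\<bar>a - c\<bar> < d" "a < c" using d(1) c by (auto simp: a_def min_def)
    then have "a \<in> S" using d(2)[of a] by (simp add: S_def)
    from cInf_lower[OF this bdd] \<open>a < c\<close> show False by (simp add: c_def)
  qed
  moreover have "\<not> slow c"
  proof
    assume "slow c"
    then obtain d where d: "d > 0" "\<And>a. \<bar>a - c\<bar> < d \<Longrightarrow> slow a" using slow_open[OF _ c] by metis
    show False using d(2)[of "c + d / 2"] d(1) c above[of "c + d / 2"] slow_not_crossing[of "c + d / 2"] by auto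
  qed
  ultimately show ?thesis using c by blast
qed

end

section \<open>Existence, uniqueness and classification in terms of \<open>p\<close>\<close>

theorem theorem2p1:
  fixes N :: nat and p :: real
  assumes "N \<ge> 1" and "2 * real N / (real N + 1) < p" and "p < 2"
  shows "\<exists>f :: real \<Rightarrow> real \<Rightarrow> real.
    (\<forall>a>0. is_solution N p a (f a) \<and>
           (\<forall>g. is_solution N p a g \<longrightarrow> (\<forall>r\<ge>0. g r = f a r))) \<and>
    (\<exists>!a_star. a_star > 0 \<and> fast_decay N p (f a_star)) \<and>
    (\<forall>a_star. a_star > 0 \<and> fast_decay N p (f a_star) \<longrightarrow>
      (\<forall>a. 0 < a \<and> a < a_star \<longrightarrow>
         (\<forall>r\<ge>0. f a r > 0) \<and>
         f a \<sim>[at_top] (\<lambda>r. ((2 - p) / (p - 1) * r) powr (- (p - 1) / (2 - p)))) \<and>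
      (\<forall>a>a_star.
         (\<exists>R>0. (\<forall>r. 0 < r \<and> r < R \<longrightarrow> f a r > 0) \<and> f a R = 0 \<and> deriv_halfline (f a) R < 0) \<and>
         (\<exists>r>0. \<exists>s>0. f a r > 0 \<and> f a s < 0)))"
proof -
  define m where "m = 1 / (p - 1)"
  have pN: "2 * real N < p * (real N + 1)" using assms(2) by (simp add: divide_less_eq)
  have "2 * real N / (real N + 1) \<ge> 1" using assms(1) by (simp add: le_divide_eq)
  then have p1: "p > 1" using assms(2) by linarith
  have pm: "(p - 1) * m = 1" using p1 by (simp add: m_def)
  have m1: "m > 1" using p1 assms(3) by (simp add: m_def)
  \<comment> \<open>The lower bound on p amounts to (N - 1) m < N + 1; subtracting m > 1 leads to
    the subcriticality of the system.\<close>
  have sub: "(real N - 2) * m < real N + 2"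
  proof -
    have "(real N - 1) * 1 < (real N + 1) * (p - 1)" using pN by (simp add: algebra_simps)
    then have "(real N - 1) * m < real N + 1" using p1 by (simp add: m_def divide_less_eq)
    then show ?thesis using m1 by (simp add: algebra_simps)
  qed
  interpret radial_system N m using assms(1) m1 sub by unfold_locales
  have m_minus_1: "m - 1 = (2 - p) / (p - 1)" using p1 by (simp add: m_def field_simps)
  then have "- (1 / (m - 1)) = - (p - 1) / (2 - p)"
    unfolding m_minus_1 using p1 assms(3) by (simp add: field_simps)
  with m_minus_1 have slow_form: "(\<lambda>r. ((m - 1) * r) powr (- (1 / (m - 1))))
      = (\<lambda>r. ((2 - p) / (p - 1) * r) powr (- (p - 1) / (2 - p)))"
    by (simp only:)
  have not_less: "\<not> a < b" if "a > 0" "fast_decay N p (pf a)" "b > 0" "fast_decay N p (pf b)" for a b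
  proof
    assume "a < b"
    have "\<not> crossing a" "\<not> slow a" "\<not> crossing b"
      using that by (simp_all add: fast_decay_iff[OF _ pm])
    with fast_imp_crossing_above[OF that(1) _ _ \<open>a < b\<close>] show False by blast
  qed
  have uniq: "a = b" if "a > 0" "fast_decay N p (pf a)" "b > 0" "fast_decay N p (pf b)" for a b
    using not_less[OF that] not_less[OF that(3,4,1,2)] by simp
  show ?thesis
  proof (intro exI[of _ pf] conjI allI impI)
    fix a :: real
    show "is_solution N p a (pf a)" by (rule sol_imp_is_solution[OF prof_sol pm])
    fix g r assume g: "is_solution N p a g" and r: "0 \<le> (r::real)"
    show "g r = pf a r"
      using is_solution_imp_sol[OF g pm] prof_sol[of a] r
      by (intro sol_unique(1)[of r a]) (auto simp: sol_def)
  next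
    obtain a where "a > 0" "\<not> crossing a \<and> \<not> slow a" using threshold_exists by blast
    then have a: "a > 0 \<and> fast_decay N p (pf a)" by (simp add: fast_decay_iff[OF _ pm])
    show "\<exists>!a_star. a_star > 0 \<and> fast_decay N p (pf a_star)"
      using a uniq by (intro ex1I[of _ a]) blast+
  next
    fix a_star a assume "a_star > 0 \<and> fast_decay N p (pf a_star)" and a: "0 < a \<and> a < a_star"
    then have star: "\<not> crossing a_star" by (simp add: fast_decay_iff[OF _ pm])
    then have "\<not> crossing a" using crossing_mono a by blast
    \<comment> \<open>If a were neither crossing nor slow, it would be a second fast value, and
      everything above it, \<open>a_star\<close> included, would cross.\<close>
    moreover have "slow a" using fast_imp_crossing_above[of a a_star] a star calculation by blast
    ultimately obtain R where R: "global_pos a (pf a) (pw a)" "\<And>r. r \<ge> R \<Longrightarrow> pw a r < 2 * pf a r"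
      using slowD a by metis
    show "pf a r > 0" if "0 \<le> r" for r using global_posD(4)[OF R(1) that] .
    show "pf a \<sim>[at_top] (\<lambda>r. ((2 - p) / (p - 1) * r) powr (- (p - 1) / (2 - p)))"
      using slow_asymptotics[OF R] unfolding slow_form .
  next
    fix a_star a assume "a_star > 0 \<and> fast_decay N p (pf a_star)" and a: "a_star < a"
    then have "crossing a" using fast_imp_crossing_above[of a_star a] by (auto simp: fast_decay_iff[OF _ pm])
    then obtain R where R: "R > 0" "pos_on R a (pf a) (pw a)" "pf a R = 0" by (auto simp: crossing_def)
    show "\<exists>R>0. (\<forall>r. 0 < r \<and> r < R \<longrightarrow> pf a r > 0) \<and> pf a R = 0 \<and> deriv_halfline (pf a) R < 0"
      using R crossing_slope(1)[OF R] by (auto simp: pos_on_def intro!: exI[of _ R])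
    obtain s where "s > R" "pf a s < 0" using crossing_slope(2)[OF R] by blast
    moreover have "pf a (R / 2) > 0" using R by (auto simp: pos_on_def)
    ultimately show "\<exists>r>0. \<exists>s>0. pf a r > 0 \<and> pf a s < 0"
      using R(1) by (intro exI[of _ "R / 2"] conjI exI[of _ s]) auto
  qed
qed

end
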